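(* Let $a<b$ be real numbers and let $G:\mathbb{N}\to\mathbb{R}_+$ be a decreasing function such that $G(0)=1$ and $\lim_{n\to\infty}G(n)=0$. Let $\Delta G(n)=G(n)-G(n+1)$, $n\ge0$, and $$M_t^{\downarrow,G}=\sum_{n\ge0}\Big\{1_{[\sigma_{2n},\sigma_{2n+1}[}(t)\Big(\frac{G(n)}2\Big(1+\frac{b-X_t}{b-a}\Big)+\frac{G(n+1)}2\,\frac{X_t-a}{b-a}\Big)+1_{[\sigma_{2n+1},\sigma_{2n+2}[}(t)\Big(\frac{G(n+1)}2\Big(1+\frac{b-X_t}{b-a}\Big)+\frac{G(n)}2\,\frac{X_t-a}{b-a}\Big)\Big\}.$$ 1. Let $s\ge0$ and $\Gamma_s\in\mathcal{F}_s$. Then $$\lim_{t\to\infty}\frac{E_0[1_{\Gamma_s}\Delta G(D_t)]}{E_0[\Delta G(D_t)]}=\frac{1}{M_0^{\downarrow,G}}E_0[1_{\Gamma_s}M_s^{\downarrow,G}].$$ 2. Let $Q_0^{\downarrow,G}$ be the probability measure on $(\Omega,\mathcal{F}_\infty)$ defined by $Q_0^{\downarrow,G}(\Gamma_s)=\frac{1}{M_0^{\downarrow,G}}E_0[1_{\Gamma_s}M_s^{\downarrow,G}]$ for any $s\ge0$ and $\Gamma_s\in\mathcal{F}_s$. Then the process $$X_t-\int_0^t\big(G(1+D_s)-G(D_s)\big)\Big\{\frac{1_{\{s<\sigma_{2D_s+1}\}}}{G(D_s)(2b-X_s-a)+G(1+D_s)(X_s-a)}-\frac{1_{\{\sigma_{2D_s+1}\le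 s\}}}{G(1+D_s)(2b-X_s-a)+G(D_s)(X_s-a)}\Big\}ds,\quad t\ge0,$$ is a $Q_0^{\downarrow,G}$-Brownian motion.
   Context: $\Omega=\mathcal{C}(\mathbb{R}_+,\mathbb{R})$ is the canonical space, $(X_t)_{t\ge0}$ the coordinate process, $\mathcal{F}_t=\sigma(X_s;0\le s\le t)$, $\mathcal{F}_\infty=\sigma(X_s;s\ge0)$; $P_0$ is the Wiener measure started at $0$, with expectation $E_0$. Stopping times: $\sigma_0=0$, and for $n\ge0$, $\sigma_{2n+1}=\inf\{t\ge\sigma_{2n};X_t>b\}$, $\sigma_{2n+2}=\inf\{t\ge\sigma_{2n+1};X_t<a\}$. $D_t=\sum_{n\ge1}1_{\{\sigma_{2n}\le t\}}$ is the number of down-crossings from level $b$ to level $a$ up to time $t$; thus $\sigma_{2D_t}\le t<\sigma_{2D_t+2}$. The process $(M_t^{\downarrow,G})$ is a $P_0$-martingale, and $M_0^{\downarrow,G}$ is a deterministic constant $P_0$-a.s. *)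

theory Defs
  imports "HOL-Probability.Probability"
begin

text \<open>Elements of \<open>C(\<real>\<^sub>+, \<real>)\<close> are functions on the whole type \<^typ>\<open>real\<close>, pinned to
  \<^const>\<open>undefined\<close> on the negative half-line so that a path is determined by its values at
  nonnegative times.\<close>

definition path_space :: "(real \<Rightarrow> real) set" where
  "path_space = {\<omega> \<in> extensional {0..}. continuous_on {0..} \<omega>}"

definition coord_algebra :: "real set \<Rightarrow> (real \<Rightarrow> real) measure" where
  "coord_algebra T =
     sigma path_space {{\<omega> \<in> path_space. \<omega> s \<in> A} | s A. s \<in> T \<and> A \<in> sets borel}"

text \<open>The natural filtration, neither completed nor made right-continuous.\<close>

definition path_filtration :: "real \<Rightarrow> (real \<Rightarrow> real) measure" where
  "path_filtration t = coord_algebra {0..t}"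

definition path_algebra :: "(real \<Rightarrow> real) measure" where
  "path_algebra = coord_algebra {0..}"

text \<open>Standard Brownian motion started at 0, relative to a filtration indexed by the nonnegative
  times.\<close>

definition brownian_motion ::
    "'a measure \<Rightarrow> (real \<Rightarrow> 'a measure) \<Rightarrow> (real \<Rightarrow> 'a \<Rightarrow> real) \<Rightarrow> bool" where
  "brownian_motion N F B \<longleftrightarrow>
     prob_space N \<and>
     (\<forall>t\<ge>0. B t \<in> borel_measurable (F t)) \<and>
     (AE \<omega> in N. B 0 \<omega> = 0) \<and>
     (AE \<omega> in N. continuous_on {0..} (\<lambda>t. B t \<omega>)) \<and>
     (\<forall>s t. 0 \<le> s \<and> s < t \<longrightarrow>
        distributed N lborel (\<lambda>\<omega>. B t \<omega> - B s \<omega>) (normal_density 0 (sqrt (t - s))) \<and>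
        prob_space.indep_set N (sets (F s))
          {(\<lambda>\<omega>. B t \<omega> - B s \<omega>) -` A \<inter> space N | A. A \<in> sets borel})"

definition wiener_measure :: "(real \<Rightarrow> real) measure \<Rightarrow> bool" where
  "wiener_measure P \<longleftrightarrow>
     sets P = sets path_algebra \<and> brownian_motion P path_filtration (\<lambda>t \<omega>. \<omega> t)"

text \<open>The infimum of the empty set is \<open>\<infinity>\<close> in \<^typ>\<open>ereal\<close>, as usual for hitting times.\<close>

primrec crossing_time :: "real \<Rightarrow> real \<Rightarrow> nat \<Rightarrow> (real \<Rightarrow> real) \<Rightarrow> ereal" where
  "crossing_time a b 0 \<omega> = 0"
| "crossing_time a b (Suc k) \<omega> =
     Inf {ereal t | t. 0 \<le> t \<and> crossing_time a b k \<omega> \<le> ereal t \<and>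
                       (if even k then \<omega> t > b else \<omega> t < a)}"

text \<open>For \<open>a < b\<close> the set below is finite, since a continuous path crosses from \<open>b\<close> to \<open>a\<close> only
  finitely often on a compact time interval.\<close>

definition downcrossings :: "real \<Rightarrow> real \<Rightarrow> real \<Rightarrow> (real \<Rightarrow> real) \<Rightarrow> nat" where
  "downcrossings a b t \<omega> = card {n. 1 \<le> n \<and> crossing_time a b (2 * n) \<omega> \<le> ereal t}"

definition Delta :: "(nat \<Rightarrow> real) \<Rightarrow> nat \<Rightarrow> real" where
  "Delta G n = G n - G (n + 1)"

definition M_down ::
    "real \<Rightarrow> real \<Rightarrow> (nat \<Rightarrow> real) \<Rightarrow> real \<Rightarrow> (real \<Rightarrow> real) \<Rightarrow> real" where
  "M_down a b G t \<omega> = (\<Sum>n.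
     indicator {crossing_time a b (2 * n) \<omega> ..< crossing_time a b (2 * n + 1) \<omega>} (ereal t) *
       (G n / 2 * (1 + (b - \<omega> t) / (b - a)) + G (n + 1) / 2 * ((\<omega> t - a) / (b - a))) +
     indicator {crossing_time a b (2 * n + 1) \<omega> ..< crossing_time a b (2 * n + 2) \<omega>} (ereal t) *
       (G (n + 1) / 2 * (1 + (b - \<omega> t) / (b - a)) + G n / 2 * ((\<omega> t - a) / (b - a))))"

definition drift_down ::
    "real \<Rightarrow> real \<Rightarrow> (nat \<Rightarrow> real) \<Rightarrow> real \<Rightarrow> (real \<Rightarrow> real) \<Rightarrow> real" where
  "drift_down a b G s \<omega> =
     (let D = downcrossings a b s \<omega> in
      (G (1 + D) - G D) *
        (of_bool (ereal s < crossing_time a b (2 * D + 1) \<omega>) /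
           (G D * (2 * b - \<omega> s - a) + G (1 + D) * (\<omega> s - a))
         - of_bool (crossing_time a b (2 * D + 1) \<omega> \<le> ereal s) /
           (G (1 + D) * (2 * b - \<omega> s - a) + G D * (\<omega> s - a))))"

end

theory Submission
  imports Defs "HOL-Real_Asymp.Real_Asymp"
begin

text \<open>Number the phases of a path so that phase \<open>k\<close> lasts from the \<open>k\<close>-th to the \<open>(k+1)\<close>-st crossing
  time. A coefficient depending on the phase only has a pathwise stochastic integral against the
  coordinate process \<open>X\<close>, which is the limit of Riemann sums with \<open>F\<^sub>s\<close>-measurable coefficients; hence
  its exponential martingale identity follows from the one for finite sums of independent Gaussian
  increments, and no general stochastic calculus is needed.

  With coefficients \<open>\<plusminus>1\<close> the integral is again a Brownian motion. Choosing \<open>+1\<close> in even and \<open>-1\<close> in odd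
  phases unfolds the path: the \<open>n\<close>-th down-crossing is completed when the unfolded path first reaches
  a level linear in \<open>n\<close>. Flipping the signs once more after that time gives the reflection principle,
  so the conditional law of the down-crossing times is explicit and its \<open>t\<^sup>-\<^sup>1\<^sup>/\<^sup>2\<close> asymptotics yields the
  penalised limit.

  The process \<open>M\<close> is itself such an integral. Differentiating the exponential martingale of
  \<open>l * X + \<mu> * M\<close> at \<open>\<mu> = 0\<close> gives Girsanov's theorem for bounded drifts by a pathwise integration
  by parts. The true drift is the coefficient of \<open>M\<close> divided by \<open>M\<close>: it is unbounded near \<open>M = 0\<close>, but
  its absolute value has bounded expectation under the penalised measure, so bounded approximations
  suffice.\<close>

section \<open>Independent Gaussian increments\<close>

text \<open>The filtration is raw: the event t < \<sigma> (Suc k) depends on the path just after t,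
  so the phase is not adapted. But consecutive phases give the same affine function of the path at
  the level where they meet; for t > 0 the phase can therefore be traded for its left limit, whose
  events t \<le> \<sigma> (Suc k) are adapted. Reflection works between fixed times s < t. If y is
  the way still to go at s, and D, D' are the increments of the unfolded path and of its reflected
  version, then reaching the goal by t is, up to a null set, the disjoint union of D > y and D' <
  -y. Both increments are N(0, t - s) independent of \<open>F s\<close>, so the goal is missed with
  conditional probability P(|N| \<le> y), asymptotically y times sqrt (2 / (\<pi> (t - s))).
  Weighting the differences of consecutive distances with \<open>Delta G n\<close> and summing over
  n gives 2 (b - a) M at time s. The distances grow with n, but their differences have one
  integrable bound for all n, which dominates the series. Imaginary exponents keep the exponential
  factors bounded; normality and independence are both read off characteristic functions.\<close>

abbreviation gauss :: "real \<Rightarrow> real measure" where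
  "gauss h \<equiv> density lborel (normal_density 0 (sqrt h))"

text \<open>The two increment clauses of \<open>brownian_motion\<close> as one predicate, with
  \<open>h\<close> the variance. It serves both to extract these clauses from the Wiener measure and
  to establish them for other processes.\<close>

definition gaussian_indep :: "'a measure \<Rightarrow> 'a measure \<Rightarrow> real \<Rightarrow> ('a \<Rightarrow> real) \<Rightarrow> bool" where
  "gaussian_indep M F h D \<longleftrightarrow> distributed M lborel D (normal_density 0 (sqrt h)) \<and>
     prob_space.indep_set M (sets F) {D -` A \<inter> space M | A. A \<in> sets borel}"

lemma real_distribution_gauss: "0 < h \<Longrightarrow> real_distribution (gauss h)"
  by (auto simp: real_distribution_def real_distribution_axioms_def intro!: prob_space_normal_density)

lemma gauss_eq_distr_std:
  assumes "0 < h"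
  shows "distr (gauss h) borel (\<lambda>x. x / sqrt h) = std_normal_distribution"
proof -
  interpret real_distribution "gauss h" by (rule real_distribution_gauss[OF assms])
  have "distributed (gauss h) lborel (\<lambda>x. x) (normal_density 0 (sqrt h))"
    unfolding distributed_def by (auto simp: distr_id2)
  then have "distributed (gauss h) lborel (\<lambda>x. (x - 0) / sqrt h) std_normal_density"
    using normal_standard_normal_convert[of "sqrt h" "\<lambda>x. x" 0] assms by simp
  then show ?thesis
    unfolding distributed_def by (simp cong: distr_cong)
qed

lemma char_gauss:
  assumes "0 < h"
  shows "char (gauss h) l = exp (- (l\<^sup>2 * h / 2))"
proof -
  have "char (gauss h) l = (CLINT x|gauss h. iexp ((l * sqrt h) * (x / sqrt h)))"
    using assms by (simp add: char_def)
  also have "\<dots> = char (distr (gauss h) borel (\<lambda>x. x / sqrt h)) (l * sqrt h)"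
    unfolding char_def by (subst integral_distr) auto
  also have "\<dots> = exp (- (l\<^sup>2 * h / 2))"
    using assms by (simp add: gauss_eq_distr_std char_std_normal_distribution power_mult_distrib)
  finally show ?thesis .
qed

lemma gaussian_indep_measurable:
  "gaussian_indep M F h D \<Longrightarrow> D \<in> borel_measurable M"
  unfolding gaussian_indep_def distributed_def by (auto simp: measurable_lborel1)

lemma gaussian_indep_distr:
  assumes "gaussian_indep M F h D"
  shows "distr M borel D = gauss h"
  using assms unfolding gaussian_indep_def distributed_def by (auto cong: distr_cong)

lemma gaussian_indep_joint:
  assumes "prob_space M" "subalgebra M F" "gaussian_indep M F h D"
  shows "distr M (F \<Otimes>\<^sub>M borel) (\<lambda>\<omega>. (\<omega>, D \<omega>)) = distr M F (\<lambda>\<omega>. \<omega>) \<Otimes>\<^sub>M gauss h"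
proof -
  interpret prob_space M by fact
  have D[measurable]: "D \<in> borel_measurable M" by (rule gaussian_indep_measurable[OF assms(3)])
  have sp: "space F = space M" and sb: "sets F \<subseteq> sets M" using assms(2) by (auto simp: subalgebra_def)
  have id: "(\<lambda>\<omega>. \<omega>) \<in> measurable M F"
    using sb sp by (auto intro!: measurableI)
  interpret G: prob_space "gauss h"
    unfolding gaussian_indep_distr[OF assms(3), symmetric] by (rule prob_space_distr[OF D])
  interpret MF: prob_space "distr M F (\<lambda>\<omega>. \<omega>)" by (rule prob_space_distr[OF id])
  have pm[measurable]: "(\<lambda>\<omega>. (\<omega>, D \<omega>)) \<in> measurable M (F \<Otimes>\<^sub>M borel)"
    by (rule measurable_Pair[OF id D])
  show ?thesis
  proof (rule pair_measure_eqI[symmetric])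
    show "sigma_finite_measure (distr M F (\<lambda>\<omega>. \<omega>))" "sigma_finite_measure (gauss h)"
      by unfold_locales
    show "sets (distr M F (\<lambda>\<omega>. \<omega>) \<Otimes>\<^sub>M gauss h) = sets (distr M (F \<Otimes>\<^sub>M borel) (\<lambda>\<omega>. (\<omega>, D \<omega>)))"
      by (simp cong: sets_pair_measure_cong)
    fix A B assume "A \<in> sets (distr M F (\<lambda>\<omega>. \<omega>))" "B \<in> sets (gauss h)"
    then have A: "A \<in> sets F" and B: "B \<in> sets borel" by auto
    have AM: "A \<in> sets M" using A sb by auto
    have "prob (A \<inter> (D -` B \<inter> space M)) = prob A * prob (D -` B \<inter> space M)"
      using assms(3) A B unfolding gaussian_indep_def by (intro indep_setD) auto
    moreover have "(\<lambda>\<omega>. (\<omega>, D \<omega>)) -` (A \<times> B) \<inter> space M = A \<inter> (D -` B \<inter> space M)"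
      using A sets.sets_into_space[of A F] sp by auto
    moreover have "(\<lambda>\<omega>. \<omega>) -` A \<inter> space M = A" using A sets.sets_into_space[of A F] sp by auto
    ultimately show "emeasure (distr M F (\<lambda>\<omega>. \<omega>)) A * emeasure (gauss h) B =
        emeasure (distr M (F \<Otimes>\<^sub>M borel) (\<lambda>\<omega>. (\<omega>, D \<omega>))) (A \<times> B)"
      unfolding gaussian_indep_distr[OF assms(3), symmetric]
      using A B AM id D by (simp add: emeasure_distr emeasure_eq_measure ennreal_mult')
  qed
qed

text \<open>Conditioning on \<open>F\<close> in integral form: everything measurable in
  \<open>F\<close> is held fixed while the increment is integrated against its own law. This is
  Fubini for the product law in \<open>gaussian_indep_joint\<close>.\<close>

lemma gaussian_indep_freeze:
  fixes f :: "'a \<times> real \<Rightarrow> 'b::{banach, second_countable_topology}"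
  assumes M: "prob_space M" and F: "subalgebra M F" and D: "gaussian_indep M F h D" "0 < h"
    and f[measurable]: "f \<in> borel_measurable (F \<Otimes>\<^sub>M borel)"
    and int: "integrable M (\<lambda>\<omega>. f (\<omega>, D \<omega>))"
  shows "(\<integral>\<omega>. f (\<omega>, D \<omega>) \<partial>M) = (\<integral>\<omega>. (\<integral>x. f (\<omega>, x) \<partial>gauss h) \<partial>M)"
    and "integrable M (\<lambda>\<omega>. \<integral>x. f (\<omega>, x) \<partial>gauss h)"
proof -
  interpret prob_space M by fact
  have [measurable]: "D \<in> borel_measurable M" by (rule gaussian_indep_measurable[OF D(1)])
  have id[measurable]: "(\<lambda>\<omega>. \<omega>) \<in> measurable M F"
    using F by (auto intro!: measurableI simp: subalgebra_def)
  interpret G: real_distribution "gauss h" by (rule real_distribution_gauss[OF D(2)])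
  interpret MF: prob_space "distr M F (\<lambda>\<omega>. \<omega>)" by (rule prob_space_distr) measurable
  interpret pair_sigma_finite "distr M F (\<lambda>\<omega>. \<omega>)" "gauss h" ..
  have fm: "f \<in> borel_measurable (F \<Otimes>\<^sub>M gauss h)"
    using f by (simp cong: measurable_cong_sets)
  have ii: "integrable (distr M F (\<lambda>\<omega>. \<omega>) \<Otimes>\<^sub>M gauss h) f"
    unfolding gaussian_indep_joint[OF M F D(1), symmetric]
    using int by (subst integrable_distr_eq) auto
  have m2: "(\<lambda>\<omega>. \<integral>x. f (\<omega>, x) \<partial>gauss h) \<in> borel_measurable F"
    using G.borel_measurable_lebesgue_integral[of "\<lambda>\<omega> x. f (\<omega>, x)" F] fm by simp
  have "(\<integral>\<omega>. f (\<omega>, D \<omega>) \<partial>M) = integral\<^sup>L (distr M (F \<Otimes>\<^sub>M borel) (\<lambda>\<omega>. (\<omega>, D \<omega>))) f"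
    by (subst integral_distr) auto
  also have "\<dots> = (\<integral>\<omega>. (\<integral>x. f (\<omega>, x) \<partial>gauss h) \<partial>distr M F (\<lambda>\<omega>. \<omega>))"
    unfolding gaussian_indep_joint[OF M F D(1)] by (rule integral_fst'[symmetric, OF ii])
  also have "\<dots> = (\<integral>\<omega>. (\<integral>x. f (\<omega>, x) \<partial>gauss h) \<partial>M)"
    using m2 by (subst integral_distr) auto
  finally show "(\<integral>\<omega>. f (\<omega>, D \<omega>) \<partial>M) = (\<integral>\<omega>. (\<integral>x. f (\<omega>, x) \<partial>gauss h) \<partial>M)" .
  show "integrable M (\<lambda>\<omega>. \<integral>x. f (\<omega>, x) \<partial>gauss h)"
    using integrable_fst'[OF ii] m2 by (subst (asm) integrable_distr_eq) auto
qed

lemma gaussian_indep_region: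
  assumes M: "prob_space M" and F: "subalgebra M F" and D: "gaussian_indep M F h D" "0 < h"
    and A[measurable]: "A \<in> sets F"
    and R[measurable]: "Measurable.pred (F \<Otimes>\<^sub>M borel) (\<lambda>p. R (fst p) (snd p))"
  shows "(\<integral>\<omega>. indicator A \<omega> * (if R \<omega> (D \<omega>) then 1 else 0) \<partial>M) =
      (\<integral>\<omega>. indicator A \<omega> * measure (gauss h) {x. R \<omega> x} \<partial>M)"
    and "integrable M (\<lambda>\<omega>. indicator A \<omega> * measure (gauss h) {x. R \<omega> x})"
proof -
  interpret prob_space M by fact
  have Dm: "D \<in> borel_measurable M" by (rule gaussian_indep_measurable[OF D(1)])
  have id: "(\<lambda>\<omega>. \<omega>) \<in> measurable M F"
    using F by (auto intro!: measurableI simp: subalgebra_def)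
  let ?f = "\<lambda>p. indicator A (fst p) * (if R (fst p) (snd p) then 1 else (0::real))"
  have m: "?f \<in> borel_measurable (F \<Otimes>\<^sub>M borel)" by measurable
  have i: "integrable M (\<lambda>\<omega>. ?f (\<omega>, D \<omega>))"
    by (rule integrable_const_bound[of _ 1])
       (auto simp: indicator_def intro!: measurable_compose[OF measurable_Pair[OF id Dm] m, simplified])
  have inner: "(\<integral>x. ?f (\<omega>, x) \<partial>gauss h) = indicator A \<omega> * measure (gauss h) {x. R \<omega> x}" for \<omega>
  proof -
    have "(\<integral>x. ?f (\<omega>, x) \<partial>gauss h) = (\<integral>x. indicator A \<omega> * indicator {x. R \<omega> x} x \<partial>gauss h)"
      by (intro Bochner_Integration.integral_cong) (auto simp: indicator_def)
    then show ?thesis by simp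
  qed
  show "(\<integral>\<omega>. indicator A \<omega> * (if R \<omega> (D \<omega>) then 1 else 0) \<partial>M) =
      (\<integral>\<omega>. indicator A \<omega> * measure (gauss h) {x. R \<omega> x} \<partial>M)"
    "integrable M (\<lambda>\<omega>. indicator A \<omega> * measure (gauss h) {x. R \<omega> x})"
    using gaussian_indep_freeze[OF M F D m i] unfolding inner by simp_all
qed

text \<open>A Gaussian law has no atoms, and the target \<open>y\<close> is a constant once
  \<open>F\<close> is frozen.\<close>

lemma gaussian_indep_null:
  assumes M: "prob_space M" and F: "subalgebra M F" and D: "gaussian_indep M F h D" "0 < h"
    and y[measurable]: "y \<in> borel_measurable F"
  shows "AE \<omega> in M. D \<omega> \<noteq> y \<omega>"
proof -
  interpret prob_space M by fact
  have Dm[measurable]: "D \<in> borel_measurable M" by (rule gaussian_indep_measurable[OF D(1)])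
  have ym[measurable]: "y \<in> borel_measurable M" by (rule measurable_from_subalg[OF F y])
  have spF: "space F = space M" using F by (simp add: subalgebra_def)
  have "emeasure (gauss h) {x} = 0" for x
    by (subst emeasure_density) (auto simp: nn_integral_indicator_singleton)
  then have z: "measure (gauss h) {x. x = y \<omega>} = 0" for \<omega> by (simp add: measure_def)
  have "(\<integral>\<omega>. indicator (space M) \<omega> * (if D \<omega> = y \<omega> then 1 else 0) \<partial>M) = (0 :: real)"
    using gaussian_indep_region(1)[OF M F D sets.top, of "\<lambda>\<omega> x. x = y \<omega>"] unfolding z spF by simp
  moreover have "integrable M (\<lambda>\<omega>. indicator (space M) \<omega> * (if D \<omega> = y \<omega> then 1 else 0 :: real))"
    by (rule integrable_const_bound[of _ 1]) (auto simp: indicator_def)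
  ultimately have "AE \<omega> in M. indicator (space M) \<omega> * (if D \<omega> = y \<omega> then 1 else 0 :: real) = 0"
    by (subst (asm) integral_nonneg_eq_0_iff_AE) auto
  then show ?thesis
    using AE_space by eventually_elim (auto split: if_splits)
qed

text \<open>For \<open>A\<close> of positive probability the hypothesis says that, conditionally on
  \<open>A\<close>, the variable has the characteristic function of \<open>gauss h\<close>;
  uniqueness then gives its conditional law. For a null set the product formula is trivial. A
  martingale identity thus yields normality and independence together.\<close>

lemma gaussian_indepI_char:
  assumes M: "prob_space M" and F: "subalgebra M F" and D[measurable]: "D \<in> borel_measurable M" and h: "0 < h"
    and c: "\<And>A l. A \<in> sets F \<Longrightarrow>
      (CLINT \<omega>|M. indicator A \<omega> * iexp (l * D \<omega>)) = measure M A * exp (- (l\<^sup>2 * h / 2))"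
  shows "gaussian_indep M F h D"
proof -
  interpret prob_space M by fact
  have spF: "space F = space M" and sb: "sets F \<subseteq> sets M" using F by (auto simp: subalgebra_def)
  have key: "measure M (A \<inter> (D -` B \<inter> space M)) = measure M A * measure (gauss h) B"
    if A: "A \<in> sets F" and B: "B \<in> sets borel" for A B
  proof (cases "measure M A = 0")
    case True
    have "measure M (A \<inter> (D -` B \<inter> space M)) \<le> measure M A"
      using A sb by (intro finite_measure_mono) auto
    then show ?thesis using True measure_nonneg[of M] by (simp add: order_antisym)
  next
    case False
    have AM[measurable]: "A \<in> sets M" using A sb by auto
    have A0: "emeasure M A \<noteq> 0" "emeasure M A \<noteq> \<infinity>" using False by (auto simp: measure_def)
    let ?U = "uniform_measure M A"
    interpret U: prob_space ?U by (rule prob_space_uniform_measure[OF A0])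
    have DU[measurable]: "D \<in> borel_measurable ?U" by simp
    interpret DD: real_distribution "distr ?U borel D"
      by (rule U.real_distribution_distr) auto
    have "distr ?U borel D = gauss h"
    proof (rule Levy_uniqueness[OF DD.real_distribution_axioms real_distribution_gauss[OF h]], rule ext)
      fix l
      have U: "?U = density M (\<lambda>x. ennreal (indicator A x / measure M A))"
        unfolding uniform_measure_def using False zero_less_measure_iff[of M A]
        by (intro density_cong) (auto simp: emeasure_eq_measure indicator_def divide_ennreal simp flip: ennreal_1)
      have "char (distr ?U borel D) l = (CLINT \<omega>|?U. iexp (l * D \<omega>))"
        unfolding char_def by (subst integral_distr) auto
      also have "\<dots> = (CLINT \<omega>|M. (indicator A \<omega> / measure M A) *\<^sub>R iexp (l * D \<omega>))"
        unfolding U by (subst integral_density) auto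
      also have "\<dots> = (CLINT \<omega>|M. (1 / measure M A) *\<^sub>R (indicator A \<omega> * iexp (l * D \<omega>)))"
        by (intro Bochner_Integration.integral_cong) (auto simp: indicator_def scaleR_conv_of_real)
      also have "\<dots> = exp (- (l\<^sup>2 * h / 2))"
        by (subst integral_scaleR_right, subst c[OF A]) (use False in \<open>simp add: scaleR_conv_of_real\<close>)
      finally show "char (distr ?U borel D) l = char (gauss h) l"
        by (simp add: char_gauss[OF h])
    qed
    then have "measure (gauss h) B = measure ?U (D -` B \<inter> space M)"
      using B by (metis measure_distr DU space_uniform_measure)
    also have "\<dots> = measure M (A \<inter> (D -` B \<inter> space M)) / measure M A"
      using B A0 by (subst measure_uniform_measure) auto
    finally show ?thesis using False by simp
  qed
  interpret G: real_distribution "gauss h" by (rule real_distribution_gauss[OF h])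
  have d: "distr M borel D = gauss h"
  proof (rule measure_eqI)
    fix B assume B: "B \<in> sets (distr M borel D)"
    then have B': "B \<in> sets borel" by simp
    have "measure M (D -` B \<inter> space M) = measure (gauss h) B"
      using key[of "space M" B] B' sets.top[of F] spF prob_space by (simp add: Int_absorb1)
    then show "emeasure (distr M borel D) B = emeasure (gauss h) B"
      using B' by (simp add: emeasure_distr emeasure_eq_measure G.emeasure_eq_measure)
  qed simp
  show ?thesis
    unfolding gaussian_indep_def
  proof
    show "distributed M lborel D (normal_density 0 (sqrt h))"
      unfolding distributed_def using d by (auto cong: distr_cong)
    show "indep_set (sets F) {D -` A \<inter> space M | A. A \<in> sets borel}"
    proof (rule indep_setI)
      show "sets F \<subseteq> events" by (rule sb)
      show "{D -` A \<inter> space M | A. A \<in> sets borel} \<subseteq> events" by (auto intro!: measurable_sets)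
      fix A B assume A: "A \<in> sets F" and "B \<in> {D -` A \<inter> space M | A. A \<in> sets borel}"
      then obtain B' where B: "B = D -` B' \<inter> space M" "B' \<in> sets borel" by auto
      have "measure M B = measure (gauss h) B'"
        using key[of "space M" B'] B sets.top[of F] spF prob_space by (simp add: Int_absorb1)
      then show "prob (A \<inter> B) = prob A * prob B" using key[OF A B(2)] B(1) by simp
    qed
  qed
qed

section \<open>Probabilities of fixed intervals under wide Gaussian laws\<close>

lemma two_div_sqrt_two_pi: "2 / sqrt (2 * pi) = sqrt (2 / pi)"
proof (rule power2_eq_imp_eq)
  show "(2 / sqrt (2 * pi))\<^sup>2 = (sqrt (2 / pi))\<^sup>2" by (simp add: power_divide)
qed simp_all

text \<open>Multiplied by its standard deviation, the Gaussian density is bounded by its value 1 /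
  sqrt (2 \<pi>) at the origin and tends to this value as the variance grows. The bound and the
  limit below are both read off this form.\<close>

lemma gauss_interval_eq_integral:
  assumes h: "0 < h"
  shows "integrable lborel (\<lambda>x. indicator {-y..y} x * exp (- (x\<^sup>2 / (2 * h))) / sqrt (2 * pi))" (is ?A)
    and "sqrt h * measure (gauss h) {-y..y} =
      (\<integral>x. indicator {-y..y} x * exp (- (x\<^sup>2 / (2 * h))) / sqrt (2 * pi) \<partial>lborel)" (is ?B)
proof -
  interpret G: prob_space "gauss h" using real_distribution_gauss[OF h] by (simp add: real_distribution_def)
  have e: "sqrt h * (normal_density 0 (sqrt h) x * indicator {-y..y} x) =
      indicator {-y..y} x * exp (- (x\<^sup>2 / (2 * h))) / sqrt (2 * pi)" for x
    using h by (simp add: normal_density_def real_sqrt_mult field_simps)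
  have i: "integrable lborel (\<lambda>x. normal_density 0 (sqrt h) x * indicator {-y..y} x)"
    using h by (intro integrable_real_mult_indicator) (auto simp: mult.commute)
  have "measure (gauss h) {-y..y} = (\<integral>x. indicator {-y..y} x \<partial>gauss h)" by simp
  also have "\<dots> = (\<integral>x. normal_density 0 (sqrt h) x * indicator {-y..y} x \<partial>lborel)"
    by (subst integral_density) auto
  finally have "sqrt h * measure (gauss h) {-y..y} =
      (\<integral>x. sqrt h * (normal_density 0 (sqrt h) x * indicator {-y..y} x) \<partial>lborel)" by simp
  then show ?B unfolding e .
  show ?A using integrable_mult_right[OF i, of "sqrt h"] unfolding e .
qed

text \<open>A Lipschitz estimate in the half-width, uniform in the variance: the two pieces between
  the intervals have total length 2 (z - y), and the scaled density is at most 1 / sqrt (2 \<pi>)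
  there.\<close>

lemma gauss_interval_scaled_bound:
  assumes h: "0 < h" and y: "0 \<le> y" "y \<le> z"
  shows "0 \<le> sqrt h * (measure (gauss h) {-z..z} - measure (gauss h) {-y..y})"
    and "sqrt h * (measure (gauss h) {-z..z} - measure (gauss h) {-y..y}) \<le> sqrt (2 / pi) * (z - y)"
proof -
  let ?f = "\<lambda>y x. indicator {-y..y} x * exp (- (x\<^sup>2 / (2 * h))) / sqrt (2 * pi)"
  have e: "sqrt h * (measure (gauss h) {-z..z} - measure (gauss h) {-y..y}) = (\<integral>x. ?f z x - ?f y x \<partial>lborel)"
    using gauss_interval_eq_integral[OF h] by (simp add: algebra_simps)
  show "0 \<le> sqrt h * (measure (gauss h) {-z..z} - measure (gauss h) {-y..y})"
    unfolding e using y by (intro integral_nonneg_AE) (auto simp: indicator_def)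
  have i: "integrable lborel (\<lambda>x. indicator {-a..a} x / sqrt (2 * pi) :: real)" for a :: real
    by (intro integrable_divide integrable_real_indicator) (auto simp: emeasure_lborel_Icc_eq)
  have "(\<integral>x. ?f z x - ?f y x \<partial>lborel) \<le> (\<integral>x. indicator {-z..z} x / sqrt (2 * pi) - indicator {-y..y} x / sqrt (2 * pi) \<partial>lborel)"
  proof (rule integral_mono)
    show "integrable lborel (\<lambda>x. ?f z x - ?f y x)" using gauss_interval_eq_integral(1)[OF h] by (intro Bochner_Integration.integrable_diff)
    show "integrable lborel (\<lambda>x. indicator {-z..z} x / sqrt (2 * pi) - indicator {-y..y} x / sqrt (2 * pi))"
      by (intro Bochner_Integration.integrable_diff i)
    show "?f z x - ?f y x \<le> indicator {-z..z} x / sqrt (2 * pi) - indicator {-y..y} x / sqrt (2 * pi)" for x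
      using y h by (auto simp: indicator_def intro!: divide_right_mono)
  qed
  also have "\<dots> = (2 * z - 2 * y) / sqrt (2 * pi)"
    using y by (subst Bochner_Integration.integral_diff) (auto intro!: i simp: diff_divide_distrib)
  also have "\<dots> = sqrt (2 / pi) * (z - y)"
    unfolding two_div_sqrt_two_pi[symmetric] by (simp add: algebra_simps diff_divide_distrib)
  finally show "sqrt h * (measure (gauss h) {-z..z} - measure (gauss h) {-y..y}) \<le> sqrt (2 / pi) * (z - y)"
    unfolding e .
qed

lemma gauss_interval_scaled_tendsto:
  assumes y: "0 \<le> y" 
  shows "((\<lambda>t. sqrt t * measure (gauss t) {-y..y}) \<longlongrightarrow> sqrt (2 / pi) * y) at_top"
proof -
  have "((\<lambda>t. \<integral>x. indicator {-y..y} x * exp (- (x\<^sup>2 / (2 * t))) / sqrt (2 * pi) \<partial>lborel)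
      \<longlongrightarrow> (\<integral>x. indicator {-y..y} x / sqrt (2 * pi) \<partial>lborel)) at_top"
  proof (rule integral_dominated_convergence_at_top[where w="\<lambda>x. indicator {-y..y} x / sqrt (2 * pi)"])
    show "integrable lborel (\<lambda>x. indicator {-y..y} x / sqrt (2 * pi) :: real)"
      by (intro integrable_divide integrable_real_indicator) (auto simp: emeasure_lborel_Icc_eq)
    show "AE x in lborel. ((\<lambda>t. indicator {-y..y} x * exp (- (x\<^sup>2 / (2 * t))) / sqrt (2 * pi))
        \<longlongrightarrow> indicator {-y..y} x / sqrt (2 * pi)) at_top"
    proof (rule AE_I2)
      fix x :: real
      have "((\<lambda>t. x\<^sup>2 / (2 * t)) \<longlongrightarrow> 0) at_top" by real_asymp
      then have "((\<lambda>t. indicator {-y..y} x * exp (- (x\<^sup>2 / (2 * t))) / sqrt (2 * pi))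
        \<longlongrightarrow> indicator {-y..y} x * exp (- 0) / sqrt (2 * pi)) at_top"
        by (intro tendsto_intros) auto
      then show "((\<lambda>t. indicator {-y..y} x * exp (- (x\<^sup>2 / (2 * t))) / sqrt (2 * pi))
        \<longlongrightarrow> indicator {-y..y} x / sqrt (2 * pi)) at_top" by simp
    qed
    show "\<forall>\<^sub>F t in at_top. AE x in lborel. norm (indicator {-y..y} x * exp (- (x\<^sup>2 / (2 * t))) / sqrt (2 * pi))
       \<le> indicator {-y..y} x / sqrt (2 * pi)"
      using eventually_gt_at_top[of 0]
      by eventually_elim (auto simp: indicator_def intro!: divide_right_mono)
  qed auto
  moreover have "(\<integral>x. indicator {-y..y} x / sqrt (2 * pi) \<partial>lborel) = sqrt (2 / pi) * y"
    unfolding two_div_sqrt_two_pi[symmetric] using y by simp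
  moreover have "\<forall>\<^sub>F t in at_top. (\<integral>x. indicator {-y..y} x * exp (- (x\<^sup>2 / (2 * t))) / sqrt (2 * pi) \<partial>lborel) =
      sqrt t * measure (gauss t) {-y..y}"
    using eventually_gt_at_top[of 0] by eventually_elim (simp add: gauss_interval_eq_integral(2))
  ultimately show ?thesis by (simp add: filterlim_cong[OF refl refl])
qed

section \<open>Phases of a path between two levels\<close>

text \<open>On a cell that misses \<open>T\<close> the increment of \<open>z\<close> equals the
  summand exactly, so the sum telescopes up to the cells meeting \<open>T\<close>. Their number
  stays bounded as the mesh shrinks, and uniform continuity makes each of their errors
  small.\<close>

lemma riemann_transform_tendsto:
  fixes f z \<kappa> :: "real \<Rightarrow> real" and T :: "real set"
  assumes st: "s \<le> t" and f: "continuous_on {s..t} f" and z: "continuous_on {s..t} z"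
    and T: "finite T" and C: "\<And>u. \<bar>\<kappa> u\<bar> \<le> C"
    and loc: "\<And>u v. s \<le> u \<Longrightarrow> u \<le> v \<Longrightarrow> v \<le> t \<Longrightarrow> T \<inter> {u..v} = {} \<Longrightarrow> z v - z u = \<kappa> u * (f v - f u)"
  shows "(\<lambda>n. \<Sum>i<n. \<kappa> (s + (t - s) * real i / real n) * (f (s + (t - s) * real (Suc i) / real n) - f (s + (t - s) * real i / real n)))
     \<longlonglongrightarrow> z t - z s"
proof (cases "s = t")
  case True then show ?thesis by simp
next
  case False
  with st have "s < t" by simp
  have C0: "0 \<le> C" using C[of 0] by linarith
  define g where "g n i = s + (t - s) * real i / real n" for n i :: nat
  show ?thesis
  proof (rule LIMSEQ_I)
    fix e :: real assume e: "0 < e"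
    \<comment> \<open>At most \<open>2 * card T\<close> cells are bad, each with error at most
      \<open>(C + 1) * \<eta>\<close>; the additional 1 makes the final bound strict, also for empty
      \<open>T\<close>.\<close>
    define \<eta> where "\<eta> = e / ((2 * real (card T) + 1) * (C + 1))"
    have \<eta>: "0 < \<eta>" unfolding \<eta>_def using e C0 by simp
    have "uniformly_continuous_on {s..t} f" "uniformly_continuous_on {s..t} z"
      using f z by (auto intro: compact_uniformly_continuous)
    then obtain d1 d2 where d: "0 < d1" "0 < d2"
      "\<And>u v. u \<in> {s..t} \<Longrightarrow> v \<in> {s..t} \<Longrightarrow> dist v u < d1 \<Longrightarrow> dist (f v) (f u) < \<eta>"
      "\<And>u v. u \<in> {s..t} \<Longrightarrow> v \<in> {s..t} \<Longrightarrow> dist v u < d2 \<Longrightarrow> dist (z v) (z u) < \<eta>"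
      unfolding uniformly_continuous_on_def using \<eta> by metis
    obtain n0 :: nat where n0: "(t - s) / min d1 d2 < n0" using reals_Archimedean2 by blast
    show "\<exists>no. \<forall>n\<ge>no. norm ((\<Sum>i<n. \<kappa> (s + (t - s) * real i / real n) *
        (f (s + (t - s) * real (Suc i) / real n) - f (s + (t - s) * real i / real n))) - (z t - z s)) < e"
    proof (intro exI[of _ "max 1 n0"] allI impI)
      fix n assume "max 1 n0 \<le> n"
      then have n: "1 \<le> n" "(t - s) / min d1 d2 < n" using n0 by auto
      have "0 < min d1 d2" "0 < real n" using n d(1,2) by auto
      then have step: "(t - s) / n < min d1 d2"
        using n(2) by (simp only: pos_divide_less_eq mult.commute)
      have g0: "g n 0 = s" and gn: "g n n = t" using n by (auto simp: g_def)
      have gS: "g n (Suc i) - g n i = (t - s) / n" for i by (simp add: g_def add_divide_distrib distrib_left)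
      have gmono: "g n i \<le> g n (Suc i)" for i using gS[of i] \<open>s < t\<close> by (smt (verit) divide_nonneg_nonneg of_nat_0_le_iff)
      have gin: "g n i \<in> {s..t}" if "i \<le> n" for i
      proof -
        have "(t - s) * (real i / real n) \<le> (t - s) * 1"
          using that n \<open>s < t\<close> by (intro mult_left_mono) (auto simp: field_simps)
        then show ?thesis using \<open>s < t\<close> by (auto simp: g_def)
      qed
      define err where "err i = \<kappa> (g n i) * (f (g n (Suc i)) - f (g n i)) - (z (g n (Suc i)) - z (g n i))" for i
      define bad where "bad = {i. i < n \<and> T \<inter> {g n i..g n (Suc i)} \<noteq> {}}"
      have err0: "err i = 0" if "i < n" "i \<notin> bad" for i
        using loc[of "g n i" "g n (Suc i)"] gin[of i] gin[of "Suc i"] gmono[of i] that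
        by (auto simp: err_def bad_def)
      have errb: "\<bar>err i\<bar> \<le> (C + 1) * \<eta>" if "i < n" for i
      proof -
        have "dist (g n (Suc i)) (g n i) < min d1 d2"
          using step gS[of i] gmono[of i] unfolding dist_real_def by linarith
        then have 1: "\<bar>f (g n (Suc i)) - f (g n i)\<bar> \<le> \<eta>" "\<bar>z (g n (Suc i)) - z (g n i)\<bar> \<le> \<eta>"
          using d(3)[of "g n i" "g n (Suc i)"] d(4)[of "g n i" "g n (Suc i)"] gin[of i] gin[of "Suc i"] that
          by (auto simp: dist_real_def)
        have "\<bar>\<kappa> (g n i)\<bar> * \<bar>f (g n (Suc i)) - f (g n i)\<bar> \<le> C * \<eta>"
          using 1 C C0 by (intro mult_mono) auto
        then have "\<bar>err i\<bar> \<le> C * \<eta> + \<eta>"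
          unfolding err_def abs_mult[symmetric] using 1 by linarith
        then show ?thesis by (simp add: algebra_simps)
      qed
      \<comment> \<open>After rescaling the cells to [i, i + 1], a point y lies in the closed cell i
        only if i is the floor of y, or one less when y is a grid point.\<close>
      have "bad \<subseteq> (\<Union>x\<in>T. {nat \<lfloor>real n * (x - s) / (t - s)\<rfloor>, nat \<lfloor>real n * (x - s) / (t - s)\<rfloor> - 1})"
      proof
        fix i assume "i \<in> bad"
        then obtain x where x: "x \<in> T" "g n i \<le> x" "x \<le> g n (Suc i)" by (auto simp: bad_def)
        define y where "y = real n * (x - s) / (t - s)"
        have xy: "x - s = (t - s) * y / real n" using n \<open>s < t\<close> by (simp add: y_def)
        have "(t - s) * real i / real n \<le> (t - s) * y / real n" "(t - s) * y / real n \<le> (t - s) * real (Suc i) / real n"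
          using x unfolding g_def xy[symmetric] by auto
        then have "real i \<le> y" "y \<le> real i + 1"
          using n \<open>s < t\<close> by (auto simp: divide_le_cancel mult_le_cancel_left_pos)
        then have "\<lfloor>y\<rfloor> = int i \<or> \<lfloor>y\<rfloor> = int i + 1" by linarith
        then have "i = nat \<lfloor>y\<rfloor> \<or> i = nat \<lfloor>y\<rfloor> - 1" by auto
        then show "i \<in> (\<Union>x\<in>T. {nat \<lfloor>real n * (x - s) / (t - s)\<rfloor>, nat \<lfloor>real n * (x - s) / (t - s)\<rfloor> - 1})"
          using x(1) unfolding y_def by blast
      qed
      then have "card bad \<le> card (\<Union>x\<in>T. {nat \<lfloor>real n * (x - s) / (t - s)\<rfloor>, nat \<lfloor>real n * (x - s) / (t - s)\<rfloor> - 1})"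
        using T by (intro card_mono) auto
      also have "\<dots> \<le> (\<Sum>x\<in>T. card {nat \<lfloor>real n * (x - s) / (t - s)\<rfloor>, nat \<lfloor>real n * (x - s) / (t - s)\<rfloor> - 1})"
        by (rule card_UN_le[OF T])
      also have "\<dots> \<le> (\<Sum>x\<in>T. 2)"
        by (intro sum_mono) (simp add: card_insert_if)
      finally have cb: "card bad \<le> 2 * card T" by simp
      have "(\<Sum>i<n. z (g n (Suc i)) - z (g n i)) = z t - z s"
        using sum_lessThan_telescope[of "\<lambda>i. z (g n i)" n] g0 gn by simp
      then have "(\<Sum>i<n. \<kappa> (g n i) * (f (g n (Suc i)) - f (g n i))) - (z t - z s) = (\<Sum>i<n. err i)"
        by (simp add: err_def sum_subtractf)
      also have "\<dots> = (\<Sum>i\<in>bad. err i)"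
        using err0 by (intro sum.mono_neutral_right) (auto simp: bad_def)
      also have "\<bar>\<dots>\<bar> \<le> (\<Sum>i\<in>bad. (C + 1) * \<eta>)"
        by (rule order_trans[OF sum_abs], rule sum_mono, rule errb) (simp add: bad_def)
      also have "\<dots> \<le> (2 * real (card T)) * ((C + 1) * \<eta>)"
        using of_nat_mono[OF cb, where 'a=real] C0 \<eta> unfolding sum_constant by (intro mult_right_mono) auto
      also have "\<dots> < (2 * real (card T) + 1) * ((C + 1) * \<eta>)"
        using C0 \<eta> by (intro mult_strict_right_mono) auto
      also have "\<dots> = e" using C0 by (simp add: \<eta>_def)
      finally show "norm ((\<Sum>i<n. \<kappa> (s + (t - s) * real i / real n) *
        (f (s + (t - s) * real (Suc i) / real n) - f (s + (t - s) * real i / real n))) - (z t - z s)) < e"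
        by (simp add: g_def)
    qed
  qed
qed

locale levels =
  fixes a b :: real
  assumes ab: "a < b"
begin

declare crossing_time.simps(2) [simp del]

abbreviation \<sigma> :: "nat \<Rightarrow> (real \<Rightarrow> real) \<Rightarrow> ereal" where "\<sigma> \<equiv> crossing_time a b"

text \<open>The level whose crossing ends phase \<open>k\<close>.\<close>

definition lev :: "nat \<Rightarrow> real" where "lev k = (if even k then b else a)"

text \<open>Even phases wait for the level \<open>b\<close>, odd ones for \<open>a\<close>; half the
  phase, rounded down, is the number of completed down-crossings.\<close>

definition phase :: "real \<Rightarrow> (real \<Rightarrow> real) \<Rightarrow> nat" where
  "phase t \<omega> = (LEAST k. ereal t < \<sigma> (Suc k) \<omega>)"

text \<open>The left-continuous version of the phase; unlike \<open>phase t\<close>, it is measurable with respect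
  to the raw filtration at time \<open>t\<close>.\<close>

definition lphase :: "real \<Rightarrow> (real \<Rightarrow> real) \<Rightarrow> nat" where
  "lphase t \<omega> = (LEAST k. ereal t \<le> \<sigma> (Suc k) \<omega>)"

text \<open>Under this condition \<open>pval \<alpha> c\<close> below is continuous in time: it is the stochastic integral of
  the step process \<open>c (phase t)\<close> with respect to the coordinate process.\<close>

definition glued :: "(nat \<Rightarrow> real) \<Rightarrow> (nat \<Rightarrow> real) \<Rightarrow> bool" where
  "glued \<alpha> c \<longleftrightarrow> (\<forall>k. \<alpha> k + c k * lev k = \<alpha> (Suc k) + c (Suc k) * lev k)"

definition pval :: "(nat \<Rightarrow> real) \<Rightarrow> (nat \<Rightarrow> real) \<Rightarrow> real \<Rightarrow> (real \<Rightarrow> real) \<Rightarrow> real" where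
  "pval \<alpha> c t \<omega> = \<alpha> (phase t \<omega>) + c (phase t \<omega>) * \<omega> t"

section \<open>Crossing times of a continuous path\<close>

lemma crossing_time_le_Suc: "\<sigma> k \<omega> \<le> \<sigma> (Suc k) \<omega>"
  by (auto simp: crossing_time.simps(2) intro!: Inf_greatest)

lemma crossing_time_mono: "i \<le> j \<Longrightarrow> \<sigma> i \<omega> \<le> \<sigma> j \<omega>"
  by (rule lift_Suc_mono_le[of "\<lambda>k. \<sigma> k \<omega>"]) (rule crossing_time_le_Suc)

lemma crossing_time_nonneg: "0 \<le> \<sigma> k \<omega>"
  using crossing_time_mono[of 0 k] by simp

lemma crossing_time_Suc_less_iff:
  "\<sigma> (Suc k) \<omega> < ereal u \<longleftrightarrow>
    (\<exists>t\<ge>0. \<sigma> k \<omega> \<le> ereal t \<and> t < u \<and> (if even k then \<omega> t > b else \<omega> t < a))"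
  by (auto simp: crossing_time.simps(2) Inf_less_iff)

text \<open>A value beyond the level at time \<open>r\<close> would put \<open>r\<close> into the
  set whose infimum is the next crossing time.\<close>

lemma before_crossing:
  assumes "0 \<le> r" "\<sigma> k \<omega> \<le> ereal r" "ereal r < \<sigma> (Suc k) \<omega>"
  shows "even k \<Longrightarrow> \<omega> r \<le> b" "odd k \<Longrightarrow> a \<le> \<omega> r"
proof -
  have "\<not> (if even k then \<omega> r > b else \<omega> r < a)"
  proof
    assume "if even k then \<omega> r > b else \<omega> r < a"
    then have "\<sigma> (Suc k) \<omega> \<le> ereal r" using assms by (auto simp: crossing_time.simps(2) intro!: Inf_lower)
    then show False using assms by simp
  qed
  then show "even k \<Longrightarrow> \<omega> r \<le> b" "odd k \<Longrightarrow> a \<le> \<omega> r" by auto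
qed

context
  fixes \<omega> :: "real \<Rightarrow> real"
  assumes \<omega>: "\<omega> \<in> path_space"
begin

lemma path_cont: "continuous_on {0..} \<omega>"
  using \<omega> by (simp add: path_space_def)

lemma path_close:
  assumes "0 \<le> v" "0 < e"
  obtains d where "0 < d" "\<And>r. 0 \<le> r \<Longrightarrow> \<bar>r - v\<bar> < d \<Longrightarrow> \<bar>\<omega> r - \<omega> v\<bar> < e"
  using path_cont assms unfolding continuous_on_iff dist_real_def by (metis atLeast_iff)

text \<open>The infimum is approached by times at which the path is beyond the level, so by
  continuity it cannot be strictly on the near side. Equality can fail: a path starting above
  \<open>b\<close> has \<sigma> 1 = 0.\<close>

lemma crossing_value_ge:
  assumes v: "\<sigma> (Suc k) \<omega> = ereal v"
  shows "0 \<le> v" "even k \<Longrightarrow> b \<le> \<omega> v" "odd k \<Longrightarrow> \<omega> v \<le> a"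
proof -
  show v0: "0 \<le> v" using crossing_time_nonneg[of "Suc k" \<omega>] v by simp
  have "\<not> (if even k then \<omega> v < b else a < \<omega> v)"
  proof
    assume *: "if even k then \<omega> v < b else a < \<omega> v"
    define e where "e = (if even k then b - \<omega> v else \<omega> v - a)"
    have "0 < e" using * by (auto simp: e_def split: if_splits)
    then obtain d where d: "0 < d" "\<And>r. 0 \<le> r \<Longrightarrow> \<bar>r - v\<bar> < d \<Longrightarrow> \<bar>\<omega> r - \<omega> v\<bar> < e"
      using path_close[OF v0] by metis
    have "\<sigma> (Suc k) \<omega> < ereal (v + d)" using v d by simp
    then obtain t where t: "0 \<le> t" "\<sigma> k \<omega> \<le> ereal t" "t < v + d" "if even k then \<omega> t > b else \<omega> t < a"
      unfolding crossing_time_Suc_less_iff by auto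
    have "\<sigma> (Suc k) \<omega> \<le> ereal t" using t by (auto simp: crossing_time.simps(2) intro!: Inf_lower)
    then have "\<bar>t - v\<bar> < d" using t v by simp
    from d(2)[OF t(1) this] t(4) show False by (auto simp: e_def split: if_splits)
  qed
  then show "even k \<Longrightarrow> b \<le> \<omega> v" "odd k \<Longrightarrow> \<omega> v \<le> a" by auto
qed

text \<open>Coinciding crossings would place the path at or above \<open>b\<close> and at or below
  \<open>a\<close> simultaneously. The bound \<open>1 \<le> k\<close> excludes \<sigma> 0 = \<sigma>
  1 = 0, which does occur for a start above \<open>b\<close>.\<close>

lemma crossing_strict:
  assumes "1 \<le> k" "\<sigma> k \<omega> \<noteq> \<infinity>"
  shows "\<sigma> k \<omega> < \<sigma> (Suc k) \<omega>"
proof (rule ccontr)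
  assume "\<not> ?thesis"
  then have eq: "\<sigma> (Suc k) \<omega> = \<sigma> k \<omega>" using crossing_time_le_Suc[of k \<omega>] by simp
  obtain j where j: "k = Suc j" using assms by (cases k) auto
  obtain v where v: "\<sigma> k \<omega> = ereal v"
    using assms(2) crossing_time_nonneg[of k \<omega>] by (cases "\<sigma> k \<omega>") auto
  show False
    using crossing_value_ge[of k v] crossing_value_ge[of j v] v eq j ab by (cases "even j") auto
qed

text \<open>Since phase \<open>k\<close> has positive length, \<open>before_crossing\<close>
  controls the path on a left neighbourhood of \<open>v\<close>; continuity then gives the
  inequality opposite to \<open>crossing_value_ge\<close>.\<close>

lemma crossing_value:
  assumes v: "\<sigma> (Suc k) \<omega> = ereal v" and s: "\<sigma> k \<omega> < ereal v"
  shows "\<omega> v = lev k"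
proof -
  have v0: "0 \<le> v" using crossing_value_ge(1)[OF v] .
  obtain u where u: "\<sigma> k \<omega> = ereal u" "0 \<le> u" "u < v"
    using s crossing_time_nonneg[of k \<omega>] by (cases "\<sigma> k \<omega>") auto
  have "\<not> (if even k then b < \<omega> v else \<omega> v < a)"
  proof
    assume *: "if even k then b < \<omega> v else \<omega> v < a"
    define e where "e = (if even k then \<omega> v - b else a - \<omega> v)"
    have "0 < e" using * by (auto simp: e_def split: if_splits)
    then obtain d where d: "0 < d" "\<And>r. 0 \<le> r \<Longrightarrow> \<bar>r - v\<bar> < d \<Longrightarrow> \<bar>\<omega> r - \<omega> v\<bar> < e"
      using path_close[OF v0] by metis
    define r where "r = max u (v - d / 2)"
    have r: "0 \<le> r" "u \<le> r" "r < v" "\<bar>r - v\<bar> < d" using u d by (auto simp: r_def)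
    from before_crossing[of r k \<omega>] r u v d(2)[of r] show False
      by (auto simp: e_def split: if_splits)
  qed
  then show ?thesis using crossing_value_ge[OF v] by (auto simp: lev_def)
qed

text \<open>From the first crossing on, consecutive crossings change the path by at least b - a, so
  uniform continuity on [0, t] keeps them a fixed distance apart and only finitely many fit. The
  count begins at \<sigma> 1 because \<sigma> 0 is not a crossing.\<close>

lemma crossing_unbounded: "\<exists>k. ereal t < \<sigma> (Suc k) \<omega>"
proof (rule ccontr)
  assume "\<not> ?thesis"
  then have le: "\<sigma> k \<omega> \<le> ereal t" for k
    using crossing_time_le_Suc[of k \<omega>] by (meson not_less order_trans)
  have "\<exists>v. \<sigma> k \<omega> = ereal v" for k
    using le[of k] crossing_time_nonneg[of k \<omega>] by (cases "\<sigma> k \<omega>") auto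
  then obtain v where v: "\<And>k. \<sigma> k \<omega> = ereal (v k)" by metis
  have v0: "0 \<le> v k" "v k \<le> t" for k using le[of k] crossing_time_nonneg[of k \<omega>] v by auto
  have "uniformly_continuous_on {0..t} \<omega>"
    by (rule compact_uniformly_continuous) (auto intro: continuous_on_subset[OF path_cont])
  then obtain d where d: "0 < d" "\<And>r u. r \<in> {0..t} \<Longrightarrow> u \<in> {0..t} \<Longrightarrow> dist u r < d \<Longrightarrow> dist (\<omega> u) (\<omega> r) < b - a"
    unfolding uniformly_continuous_on_def using ab by (metis diff_gt_0_iff_gt)
  have step: "v (Suc k) + d \<le> v (Suc (Suc k))" for k
  proof (rule ccontr)
    assume "\<not> ?thesis"
    moreover have "v (Suc k) \<le> v (Suc (Suc k))" using crossing_time_le_Suc[of "Suc k" \<omega>] v by (metis ereal_less_eq(3))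
    ultimately have "dist (\<omega> (v (Suc (Suc k)))) (\<omega> (v (Suc k))) < b - a"
      using v0 by (intro d(2)) (auto simp: dist_real_def)
    then show False
      using crossing_value_ge[OF v[of "Suc k"]] crossing_value_ge[OF v[of "Suc (Suc k)"]] ab
      by (cases "even k") (auto simp: dist_real_def)
  qed
  have "real k * d \<le> v (Suc k)" for k
  proof (induction k)
    case 0 then show ?case using v0 by simp
  next
    case (Suc k) then show ?case using step[of k] by (simp add: algebra_simps)
  qed
  moreover obtain k :: nat where "t / d < real k" using reals_Archimedean2 by blast
  ultimately show False using v0(2)[of "Suc k"] d(1) by (metis divide_less_eq not_less order_trans)
qed

section \<open>Phase, left phase and glued functionals\<close>

lemma phase_less: "ereal t < \<sigma> (Suc (phase t \<omega>)) \<omega>"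
  unfolding phase_def by (rule LeastI_ex[OF crossing_unbounded])

lemma phase_le_iff: "phase t \<omega> \<le> k \<longleftrightarrow> ereal t < \<sigma> (Suc k) \<omega>"
proof
  assume "phase t \<omega> \<le> k"
  then show "ereal t < \<sigma> (Suc k) \<omega>"
    using phase_less[of t] crossing_time_mono[of "Suc (phase t \<omega>)" "Suc k" \<omega>] by (meson Suc_le_mono less_le_trans)
qed (auto simp: phase_def intro: Least_le)

lemma phase_ge:
  assumes "0 \<le> t" shows "\<sigma> (phase t \<omega>) \<omega> \<le> ereal t"
proof (cases "phase t \<omega>")
  case 0 then show ?thesis using assms by simp
next
  case (Suc k) then show ?thesis using phase_le_iff[of t k] by simp
qed

lemma phase_eqI:
  assumes "\<sigma> k \<omega> \<le> ereal t" "ereal t < \<sigma> (Suc k) \<omega>" shows "phase t \<omega> = k"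
proof (rule antisym)
  show "phase t \<omega> \<le> k" using assms phase_le_iff by blast
  show "k \<le> phase t \<omega>"
    using assms phase_le_iff[of t "k - 1"] by (cases k) auto
qed

lemma phase_less_iff:
  assumes "0 \<le> t" shows "k \<le> phase t \<omega> \<longleftrightarrow> \<sigma> k \<omega> \<le> ereal t"
  using phase_le_iff[of t "k - 1"] assms by (cases k) auto

lemma lphase_le: "ereal t \<le> \<sigma> (Suc (lphase t \<omega>)) \<omega>"
  unfolding lphase_def by (rule LeastI_ex) (use crossing_unbounded less_imp_le in blast)

lemma lphase_le_iff: "lphase t \<omega> \<le> k \<longleftrightarrow> ereal t \<le> \<sigma> (Suc k) \<omega>"
proof
  assume "lphase t \<omega> \<le> k"
  then show "ereal t \<le> \<sigma> (Suc k) \<omega>"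
    using lphase_le[of t] crossing_time_mono[of "Suc (lphase t \<omega>)" "Suc k" \<omega>] by (meson Suc_le_mono order_trans)
qed (auto simp: lphase_def intro: Least_le)

lemma lphase_gt:
  assumes "0 < t" shows "\<sigma> (lphase t \<omega>) \<omega> < ereal t"
proof (cases "lphase t \<omega>")
  case 0 then show ?thesis using assms by simp
next
  case (Suc k) then show ?thesis using lphase_le_iff[of t k] by simp
qed

text \<open>The versions differ only at a crossing time, and there the path sits on the level
  separating the two phases, which is what \<open>glued\<close> exploits. Time 0 is excluded: a path
  starting above \<open>b\<close> has phase 1 and left phase 0 away from that level.\<close>

lemma phase_lphase:
  assumes "0 < t"
  shows "phase t \<omega> = lphase t \<omega> \<or>
    phase t \<omega> = Suc (lphase t \<omega>) \<and> \<sigma> (phase t \<omega>) \<omega> = ereal t \<and> \<omega> t = lev (lphase t \<omega>)"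
proof (cases "ereal t < \<sigma> (Suc (lphase t \<omega>)) \<omega>")
  case True
  then show ?thesis using lphase_gt[OF assms] phase_eqI[of "lphase t \<omega>" t] by auto
next
  case False
  then have eq: "\<sigma> (Suc (lphase t \<omega>)) \<omega> = ereal t" using lphase_le[of t] by simp
  moreover have "ereal t < \<sigma> (Suc (Suc (lphase t \<omega>))) \<omega>"
    using crossing_strict[of "Suc (lphase t \<omega>)"] eq by simp
  ultimately have "phase t \<omega> = Suc (lphase t \<omega>)" by (intro phase_eqI) auto
  then show ?thesis using crossing_value[OF eq lphase_gt[OF assms]] eq by simp
qed

lemma pval_eq_lphase:
  assumes "0 < t" "glued \<alpha> c"
  shows "pval \<alpha> c t \<omega> = \<alpha> (lphase t \<omega>) + c (lphase t \<omega>) * \<omega> t"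
  using phase_lphase[OF assms(1)] assms(2) unfolding pval_def glued_def by auto

text \<open>If the path starts exactly at \<open>b\<close>, its behaviour right after 0 decides
  between phases 0 and 1; gluing makes both formulas agree there, so that a function of the starting
  value alone remains.\<close>

lemma pval_zero:
  assumes "glued \<alpha> c"
  shows "pval \<alpha> c 0 \<omega> = (if b < \<omega> 0 then \<alpha> 1 + c 1 * \<omega> 0 else \<alpha> 0 + c 0 * \<omega> 0)"
proof (cases "0 < \<sigma> 1 \<omega>")
  case True
  then have p: "phase 0 \<omega> = 0" by (intro phase_eqI) (auto simp: zero_ereal_def )
  have "\<omega> 0 \<le> b" using before_crossing(1)[of 0 0 \<omega>] True by (simp add: zero_ereal_def )
  then show ?thesis by (simp add: pval_def p)
next
  case False
  then have eq: "\<sigma> (Suc 0) \<omega> = ereal 0" using crossing_time_nonneg[of 1 \<omega>] by (simp add: zero_ereal_def )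
  then have "ereal 0 < \<sigma> (Suc (Suc 0)) \<omega>" using crossing_strict[of 1] by simp
  with eq have p: "phase 0 \<omega> = 1" by (intro phase_eqI) auto
  have "b \<le> \<omega> 0" using crossing_value_ge[OF eq] by simp
  moreover have "\<alpha> 1 + c 1 * b = \<alpha> 0 + c 0 * b" using assms by (auto simp: glued_def lev_def dest: spec[of _ 0])
  ultimately show ?thesis by (auto simp: pval_def p)
qed

lemma phase_right:
  assumes "0 \<le> t"
  obtains d where "0 < d" "\<And>r. t \<le> r \<Longrightarrow> r < t + d \<Longrightarrow> phase r \<omega> = phase t \<omega>"
proof -
  obtain u where u: "t < u" "ereal u \<le> \<sigma> (Suc (phase t \<omega>)) \<omega>"
    using ereal_dense2[OF phase_less[of t]] by (auto  intro: less_imp_le)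
  show ?thesis
  proof (rule that[of "u - t"])
    fix r assume "t \<le> r" "r < t + (u - t)"
    then show "phase r \<omega> = phase t \<omega>"
      using phase_ge[OF assms] u
      by (intro phase_eqI) (auto  intro: order_trans less_le_trans[of _ "ereal u"])
  qed (use u in simp)
qed

lemma phase_left:
  assumes "0 < t"
  obtains d where "0 < d" "\<And>r. 0 \<le> r \<Longrightarrow> t - d < r \<Longrightarrow> r < t \<Longrightarrow> phase r \<omega> = lphase t \<omega>"
proof -
  obtain u where u: "u < t" "\<sigma> (lphase t \<omega>) \<omega> \<le> ereal u"
    using ereal_dense2[OF lphase_gt[OF assms]] by (auto  intro: less_imp_le)
  show ?thesis
  proof (rule that[of "t - u"])
    fix r assume "t - (t - u) < r" "r < t"
    then show "phase r \<omega> = lphase t \<omega>"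
      using lphase_le[of t] u
      by (intro phase_eqI) (auto  intro: order_trans[of _ "ereal u"] less_le_trans[of _ "ereal t"])
  qed (use u in simp)
qed

text \<open>Near \<open>t\<close> the functional is affine in the path, with the coefficients of
  \<open>phase t\<close> on the right and of \<open>lphase t\<close> on the left; by
  \<open>pval_eq_lphase\<close> both branches take the value at \<open>t\<close>.\<close>

lemma continuous_on_pval:
  assumes g: "glued \<alpha> c"
  shows "continuous_on {0..} (\<lambda>t. pval \<alpha> c t \<omega>)"
  unfolding continuous_on_def
proof
  fix t :: real assume "t \<in> {0..}" then have t: "0 \<le> t" by simp
  obtain d1 where d1: "0 < d1" "\<And>r. t \<le> r \<Longrightarrow> r < t + d1 \<Longrightarrow> phase r \<omega> = phase t \<omega>"
    using phase_right[OF t] by metis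
  obtain d2 where d2: "0 < d2" "\<And>r. 0 < t \<Longrightarrow> 0 \<le> r \<Longrightarrow> t - d2 < r \<Longrightarrow> r < t \<Longrightarrow> phase r \<omega> = lphase t \<omega>"
  proof (cases "0 < t")
    case True then show ?thesis using phase_left[OF True] that by metis
  qed (use that[of 1] in auto)
  let ?C = "max \<bar>c (phase t \<omega>)\<bar> \<bar>c (lphase t \<omega>)\<bar>"
  have "\<bar>pval \<alpha> c r \<omega> - pval \<alpha> c t \<omega>\<bar> \<le> ?C * \<bar>\<omega> r - \<omega> t\<bar>" if r: "0 \<le> r" "dist r t < min d1 d2" for r
  proof (cases "t \<le> r")
    case True
    then have "pval \<alpha> c r \<omega> - pval \<alpha> c t \<omega> = c (phase t \<omega>) * (\<omega> r - \<omega> t)"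
      using d1(2)[of r] r by (simp add: pval_def dist_real_def algebra_simps)
    then show ?thesis by (simp add: abs_mult mult_right_mono)
  next
    case False
    then have t0: "0 < t" using r by simp
    have "pval \<alpha> c r \<omega> - pval \<alpha> c t \<omega> = c (lphase t \<omega>) * (\<omega> r - \<omega> t)"
      using d2(2)[of r] r False t0 unfolding pval_eq_lphase[OF t0 g]
      by (simp add: pval_def dist_real_def algebra_simps)
    then show ?thesis by (simp add: abs_mult mult_right_mono)
  qed
  then have ev: "\<forall>\<^sub>F r in at t within {0..}. norm (pval \<alpha> c r \<omega> - pval \<alpha> c t \<omega>) \<le> ?C * \<bar>\<omega> r - \<omega> t\<bar>"
    using d1(1) d2(1) unfolding eventually_at by (intro exI[of _ "min d1 d2"]) auto
  have "((\<lambda>r. \<omega> r) \<longlongrightarrow> \<omega> t) (at t within {0..})"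
    using path_cont t by (auto simp: continuous_on_def)
  then have "((\<lambda>r. ?C * \<bar>\<omega> r - \<omega> t\<bar>) \<longlongrightarrow> ?C * \<bar>\<omega> t - \<omega> t\<bar>) (at t within {0..})"
    by (intro tendsto_intros)
  then have "((\<lambda>r. ?C * \<bar>\<omega> r - \<omega> t\<bar>) \<longlongrightarrow> 0) (at t within {0..})" by simp
  from Lim_null_comparison[OF ev this]
  show "((\<lambda>t. pval \<alpha> c t \<omega>) \<longlongrightarrow> pval \<alpha> c t \<omega>) (at t within {0..})"
    by (simp add: LIM_zero_iff)
qed

text \<open>The set consists of the crossing times reached by \<open>t\<close>, together with 0,
  where phase and left phase may disagree.\<close>

lemma change_times:
  assumes "0 \<le> t"
  obtains T where "finite T"
    "\<And>u v. 0 \<le> u \<Longrightarrow> u \<le> v \<Longrightarrow> v \<le> t \<Longrightarrow> T \<inter> {u..v} = {} \<Longrightarrow>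
       phase u \<omega> = phase v \<omega> \<and> lphase u \<omega> = phase v \<omega>"
proof (rule that)
  let ?T = "(\<lambda>k. real_of_ereal (\<sigma> k \<omega>)) ` {..phase t \<omega>}"
  show "finite (?T - {0} \<union> {0})" by simp
  fix u v assume uv: "0 \<le> u" "u \<le> v" "v \<le> t" "(?T - {0} \<union> {0}) \<inter> {u..v} = {}"
  define k where "k = phase v \<omega>"
  have v0: "0 \<le> v" using uv by simp
  have k: "\<sigma> k \<omega> \<le> ereal v" "ereal v < \<sigma> (Suc k) \<omega>"
    using phase_ge[OF v0] phase_less[of v] by (auto simp: k_def)
  obtain w where w: "\<sigma> k \<omega> = ereal w" "0 \<le> w"
    using k(1) crossing_time_nonneg[of k \<omega>] by (cases "\<sigma> k \<omega>") auto
  have "k \<le> phase t \<omega>" using phase_less_iff[of t k] k uv by (meson ereal_less_eq(3) order_trans v0)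
  then have "w \<in> ?T" using w by force
  then have wu: "w < u" using uv k(1) w by auto
  then have sk: "\<sigma> k \<omega> < ereal u" "ereal u < \<sigma> (Suc k) \<omega>"
    using w k uv by (auto  intro: le_less_trans[of _ "ereal v"])
  have "phase u \<omega> = k" using sk by (intro phase_eqI) auto
  moreover have "lphase u \<omega> = k"
  proof (rule antisym)
    show "lphase u \<omega> \<le> k" using sk lphase_le_iff by simp
    show "k \<le> lphase u \<omega>" using sk lphase_le_iff[of u "k - 1"] by (cases k) auto
  qed
  ultimately show "phase u \<omega> = phase v \<omega> \<and> lphase u \<omega> = phase v \<omega>" by (simp add: k_def)
qed

text \<open>Taking the left phase at the left end of each cell makes the sum a martingale transform:
  the coefficient is known when the cell begins.\<close>

lemma pval_riemann:
  assumes g: "glued \<alpha> c" and C: "\<And>k. \<bar>c k\<bar> \<le> C" and st: "0 \<le> s" "s \<le> t"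
  shows "(\<lambda>n. \<Sum>i<n. c (lphase (s + (t - s) * real i / real n) \<omega>) *
      (\<omega> (s + (t - s) * real (Suc i) / real n) - \<omega> (s + (t - s) * real i / real n))) \<longlonglongrightarrow> pval \<alpha> c t \<omega> - pval \<alpha> c s \<omega>"
proof -
  obtain T where T: "finite T" "\<And>u v. 0 \<le> u \<Longrightarrow> u \<le> v \<Longrightarrow> v \<le> t \<Longrightarrow> T \<inter> {u..v} = {} \<Longrightarrow>
       phase u \<omega> = phase v \<omega> \<and> lphase u \<omega> = phase v \<omega>"
    using change_times[of t] st by (metis order_trans)
  show ?thesis
  proof (rule riemann_transform_tendsto[where \<kappa>="\<lambda>u. c (lphase u \<omega>)", OF st(2) _ _ T(1) C])
    show "continuous_on {s..t} \<omega>" "continuous_on {s..t} (\<lambda>t. pval \<alpha> c t \<omega>)"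
      using st by (auto intro: continuous_on_subset[OF path_cont] continuous_on_subset[OF continuous_on_pval[OF g]])
    fix u v assume "s \<le> u" "u \<le> v" "v \<le> t" "T \<inter> {u..v} = {}"
    then show "pval \<alpha> c v \<omega> - pval \<alpha> c u \<omega> = c (lphase u \<omega>) * (\<omega> v - \<omega> u)"
      using T(2)[of u v] st by (simp add: pval_def algebra_simps)
  qed
qed

lemma lphase_measurable_time [measurable]: "(\<lambda>r. lphase r \<omega>) \<in> measurable borel (count_space UNIV)"
proof (subst measurable_count_space_eq2_countable, safe)
  fix k
  have "(\<lambda>r. lphase r \<omega>) -` {k} = {r. lphase r \<omega> \<le> k \<and> \<not> (k \<noteq> 0 \<and> lphase r \<omega> \<le> k - 1)}" by auto
  also have "\<dots> = {r. ereal r \<le> \<sigma> (Suc k) \<omega> \<and> \<not> (k \<noteq> 0 \<and> ereal r \<le> \<sigma> (Suc (k - 1)) \<omega>)}"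
    unfolding lphase_le_iff ..
  also have "\<dots> \<in> sets borel" by measurable
  finally show "(\<lambda>r. lphase r \<omega>) -` {k} \<inter> space borel \<in> sets borel" by simp
qed auto

lemma step_integrable:
  assumes C: "\<And>k. \<bar>c k\<bar> \<le> C"
  shows "(\<lambda>r. c (lphase r \<omega>) :: real) integrable_on {s..t}"
proof -
  have "set_integrable lborel {s..t} (\<lambda>r. c (lphase r \<omega>))"
    by (rule set_integrable_bound[where f="\<lambda>_. C"])
       (use C in \<open>auto simp: set_borel_measurable_def intro: order_trans[OF _ abs_ge_self] borel_integrable_atLeastAtMost'\<close>)
  then show ?thesis by (rule set_borel_integral_eq_integral)
qed

text \<open>The instance of \<open>riemann_transform_tendsto\<close> in which the identity is the
  integrator and the running integral is the transform.\<close>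

lemma step_riemann:
  assumes C: "\<And>k. \<bar>c k\<bar> \<le> C" and st: "0 \<le> s" "s \<le> t"
  shows "(\<lambda>n. \<Sum>i<n. c (lphase (s + (t - s) * real i / real n) \<omega>) * ((t - s) / real n)) \<longlonglongrightarrow> integral {s..t} (\<lambda>r. c (lphase r \<omega>))"
proof -
  let ?f = "\<lambda>r. c (lphase r \<omega>)"
  obtain T where T: "finite T" "\<And>u v. 0 \<le> u \<Longrightarrow> u \<le> v \<Longrightarrow> v \<le> t \<Longrightarrow> T \<inter> {u..v} = {} \<Longrightarrow>
       phase u \<omega> = phase v \<omega> \<and> lphase u \<omega> = phase v \<omega>"
    using change_times[of t] st by (metis order_trans)
  have "(\<lambda>n. \<Sum>i<n. ?f (s + (t - s) * real i / real n) * ((s + (t - s) * real (Suc i) / real n) - (s + (t - s) * real i / real n)))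
      \<longlonglongrightarrow> integral {s..t} ?f - integral {s..s} ?f"
  proof (rule riemann_transform_tendsto[where f="\<lambda>x. x", OF st(2) _ _ T(1) C])
    show "continuous_on {s..t} (\<lambda>r. integral {s..r} ?f)"
      by (rule indefinite_integral_continuous_1[OF step_integrable[OF C]])
    fix u v assume uv: "s \<le> u" "u \<le> v" "v \<le> t" "T \<inter> {u..v} = {}"
    have "integral {s..v} ?f = integral {s..u} ?f + integral {u..v} ?f"
      using uv by (intro Henstock_Kurzweil_Integration.integral_combine[symmetric] step_integrable[OF C]) auto
    also have "integral {u..v} ?f = integral {u..v} (\<lambda>_. ?f u)"
    proof (rule integral_cong)
      fix r assume r: "r \<in> {u..v}"
      then have "T \<inter> {r..v} = {}" using uv by auto
      then show "?f r = ?f u" using T(2)[of r v] T(2)[of u v] uv r st by simp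
    qed
    finally show "integral {s..v} ?f - integral {s..u} ?f = ?f u * (v - u)" using uv by simp
  qed simp
  moreover have "(s + (t - s) * real (Suc i) / real n) - (s + (t - s) * real i / real n) = (t - s) / real n" for i n
    by (simp add: add_divide_distrib distrib_left)
  ultimately show ?thesis by (simp del: of_nat_Suc)
qed

lemma downcrossings_eq:
  assumes "0 \<le> t" shows "downcrossings a b t \<omega> = phase t \<omega> div 2"
proof -
  have "{n. 1 \<le> n \<and> \<sigma> (2 * n) \<omega> \<le> ereal t} = {1..phase t \<omega> div 2}"
    unfolding phase_less_iff[OF assms, symmetric] by auto
  then show ?thesis by (simp add: downcrossings_def)
qed

end

end

section \<open>Measurability of the phases\<close>

lemma space_coord_algebra [simp]: "space (coord_algebra T) = path_space"
  unfolding coord_algebra_def by (rule space_measure_of) auto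

lemma space_path_filtration [simp]: "space (path_filtration t) = path_space"
  by (simp add: path_filtration_def)

lemma space_path_algebra [simp]: "space path_algebra = path_space"
  by (simp add: path_algebra_def)

lemma sets_coord_algebra:
  "sets (coord_algebra T) = sigma_sets path_space {{\<omega> \<in> path_space. \<omega> s \<in> A} | s A. s \<in> T \<and> A \<in> sets borel}"
  unfolding coord_algebra_def by (rule sets_measure_of) auto

lemma coord_measurable: "s \<in> T \<Longrightarrow> (\<lambda>\<omega>. \<omega> s) \<in> borel_measurable (coord_algebra T)"
proof (rule measurableI)
  fix A :: "real set" assume "s \<in> T" "A \<in> sets borel"
  then have "{\<omega> \<in> path_space. \<omega> s \<in> A} \<in> sets (coord_algebra T)"
    unfolding sets_coord_algebra by (intro sigma_sets.Basic) auto
  then show "(\<lambda>\<omega>. \<omega> s) -` A \<inter> space (coord_algebra T) \<in> sets (coord_algebra T)"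
    by (simp add: vimage_def Int_def conj_commute)
qed simp

lemma coord_algebra_mono:
  assumes "S \<subseteq> T" shows "sets (coord_algebra S) \<subseteq> sets (coord_algebra T)"
  unfolding sets_coord_algebra using assms by (intro sigma_sets_mono') auto

lemma subalgebra_path_filtration:
  assumes "s \<le> t" shows "subalgebra (path_filtration t) (path_filtration s)"
  using coord_algebra_mono[of "{0..s}" "{0..t}"] assms by (auto simp: subalgebra_def path_filtration_def)

lemma subalgebra_path_algebra: "subalgebra path_algebra (path_filtration s)"
  using coord_algebra_mono[of "{0..s}" "{0..}"] by (auto simp: subalgebra_def path_filtration_def path_algebra_def)

lemma coord_measurable_filtration [measurable]:
  "0 \<le> s \<Longrightarrow> s \<le> t \<Longrightarrow> (\<lambda>\<omega>. \<omega> s) \<in> borel_measurable (path_filtration t)"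
  unfolding path_filtration_def by (rule coord_measurable) simp

text \<open>Evaluation is the limit of evaluations at times rounded down to multiples of 1 / (m +
  1), and these take countably many values. Clamping to [0, r] keeps everything inside
  \<open>path_filtration r\<close>, so this is progressive measurability.\<close>

lemma path_joint_measurable:
  assumes r: "0 \<le> r"
  shows "(\<lambda>p. snd p (max 0 (min (fst p) r))) \<in> borel_measurable (borel \<Otimes>\<^sub>M path_filtration r)"
proof (rule borel_measurable_LIMSEQ_metric)
  let ?M = "borel \<Otimes>\<^sub>M path_filtration r :: (real \<times> (real \<Rightarrow> real)) measure"
  let ?cl = "\<lambda>q. max 0 (min q r)"
  fix m :: nat
  have 1: "(\<lambda>p. snd p (?cl (real_of_int i / Suc m))) \<in> borel_measurable ?M" for i :: int
    by (rule measurable_compose[OF measurable_snd coord_measurable_filtration]) (use r in auto)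
  have "(\<lambda>p. \<lfloor>fst p * Suc m\<rfloor>) \<in> measurable ?M (count_space UNIV)" by measurable
  from measurable_compose_countable[OF 1 this]
  show "(\<lambda>p. snd p (?cl (real_of_int \<lfloor>fst p * Suc m\<rfloor> / Suc m))) \<in> borel_measurable ?M" .
next
  let ?cl = "\<lambda>q. max 0 (min q r)"
  fix p assume "p \<in> space (borel \<Otimes>\<^sub>M path_filtration r :: (real \<times> (real \<Rightarrow> real)) measure)"
  then have c: "continuous_on {0..} (snd p)" by (auto simp: space_pair_measure path_space_def)
  have "(\<lambda>m. real_of_int \<lfloor>fst p * Suc m\<rfloor> / Suc m) \<longlonglongrightarrow> fst p"
  proof (rule tendsto_sandwich[where f="\<lambda>m. fst p - 1 / Suc m" and h="\<lambda>m. fst p"])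
    show "\<forall>\<^sub>F m in sequentially. fst p - 1 / Suc m \<le> real_of_int \<lfloor>fst p * Suc m\<rfloor> / Suc m"
    proof (rule always_eventually, rule allI)
      fix m
      have "(fst p * Suc m - 1) / Suc m \<le> real_of_int \<lfloor>fst p * Suc m\<rfloor> / Suc m"
        by (intro divide_right_mono) linarith+
      then show "fst p - 1 / Suc m \<le> real_of_int \<lfloor>fst p * Suc m\<rfloor> / Suc m" by (simp add: diff_divide_distrib)
    qed
    show "\<forall>\<^sub>F m in sequentially. real_of_int \<lfloor>fst p * Suc m\<rfloor> / Suc m \<le> fst p"
      by (intro always_eventually allI) (simp add: divide_le_eq del: of_nat_Suc)
    show "(\<lambda>m. fst p - 1 / Suc m) \<longlonglongrightarrow> fst p"
      using tendsto_diff[OF tendsto_const LIMSEQ_inverse_real_of_nat, of "fst p"] by (simp add: divide_inverse)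
  qed simp
  then have "(\<lambda>m. ?cl (real_of_int \<lfloor>fst p * Suc m\<rfloor> / Suc m)) \<longlonglongrightarrow> ?cl (fst p)"
    by (intro tendsto_intros)
  from continuous_on_tendsto_compose[OF c this]
  show "(\<lambda>m. snd p (?cl (real_of_int \<lfloor>fst p * Suc m\<rfloor> / Suc m))) \<longlonglongrightarrow> snd p (?cl (fst p))"
    by simp
qed

context levels
begin

text \<open>By continuity a witness beyond the level can be moved slightly to the right to a
  rational time. The move also turns the weak inequality for \<sigma> k into a strict one, so the
  recursion over \<open>k\<close> runs through strict inequalities only.\<close>

lemma crossing_less_rational:
  assumes \<omega>: "\<omega> \<in> path_space"
  shows "\<sigma> (Suc k) \<omega> < ereal u \<longleftrightarrow>
    (\<exists>q\<in>\<rat>. 0 \<le> q \<and> q < u \<and> \<sigma> k \<omega> < ereal q \<and> (if even k then \<omega> q > b else \<omega> q < a))"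
proof
  assume "\<sigma> (Suc k) \<omega> < ereal u"
  then obtain t where t: "0 \<le> t" "\<sigma> k \<omega> \<le> ereal t" "t < u" "if even k then \<omega> t > b else \<omega> t < a"
    unfolding crossing_time_Suc_less_iff by auto
  define e where "e = (if even k then \<omega> t - b else a - \<omega> t)"
  have "0 < e" using t by (auto simp: e_def split: if_splits)
  then obtain d where d: "0 < d" "\<And>r. 0 \<le> r \<Longrightarrow> \<bar>r - t\<bar> < d \<Longrightarrow> \<bar>\<omega> r - \<omega> t\<bar> < e"
    using path_close[OF \<omega> t(1)] by metis
  obtain q where q: "q \<in> \<rat>" "t < q" "q < min u (t + d)"
    using Rats_dense_in_real[of t "min u (t + d)"] t d by auto
  have "\<bar>\<omega> q - \<omega> t\<bar> < e" using q t by (intro d(2)) auto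
  then have "if even k then \<omega> q > b else \<omega> q < a" by (auto simp: e_def split: if_splits)
  moreover have "\<sigma> k \<omega> < ereal q" using t q by (simp add: le_less_trans)
  ultimately show "\<exists>q\<in>\<rat>. 0 \<le> q \<and> q < u \<and> \<sigma> k \<omega> < ereal q \<and> (if even k then \<omega> q > b else \<omega> q < a)"
    using q t by (intro bexI[of _ q]) auto
next
  assume "\<exists>q\<in>\<rat>. 0 \<le> q \<and> q < u \<and> \<sigma> k \<omega> < ereal q \<and> (if even k then \<omega> q > b else \<omega> q < a)"
  then show "\<sigma> (Suc k) \<omega> < ereal u" unfolding crossing_time_Suc_less_iff by (auto intro: less_imp_le)
qed

lemma crossing_less_sets:
  "u \<le> r \<Longrightarrow> {\<omega> \<in> path_space. \<sigma> k \<omega> < ereal u} \<in> sets (path_filtration r)"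
proof (induction k arbitrary: u)
  case 0
  then show ?case using sets.top[of "path_filtration r"] by (cases "0 < u") (auto simp: zero_ereal_def)
next
  case (Suc k)
  have "{\<omega> \<in> path_space. \<sigma> (Suc k) \<omega> < ereal u} =
      (\<Union>q\<in>{q \<in> \<rat>. 0 \<le> q \<and> q < u}. {\<omega> \<in> path_space. \<sigma> k \<omega> < ereal q} \<inter>
         {\<omega> \<in> space (path_filtration r). if even k then \<omega> q > b else \<omega> q < a})"
    by (auto simp: crossing_less_rational simp del: if_split_asm split del: if_split)
  also have "\<dots> \<in> sets (path_filtration r)"
  proof (intro sets.countable_UN'' sets.Int)
    show "countable {q \<in> \<rat>. 0 \<le> q \<and> q < u}" by (rule countable_subset[OF _ countable_rat]) auto
    fix q assume q: "q \<in> {q \<in> \<rat>. 0 \<le> q \<and> q < u}"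
    then show "{\<omega> \<in> path_space. \<sigma> k \<omega> < ereal q} \<in> sets (path_filtration r)"
      using Suc by auto
    have "(\<lambda>\<omega>. \<omega> q) \<in> borel_measurable (path_filtration r)"
      using q Suc.prems by (intro coord_measurable_filtration) auto
    then show "{\<omega> \<in> space (path_filtration r). if even k then \<omega> q > b else \<omega> q < a} \<in> sets (path_filtration r)"
      by measurable
  qed
  finally show ?case .
qed

text \<open>The raw filtration at time \<open>r\<close> decides \<sigma> k < u for u \<le> r;
  truncation at \<open>r\<close> removes all other level sets.\<close>

lemma crossing_min_measurable [measurable]:
  "(\<lambda>\<omega>. min (\<sigma> k \<omega>) (ereal r)) \<in> borel_measurable (path_filtration r)"
proof (rule borel_measurableI_less)
  fix y :: ereal
  show "{\<omega> \<in> space (path_filtration r). min (\<sigma> k \<omega>) (ereal r) < y} \<in> sets (path_filtration r)"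
  proof (cases "ereal r < y")
    case True
    then have "{\<omega> \<in> space (path_filtration r). min (\<sigma> k \<omega>) (ereal r) < y} = space (path_filtration r)"
      by (auto simp: min_less_iff_disj)
    then show ?thesis by (metis sets.top)
  next
    case False
    then have "{\<omega> \<in> space (path_filtration r). min (\<sigma> k \<omega>) (ereal r) < y} = {\<omega> \<in> path_space. \<sigma> k \<omega> < y}"
      by (auto simp: min_less_iff_disj)
    then show ?thesis using crossing_less_sets[of _ r k] False by (cases y) auto
  qed
qed

lemma crossing_ge_sets: "{\<omega> \<in> path_space. ereal s \<le> \<sigma> k \<omega>} \<in> sets (path_filtration s)"
proof -
  have "{\<omega> \<in> path_space. ereal s \<le> \<sigma> k \<omega>} = space (path_filtration s) - {\<omega> \<in> path_space. \<sigma> k \<omega> < ereal s}" by auto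
  then show ?thesis using sets.compl_sets[OF crossing_less_sets[of s s k]] by simp
qed

lemma crossing_measurable [measurable]: "\<sigma> k \<in> borel_measurable path_algebra"
proof (rule borel_measurableI_less)
  have 1: "{\<omega> \<in> path_space. \<sigma> k \<omega> < ereal u} \<in> sets path_algebra" for u
    using crossing_less_sets[of u u k] subalgebra_path_algebra[of u] by (auto simp: subalgebra_def)
  fix y :: ereal
  show "{\<omega> \<in> space path_algebra. \<sigma> k \<omega> < y} \<in> sets path_algebra"
  proof (cases y)
    case PInf
    have "{\<omega> \<in> path_space. \<sigma> k \<omega> < \<infinity>} = (\<Union>n. {\<omega> \<in> path_space. \<sigma> k \<omega> < ereal (real n)})"
    proof (intro equalityI subsetI)
      fix \<omega> assume "\<omega> \<in> {\<omega> \<in> path_space. \<sigma> k \<omega> < \<infinity>}"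
      then show "\<omega> \<in> (\<Union>n. {\<omega> \<in> path_space. \<sigma> k \<omega> < ereal (real n)})"
        using less_PInf_Ex_of_nat[of "\<sigma> k \<omega>"] by auto
    next
      fix \<omega> assume "\<omega> \<in> (\<Union>n. {\<omega> \<in> path_space. \<sigma> k \<omega> < ereal (real n)})"
      then show "\<omega> \<in> {\<omega> \<in> path_space. \<sigma> k \<omega> < \<infinity>}" by (auto simp: less_PInf_Ex_of_nat)
    qed
    then show ?thesis using PInf 1 by auto
  qed (use 1 in auto)
qed

lemma lphase_joint_measurable:
  assumes r: "0 \<le> r"
  shows "(\<lambda>p. lphase (max 0 (min (fst p) r)) (snd p)) \<in> measurable (borel \<Otimes>\<^sub>M path_filtration r) (count_space UNIV)"
proof (subst measurable_count_space_eq2_countable, safe)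
  let ?cl = "\<lambda>q. max 0 (min q r)" and ?M = "borel \<Otimes>\<^sub>M path_filtration r :: (real \<times> (real \<Rightarrow> real)) measure"
  have 1: "{p \<in> space ?M. lphase (?cl (fst p)) (snd p) \<le> k} \<in> sets ?M" for k
  proof -
    have "{p \<in> space ?M. lphase (?cl (fst p)) (snd p) \<le> k} =
      {p \<in> space ?M. ereal (?cl (fst p)) \<le> min (\<sigma> (Suc k) (snd p)) (ereal r)}"
      using r by (auto simp: lphase_le_iff space_pair_measure)
    also have "\<dots> \<in> sets ?M" by measurable
    finally show ?thesis .
  qed
  fix k
  have "(\<lambda>p. lphase (?cl (fst p)) (snd p)) -` {k} \<inter> space ?M =
    {p \<in> space ?M. lphase (?cl (fst p)) (snd p) \<le> k} -
    (if k = 0 then {} else {p \<in> space ?M. lphase (?cl (fst p)) (snd p) \<le> k - 1})" by auto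
  then show "(\<lambda>p. lphase (?cl (fst p)) (snd p)) -` {k} \<inter> space ?M \<in> sets ?M"
    using 1[of k] 1[of "k - 1"] by (cases k) simp_all
qed auto

lemma joint_measurable:
  fixes h :: "nat \<Rightarrow> real \<Rightarrow> 'b::topological_space"
  assumes r: "0 \<le> r" and h[measurable]: "\<And>k. h k \<in> borel_measurable borel"
  shows "(\<lambda>p. h (lphase (max 0 (min (fst p) r)) (snd p)) (snd p (max 0 (min (fst p) r))))
    \<in> borel_measurable (borel \<Otimes>\<^sub>M path_filtration r)"
  by (rule measurable_compose_countable[OF _ lphase_joint_measurable[OF r]])
     (rule measurable_compose[OF path_joint_measurable[OF r] h])

lemma lphase_fun_measurable:
  fixes h :: "nat \<Rightarrow> real \<Rightarrow> 'b::topological_space"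
  assumes r: "0 \<le> r" and h: "\<And>k. h k \<in> borel_measurable borel"
  shows "(\<lambda>\<omega>. h (lphase r \<omega>) (\<omega> r)) \<in> borel_measurable (path_filtration r)"
  using measurable_compose[OF measurable_Pair1' joint_measurable[OF r h], of r] r by simp

text \<open>Positive times are expressed through the left phase, time 0 through the explicit formula
  in the starting value.\<close>

lemma pval_measurable:
  assumes t: "0 \<le> t" and g: "glued \<alpha> c"
  shows "pval \<alpha> c t \<in> borel_measurable (path_filtration t)"
proof (cases "t = 0")
  case True
  have "(\<lambda>\<omega>. if b < \<omega> 0 then \<alpha> 1 + c 1 * \<omega> 0 else \<alpha> 0 + c 0 * \<omega> 0) \<in> borel_measurable (path_filtration t)"
  proof -
    have [measurable]: "(\<lambda>\<omega>. \<omega> 0) \<in> borel_measurable (path_filtration t)"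
      using True by (intro coord_measurable_filtration) auto
    show ?thesis by measurable
  qed
  then show ?thesis unfolding True
    by (rule measurable_cong[THEN iffD1, rotated]) (simp add: pval_zero[OF _ g])
next
  case False
  have "(\<lambda>\<omega>. \<alpha> (lphase t \<omega>) + c (lphase t \<omega>) * \<omega> t) \<in> borel_measurable (path_filtration t)"
    by (rule lphase_fun_measurable[OF t, where h="\<lambda>k x. \<alpha> k + c k * x"]) measurable
  then show ?thesis
    by (rule measurable_cong[THEN iffD1, rotated]) (use False t in \<open>simp add: pval_eq_lphase[OF _ _ g]\<close>)
qed

text \<open>Stated for the full algebra because t < \<sigma> (Suc k) involves the path immediately
  after t.\<close>

lemma phase_measurable [measurable]:
  "phase t \<in> measurable path_algebra (count_space UNIV)"
proof (subst measurable_count_space_eq2_countable, safe)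
  have 1: "{\<omega> \<in> path_space. phase t \<omega> \<le> k} \<in> sets path_algebra" for k
  proof -
    have "{\<omega> \<in> path_space. phase t \<omega> \<le> k} = {\<omega> \<in> space path_algebra. ereal t < \<sigma> (Suc k) \<omega>}"
      by (auto simp: phase_le_iff)
    also have "\<dots> \<in> sets path_algebra" by measurable
    finally show ?thesis .
  qed
  fix k
  have "phase t -` {k} \<inter> space path_algebra =
    {\<omega> \<in> path_space. phase t \<omega> \<le> k} - (if k = 0 then {} else {\<omega> \<in> path_space. phase t \<omega> \<le> k - 1})" by auto
  then show "phase t -` {k} \<inter> space path_algebra \<in> sets path_algebra"
    using 1[of k] 1[of "k - 1"] by (cases k) simp_all
qed auto

end

section \<open>Exponential martingales of phase-dependent integrands\<close>

text \<open>With \<open>F i\<close> frozen the coefficient \<xi> i is a constant, and the factor of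
  step i integrates to the characteristic function of \<open>gauss h\<close> at \<xi> i. The
  compensating real exponential is its reciprocal, so each step preserves the expectation.\<close>

lemma exp_transform_discrete:
  fixes W :: "'a \<Rightarrow> complex" and F :: "nat \<Rightarrow> 'a measure"
  assumes M: "prob_space M" and h: "0 < h"
    and F: "\<And>i. i \<le> n \<Longrightarrow> subalgebra M (F i)" "\<And>i. i < n \<Longrightarrow> subalgebra (F (Suc i)) (F i)"
    and D: "\<And>i. i < n \<Longrightarrow> gaussian_indep M (F i) h (D i)" "\<And>i. i < n \<Longrightarrow> D i \<in> borel_measurable (F (Suc i))"
    and \<xi>: "\<And>i. i < n \<Longrightarrow> \<xi> i \<in> borel_measurable (F i)" "\<And>i \<omega>. i < n \<Longrightarrow> \<bar>\<xi> i \<omega>\<bar> \<le> C"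
    and W: "W \<in> borel_measurable (F 0)" "\<And>\<omega>. norm (W \<omega>) \<le> B"
  shows "(\<lambda>\<omega>. W \<omega> * iexp (\<Sum>i<n. \<xi> i \<omega> * D i \<omega>) * exp (h / 2 * (\<Sum>i<n. (\<xi> i \<omega>)\<^sup>2))) \<in> borel_measurable (F n)"
      (is "?m n")
    and "(CLINT \<omega>|M. W \<omega> * iexp (\<Sum>i<n. \<xi> i \<omega> * D i \<omega>) * exp (h / 2 * (\<Sum>i<n. (\<xi> i \<omega>)\<^sup>2))) = (CLINT \<omega>|M. W \<omega>)"
      (is "?e n")
proof -
  interpret prob_space M by fact
  interpret G: real_distribution "gauss h" by (rule real_distribution_gauss[OF h])
  define Z where "Z n \<omega> = W \<omega> * iexp (\<Sum>i<n. \<xi> i \<omega> * D i \<omega>) * exp (h / 2 * (\<Sum>i<n. (\<xi> i \<omega>)\<^sup>2))" for n \<omega>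
  have B0: "0 \<le> B" using W(2)[of undefined] norm_ge_zero order_trans by blast
  have bound: "norm (Z m \<omega>) \<le> B * exp (h / 2 * (m * C\<^sup>2))" if "m \<le> n" for m \<omega>
  proof -
    have "(\<Sum>i<m. (\<xi> i \<omega>)\<^sup>2) \<le> (\<Sum>i<m. C\<^sup>2)"
    proof (rule sum_mono)
      fix i assume "i \<in> {..<m}"
      then have "\<bar>\<xi> i \<omega>\<bar> \<le> C" using \<xi>(2) that by auto
      then show "(\<xi> i \<omega>)\<^sup>2 \<le> C\<^sup>2" by (rule abs_le_square_iff[THEN iffD1, OF order_trans[OF _ abs_ge_self]])
    qed
    then have "exp (h / 2 * (\<Sum>i<m. (\<xi> i \<omega>)\<^sup>2)) \<le> exp (h / 2 * (m * C\<^sup>2))" using h by simp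
    then have "norm (W \<omega>) * exp (h / 2 * (\<Sum>i<m. (\<xi> i \<omega>)\<^sup>2)) \<le> B * exp (h / 2 * (m * C\<^sup>2))"
      using W(2) B0 by (intro mult_mono) auto
    then show ?thesis by (simp add: Z_def norm_mult)
  qed
  have "m \<le> n \<Longrightarrow> Z m \<in> borel_measurable (F m) \<and> (CLINT \<omega>|M. Z m \<omega>) = (CLINT \<omega>|M. W \<omega>)" for m
  proof (induction m)
    case 0 then show ?case using W by (simp add: Z_def[abs_def])
  next
    case (Suc m)
    then have mn: "m < n" and IH: "Z m \<in> borel_measurable (F m)" "(CLINT \<omega>|M. Z m \<omega>) = (CLINT \<omega>|M. W \<omega>)" by auto
    note [measurable] = IH(1) \<xi>(1)[OF mn]
    have sF: "subalgebra M (F m)" using F(1)[of m] mn by simp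
    have ZS: "Z (Suc m) \<omega> = Z m \<omega> * iexp (\<xi> m \<omega> * D m \<omega>) * exp (h / 2 * (\<xi> m \<omega>)\<^sup>2)" for \<omega>
      by (simp add: Z_def exp_add algebra_simps)
    have m1: "Z (Suc m) \<in> borel_measurable (F (Suc m))"
    proof -
      have [measurable]: "Z m \<in> borel_measurable (F (Suc m))" "\<xi> m \<in> borel_measurable (F (Suc m))"
        using F(2)[OF mn] IH(1) \<xi>(1)[OF mn] by (auto intro: measurable_from_subalg)
      note [measurable] = D(2)[OF mn]
      show ?thesis unfolding ZS[abs_def] by measurable
    qed
    let ?f = "\<lambda>p. Z m (fst p) * iexp (\<xi> m (fst p) * snd p) * complex_of_real (exp (h / 2 * (\<xi> m (fst p))\<^sup>2))"
    have fm: "?f \<in> borel_measurable (F m \<Otimes>\<^sub>M borel)" by measurable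
    have int: "integrable M (\<lambda>\<omega>. ?f (\<omega>, D m \<omega>))"
    proof (rule integrable_const_bound[of _ "B * exp (h / 2 * (Suc m * C\<^sup>2))"])
      show "AE \<omega> in M. norm (?f (\<omega>, D m \<omega>)) \<le> B * exp (h / 2 * (Suc m * C\<^sup>2))"
        using bound[of "Suc m"] mn by (intro AE_I2) (simp add: ZS del: of_nat_Suc)
      have "(\<lambda>\<omega>. ?f (\<omega>, D m \<omega>)) = Z (Suc m)" by (auto simp: ZS)
      then show "(\<lambda>\<omega>. ?f (\<omega>, D m \<omega>)) \<in> borel_measurable M"
        using m1 F(1)[of "Suc m"] mn by (simp add: measurable_from_subalg)
    qed
    have inner: "(CLINT x|gauss h. ?f (\<omega>, x)) = Z m \<omega>" for \<omega>
    proof -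
      have "(CLINT x|gauss h. ?f (\<omega>, x)) =
          (CLINT x|gauss h. (Z m \<omega> * complex_of_real (exp (h / 2 * (\<xi> m \<omega>)\<^sup>2))) * iexp (\<xi> m \<omega> * x))"
        by (intro Bochner_Integration.integral_cong) (auto simp: mult_ac)
      also have "\<dots> = (Z m \<omega> * complex_of_real (exp (h / 2 * (\<xi> m \<omega>)\<^sup>2))) * char (gauss h) (\<xi> m \<omega>)"
        unfolding char_def by (rule integral_mult_right_zero)
      also have "\<dots> = Z m \<omega> * complex_of_real (exp (h / 2 * (\<xi> m \<omega>)\<^sup>2) * exp (- ((\<xi> m \<omega>)\<^sup>2 * h / 2)))"
        by (simp add: char_gauss[OF h])
      also have "exp (h / 2 * (\<xi> m \<omega>)\<^sup>2) * exp (- ((\<xi> m \<omega>)\<^sup>2 * h / 2)) = 1"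
        by (simp add: exp_add[symmetric])
      finally show ?thesis by simp
    qed
    have "(CLINT \<omega>|M. Z (Suc m) \<omega>) = (CLINT \<omega>|M. ?f (\<omega>, D m \<omega>))" by (simp add: ZS)
    also have "\<dots> = (CLINT \<omega>|M. Z m \<omega>)"
      unfolding gaussian_indep_freeze(1)[OF M sF D(1)[OF mn] h fm int] inner ..
    finally show ?case using IH m1 by simp
  qed
  from this[of n] show "?m n" "?e n" by (auto simp: Z_def[abs_def])
qed

section \<open>Wiener measure and exponential martingales in continuous time\<close>

locale wiener = levels +
  fixes P :: "(real \<Rightarrow> real) measure"
  assumes wiener: "wiener_measure P"
begin

sublocale prob_space P
  using wiener by (simp add: wiener_measure_def brownian_motion_def)

abbreviation F :: "real \<Rightarrow> (real \<Rightarrow> real) measure" where "F \<equiv> path_filtration"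

lemma sets_P [measurable_cong, simp]: "sets P = sets path_algebra"
  using wiener by (simp add: wiener_measure_def)

lemma space_P [simp]: "space P = path_space"
  using sets_eq_imp_space_eq[OF sets_P] by simp

lemma subalgebra_P: "subalgebra P (F s)"
  using subalgebra_path_algebra[of s] by (simp add: subalgebra_def)

lemma start_zero: "AE \<omega> in P. \<omega> 0 = 0"
  using wiener by (simp add: wiener_measure_def brownian_motion_def)

lemma increment_gaussian:
  "0 \<le> s \<Longrightarrow> s < t \<Longrightarrow> gaussian_indep P (F s) (t - s) (\<lambda>\<omega>. \<omega> t - \<omega> s)"
  using wiener by (simp add: wiener_measure_def brownian_motion_def gaussian_indep_def)

lemma coord_measurable_P [measurable]: "0 \<le> s \<Longrightarrow> (\<lambda>\<omega>. \<omega> s) \<in> borel_measurable P"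
  by (rule measurable_from_subalg[OF subalgebra_P[of s] coord_measurable_filtration]) auto

lemma pval_measurable_P: "0 \<le> t \<Longrightarrow> glued \<alpha> c \<Longrightarrow> pval \<alpha> c t \<in> borel_measurable P"
  by (rule measurable_from_subalg[OF subalgebra_P pval_measurable])

lemma coord_integrable:
  assumes "0 \<le> t" shows "integrable P (\<lambda>\<omega>. \<omega> t)"
proof (cases "t = 0")
  case True
  have "integrable P (\<lambda>\<omega>. \<omega> 0) \<longleftrightarrow> integrable P (\<lambda>\<omega>. 0 :: real)"
    using start_zero by (intro integrable_cong_AE) auto
  then show ?thesis using True by simp
next
  case False
  then have t: "0 < t" using assms by simp
  note g = increment_gaussian[of 0 t, OF order_refl t, simplified]
  have "distributed P lborel (\<lambda>\<omega>. \<omega> t - \<omega> 0) (normal_density 0 (sqrt t))"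
    using g by (simp add: gaussian_indep_def)
  moreover have "integrable lborel (\<lambda>x. normal_density 0 (sqrt t) x * x)"
    using integrable_normal_moment[of "sqrt t" 0 1] t by simp
  ultimately have "integrable P (\<lambda>\<omega>. \<omega> t - \<omega> 0)"
    by (subst distributed_integrable[symmetric, where g="\<lambda>x. x"]) auto
  moreover have "integrable P (\<lambda>\<omega>. \<omega> t - \<omega> 0) \<longleftrightarrow> integrable P (\<lambda>\<omega>. \<omega> t)"
  proof (rule integrable_cong_AE)
    show "AE \<omega> in P. \<omega> t - \<omega> 0 = \<omega> t" using start_zero by eventually_elim simp
  qed (use t in \<open>auto intro!: borel_measurable_diff coord_measurable_P\<close>)
  ultimately show ?thesis by simp
qed

lemma pval_integrable:
  assumes t: "0 \<le> t" and g: "glued \<alpha> c" and C: "\<And>k. \<bar>\<alpha> k\<bar> \<le> C" "\<And>k. \<bar>c k\<bar> \<le> C"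
  shows "integrable P (pval \<alpha> c t)"
proof (rule Bochner_Integration.integrable_bound)
  show "integrable P (\<lambda>\<omega>. C + C * \<bar>\<omega> t\<bar>)"
    using coord_integrable[OF t] by auto
  show "pval \<alpha> c t \<in> borel_measurable P" by (rule pval_measurable_P[OF t g])
  show "AE \<omega> in P. norm (pval \<alpha> c t \<omega>) \<le> norm (C + C * \<bar>\<omega> t\<bar>)"
  proof (rule AE_I2)
    fix \<omega>
    have "\<bar>\<alpha> (phase t \<omega>) + c (phase t \<omega>) * \<omega> t\<bar> \<le> C + C * \<bar>\<omega> t\<bar>"
      using C(1)[of "phase t \<omega>"] mult_right_mono[OF C(2)[of "phase t \<omega>"], of "\<bar>\<omega> t\<bar>"]
      by (simp add: abs_mult order_trans[OF abs_triangle_ineq] add_mono)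
    then show "norm (pval \<alpha> c t \<omega>) \<le> norm (C + C * \<bar>\<omega> t\<bar>)" by (simp add: pval_def)
  qed
qed

lemma step_integral_bound:
  fixes c :: "nat \<Rightarrow> real"
  assumes C: "\<And>k. \<bar>c k\<bar> \<le> C" and st: "s \<le> t" and \<omega>: "\<omega> \<in> path_space"
  shows "\<bar>integral {s..t} (\<lambda>r. c (lphase r \<omega>))\<bar> \<le> C * (t - s)"
  using integral_norm_bound_integral[OF step_integrable[OF \<omega>, of c C s t] integrable_const_ivl[of C s t]] C st
  by (simp add: mult.commute)

lemma step_integral_measurable:
  fixes c :: "nat \<Rightarrow> real"
  assumes C: "\<And>k. \<bar>c k\<bar> \<le> C" and st: "0 \<le> s" "s \<le> t"
  shows "(\<lambda>\<omega>. integral {s..t} (\<lambda>r. c (lphase r \<omega>))) \<in> borel_measurable (F t)"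
proof (rule borel_measurable_LIMSEQ_metric)
  fix \<omega> assume "\<omega> \<in> space (F t)"
  then show "(\<lambda>n. \<Sum>i<n. c (lphase (s + (t - s) * real i / real n) \<omega>) * ((t - s) / real n)) \<longlonglongrightarrow> integral {s..t} (\<lambda>r. c (lphase r \<omega>))"
    using step_riemann[OF _ C st] by simp
next
  fix n
  have "(\<lambda>\<omega>. c (lphase (s + (t - s) * real i / real n) \<omega>)) \<in> borel_measurable (F t)" if "i < n" for i
  proof -
    have 1: "(t - s) * (real i / real n) \<le> (t - s) * 1"
      using that st by (intro mult_left_mono) auto
    show ?thesis
      using lphase_fun_measurable[of "s + (t - s) * real i / real n" "\<lambda>k x. c k"] st 1
      by (intro measurable_from_subalg[OF subalgebra_path_filtration[of "s + (t - s) * real i / real n" t]]) auto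
  qed
  then show "(\<lambda>\<omega>. \<Sum>i<n. c (lphase (s + (t - s) * real i / real n) \<omega>) * ((t - s) / real n)) \<in> borel_measurable (F t)"
    by (intro borel_measurable_sum borel_measurable_times) auto
qed

text \<open>The discrete identity on uniform grids passes to the limit: the exponents converge on
  every path by \<open>pval_riemann\<close> and \<open>step_riemann\<close>, and bounded
  coefficients give a constant majorant.\<close>

theorem exp_martingale:
  fixes W :: "(real \<Rightarrow> real) \<Rightarrow> complex"
  assumes st: "0 \<le> s" "s \<le> t" and g: "glued \<alpha> c" and C: "\<And>k. \<bar>c k\<bar> \<le> C"
    and W: "W \<in> borel_measurable (F s)" "\<And>\<omega>. norm (W \<omega>) \<le> B"
  shows "(CLINT \<omega>|P. W \<omega> * iexp (pval \<alpha> c t \<omega> - pval \<alpha> c s \<omega>) *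
      exp (1 / 2 * integral {s..t} (\<lambda>r. (c (lphase r \<omega>))\<^sup>2))) = (CLINT \<omega>|P. W \<omega>)"
proof (cases "s = t")
  case True then show ?thesis by simp
next
  case False
  with st have lt: "s < t" by simp
  have B0: "0 \<le> B" using W(2)[of undefined] norm_ge_zero order_trans by blast
  have C2: "\<bar>(c k)\<^sup>2\<bar> \<le> C\<^sup>2" for k
    using abs_le_square_iff[THEN iffD1, OF order_trans[OF C[of k] abs_ge_self]] by simp
  have WP: "W \<in> borel_measurable P" by (rule measurable_from_subalg[OF subalgebra_P W(1)])
  define g' where "g' n i = s + (t - s) * real i / real n" for n i :: nat
  define S where "S n \<omega> = W \<omega> * iexp (\<Sum>i<n. c (lphase (g' n i) \<omega>) * (\<omega> (g' n (Suc i)) - \<omega> (g' n i))) *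
      exp ((t - s) / real n / 2 * (\<Sum>i<n. (c (lphase (g' n i) \<omega>))\<^sup>2))" for n \<omega>
  define L where "L \<omega> = W \<omega> * iexp (pval \<alpha> c t \<omega> - pval \<alpha> c s \<omega>) *
      exp (1 / 2 * integral {s..t} (\<lambda>r. (c (lphase r \<omega>))\<^sup>2))" for \<omega>
  have gin: "s \<le> g' n i" "i \<le> n \<Longrightarrow> g' n i \<le> t" for n i
  proof -
    show "s \<le> g' n i" using lt by (simp add: g'_def)
    assume "i \<le> n"
    then have "(t - s) * (real i / real n) \<le> (t - s) * 1"
      using st by (intro mult_left_mono) (auto simp: divide_le_eq)
    then show "g' n i \<le> t" by (simp add: g'_def)
  qed
  have g0: "0 \<le> g' n i" for n i using gin(1)[of n i] st by simp
  have gS: "g' n (Suc i) - g' n i = (t - s) / real n" for n i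
    by (simp add: g'_def add_divide_distrib distrib_left)
  have gless: "g' n i < g' n (Suc i)" if "0 < n" for n i
    using gS[of n i] lt that by (metis diff_gt_0_iff_gt divide_pos_pos of_nat_0_less_iff)
  have disc: "S n \<in> borel_measurable (F (g' n n)) \<and> (CLINT \<omega>|P. S n \<omega>) = (CLINT \<omega>|P. W \<omega>)" if n: "0 < n" for n
  proof -
    have h: "0 < (t - s) / real n" using lt n by simp
    have 1: "\<And>i. i \<le> n \<Longrightarrow> subalgebra P (F (g' n i))" by (rule subalgebra_P)
    have 2: "\<And>i. i < n \<Longrightarrow> subalgebra (F (g' n (Suc i))) (F (g' n i))"
      using gless[OF n] by (intro subalgebra_path_filtration less_imp_le)
    have 3: "\<And>i. i < n \<Longrightarrow> gaussian_indep P (F (g' n i)) ((t - s) / real n) (\<lambda>\<omega>. \<omega> (g' n (Suc i)) - \<omega> (g' n i))"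
      using increment_gaussian[OF g0 gless[OF n]] unfolding gS .
    have 4: "\<And>i. i < n \<Longrightarrow> (\<lambda>\<omega>. \<omega> (g' n (Suc i)) - \<omega> (g' n i)) \<in> borel_measurable (F (g' n (Suc i)))"
      using g0 less_imp_le[OF gless[OF n]] by (intro borel_measurable_diff coord_measurable_filtration) auto
    have 5: "\<And>i. i < n \<Longrightarrow> (\<lambda>\<omega>. c (lphase (g' n i) \<omega>)) \<in> borel_measurable (F (g' n i))"
      using lphase_fun_measurable[OF g0, of "\<lambda>k x. c k"] by simp
    have 6: "W \<in> borel_measurable (F (g' n 0))" using W(1) by (simp add: g'_def)
    show ?thesis
      unfolding S_def[abs_def]
      using exp_transform_discrete[OF prob_space_axioms h 1 2 3 4 5 C 6 W(2)] by auto
  qed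
  have gn: "g' n n = t" if "0 < n" for n using that by (simp add: g'_def)
  have ex: "exp (x / 2 * y) \<le> exp (C\<^sup>2 * (t - s) / 2)" if "x * y \<le> C\<^sup>2 * (t - s)" for x y
    using that by simp
  have Sb: "norm (S n \<omega>) \<le> B * exp (C\<^sup>2 * (t - s) / 2)" if "0 < n" for n \<omega>
  proof -
    have "(t - s) / real n * (\<Sum>i<n. (c (lphase (g' n i) \<omega>))\<^sup>2) \<le> (t - s) / real n * (\<Sum>i<n. C\<^sup>2)"
      using C2 lt by (intro mult_left_mono sum_mono) auto
    then have "norm (W \<omega>) * exp ((t - s) / real n / 2 * (\<Sum>i<n. (c (lphase (g' n i) \<omega>))\<^sup>2)) \<le> B * exp (C\<^sup>2 * (t - s) / 2)"
      using W(2) B0 that by (intro mult_mono[OF _ ex]) (auto simp: mult.commute)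
    then show ?thesis by (simp add: S_def norm_mult)
  qed
  \<comment> \<open>The index is shifted because the discrete identity holds for a positive number
    of cells; for none the mesh is a division by zero.\<close>
  have lim: "(\<lambda>n. S (Suc n) \<omega>) \<longlonglongrightarrow> L \<omega>" if "\<omega> \<in> path_space" for \<omega>
  proof (rule LIMSEQ_Suc)
    have 1: "(\<lambda>n. \<Sum>i<n. c (lphase (g' n i) \<omega>) * (\<omega> (g' n (Suc i)) - \<omega> (g' n i))) \<longlonglongrightarrow> pval \<alpha> c t \<omega> - pval \<alpha> c s \<omega>"
      unfolding g'_def by (rule pval_riemann[OF that g C st])
    have "(\<lambda>n. \<Sum>i<n. (c (lphase (g' n i) \<omega>))\<^sup>2 * ((t - s) / real n)) \<longlonglongrightarrow> integral {s..t} (\<lambda>r. (c (lphase r \<omega>))\<^sup>2)"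
      unfolding g'_def by (rule step_riemann[OF that C2 st])
    then have "(\<lambda>n. 1 / 2 * (\<Sum>i<n. (c (lphase (g' n i) \<omega>))\<^sup>2 * ((t - s) / real n))) \<longlonglongrightarrow> 1 / 2 * integral {s..t} (\<lambda>r. (c (lphase r \<omega>))\<^sup>2)"
      by (rule tendsto_mult_left)
    moreover have "1 / 2 * (\<Sum>i<n. (c (lphase (g' n i) \<omega>))\<^sup>2 * ((t - s) / real n)) =
        (t - s) / real n / 2 * (\<Sum>i<n. (c (lphase (g' n i) \<omega>))\<^sup>2)" for n
      unfolding sum_distrib_right[symmetric] by (simp add: mult.commute)
    ultimately have 2: "(\<lambda>n. (t - s) / real n / 2 * (\<Sum>i<n. (c (lphase (g' n i) \<omega>))\<^sup>2)) \<longlonglongrightarrow> 1 / 2 * integral {s..t} (\<lambda>r. (c (lphase r \<omega>))\<^sup>2)"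
      by simp
    show "(\<lambda>n. S n \<omega>) \<longlonglongrightarrow> L \<omega>"
      unfolding S_def L_def by (intro tendsto_intros 1 2)
  qed
  have Sm: "S (Suc n) \<in> borel_measurable P" for n
    using disc[of "Suc n"] by (auto intro: measurable_from_subalg[OF subalgebra_P])
  have "(\<lambda>n. CLINT \<omega>|P. S (Suc n) \<omega>) \<longlonglongrightarrow> (CLINT \<omega>|P. L \<omega>)"
  proof (rule integral_dominated_convergence[where w="\<lambda>_. B * exp (C\<^sup>2 * (t - s) / 2)"])
    show "L \<in> borel_measurable P"
      by (rule borel_measurable_LIMSEQ_metric[OF Sm]) (use lim in simp)
    show "AE \<omega> in P. (\<lambda>n. S (Suc n) \<omega>) \<longlonglongrightarrow> L \<omega>" using lim by (intro AE_I2) simp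
    show "AE \<omega> in P. norm (S (Suc n) \<omega>) \<le> B * exp (C\<^sup>2 * (t - s) / 2)" for n using Sb by (intro AE_I2) simp
  qed (use Sm in auto)
  moreover have "(CLINT \<omega>|P. S (Suc n) \<omega>) = (CLINT \<omega>|P. W \<omega>)" for n using disc[of "Suc n"] by simp
  ultimately have "(\<lambda>n. CLINT \<omega>|P. W \<omega>) \<longlonglongrightarrow> (CLINT \<omega>|P. L \<omega>)" by simp
  then have "(CLINT \<omega>|P. L \<omega>) = (CLINT \<omega>|P. W \<omega>)" by (simp add: LIMSEQ_const_iff)
  then show ?thesis by (simp add: L_def)
qed

text \<open>A form of Levy's characterisation of Brownian motion: for coefficients of absolute value
  1 the compensator is deterministic and leaves the expectation, so \<open>exp_martingale\<close>
  becomes the criterion of \<open>gaussian_indepI_char\<close>.\<close>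

lemma gaussian_pval_increment:
  assumes st: "0 \<le> s" "s < t" and g: "glued \<alpha> c" and c: "\<And>k. (c k)\<^sup>2 = 1"
  shows "gaussian_indep P (F s) (t - s) (\<lambda>\<omega>. pval \<alpha> c t \<omega> - pval \<alpha> c s \<omega>)"
proof (rule gaussian_indepI_char[OF prob_space_axioms subalgebra_P])
  show "(\<lambda>\<omega>. pval \<alpha> c t \<omega> - pval \<alpha> c s \<omega>) \<in> borel_measurable P"
    using st g by (intro borel_measurable_diff pval_measurable_P) auto
  fix A l assume A: "A \<in> sets (F s)"
  have g': "glued (\<lambda>k. l * \<alpha> k) (\<lambda>k. l * c k)"
    using g unfolding glued_def by (metis distrib_left mult.assoc)
  have pv: "pval (\<lambda>k. l * \<alpha> k) (\<lambda>k. l * c k) u \<omega> = l * pval \<alpha> c u \<omega>" for u \<omega>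
    by (simp add: pval_def algebra_simps)
  have c1: "\<bar>c k\<bar> = 1" for k using c[of k] by (metis abs_square_eq_1)
  have 1: "(CLINT \<omega>|P. indicator A \<omega> * iexp (l * (pval \<alpha> c t \<omega> - pval \<alpha> c s \<omega>)) * exp (1 / 2 * (l\<^sup>2 * (t - s))))
     = (CLINT \<omega>|P. indicator A \<omega>)"
  proof -
    have "(CLINT \<omega>|P. indicator A \<omega> * iexp (pval (\<lambda>k. l * \<alpha> k) (\<lambda>k. l * c k) t \<omega> - pval (\<lambda>k. l * \<alpha> k) (\<lambda>k. l * c k) s \<omega>) *
        exp (1 / 2 * integral {s..t} (\<lambda>r. (l * c (lphase r \<omega>))\<^sup>2))) = (CLINT \<omega>|P. indicator A \<omega>)"
    proof (rule exp_martingale[OF st(1) less_imp_le[OF st(2)] g'])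
      show "\<bar>l * c k\<bar> \<le> \<bar>l\<bar>" for k by (simp add: abs_mult c1)
      show "indicator A \<in> borel_measurable (F s)" using A by simp
      show "norm (indicator A \<omega> :: complex) \<le> 1" for \<omega> by (simp add: indicator_def)
    qed
    moreover have "integral {s..t} (\<lambda>r. (l * c (lphase r \<omega>))\<^sup>2) = l\<^sup>2 * (t - s)" for \<omega>
      using st by (simp add: power_mult_distrib c mult.commute)
    ultimately show ?thesis by (simp only: pv right_diff_distrib)
  qed
  have "(CLINT \<omega>|P. indicator A \<omega> * iexp (l * (pval \<alpha> c t \<omega> - pval \<alpha> c s \<omega>)) * exp (1 / 2 * (l\<^sup>2 * (t - s))))
     = (CLINT \<omega>|P. indicator A \<omega> * iexp (l * (pval \<alpha> c t \<omega> - pval \<alpha> c s \<omega>))) * exp (1 / 2 * (l\<^sup>2 * (t - s)))"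
    by (rule integral_mult_left_zero)
  moreover have "(CLINT \<omega>|P. indicator A \<omega>) = measure P A"
  proof -
    have "(CLINT \<omega>|P. indicator A \<omega>) = (CLINT \<omega>|P. complex_of_real (indicator A \<omega>))"
      by (intro Bochner_Integration.integral_cong) (auto simp: indicator_def)
    also have "\<dots> = measure P A"
      using A subalgebra_P[of s] sets.sets_into_space[OF A]
      by (subst integral_complex_of_real) (auto simp: subalgebra_def Int_absorb2)
    finally show ?thesis .
  qed
  ultimately show "(CLINT \<omega>|P. indicator A \<omega> * iexp (l * (pval \<alpha> c t \<omega> - pval \<alpha> c s \<omega>))) =
      measure P A * exp (- (l\<^sup>2 * (t - s) / 2))"
    using 1 by (simp add: exp_minus field_simps)
qed (use st in simp)

text \<open>The majorant for differentiating under the expectation: the two exponentials differ from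
  1 by at most \<mu> |z| and \<mu> K exp K, so the quotient is bounded independently of
  \<mu>.\<close>

lemma iexp_exp_difference_bound:
  assumes \<mu>: "0 < \<mu>" and y: "\<bar>y\<bar> \<le> \<mu> * K" "\<bar>y\<bar> \<le> K"
  shows "norm ((iexp (\<mu> * z) * complex_of_real (exp y) - 1) / \<mu>) \<le> (\<bar>z\<bar> + K) * exp K"
proof -
  have K: "0 \<le> K" using y(2) by linarith
  have 1: "norm (iexp (\<mu> * z) - 1) \<le> \<mu> * \<bar>z\<bar>"
    using iexp_approx1[of "\<mu> * z" 0] \<mu> by (simp add: abs_mult)
  have "\<bar>exp y - 1\<bar> \<le> \<bar>y\<bar> * exp \<bar>y\<bar>"
  proof (cases "0 \<le> y")
    case True
    have "1 - y \<le> exp (- y)" using exp_ge_add_one_self[of "- y"] by simp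
    then have "exp y * (1 - y) \<le> exp y * exp (- y)" by (intro mult_left_mono) auto
    then have "exp y * (1 - y) \<le> 1" by (simp add: exp_minus)
    then show ?thesis using True by (simp add: algebra_simps)
  next
    case False
    then have "\<bar>exp y - 1\<bar> = 1 - exp y" by simp
    also have "\<dots> \<le> - y" using exp_ge_add_one_self[of y] by linarith
    also have "\<dots> \<le> \<bar>y\<bar> * exp \<bar>y\<bar>" using False by simp
    finally show ?thesis .
  qed
  also have "\<dots> \<le> (\<mu> * K) * exp K" using y K \<mu> by (intro mult_mono) auto
  finally have 2: "norm (complex_of_real (exp y) - 1) \<le> (\<mu> * K) * exp K"
    by (metis norm_of_real of_real_1 of_real_diff)
  have "norm (iexp (\<mu> * z) * complex_of_real (exp y) - 1) =
      norm ((iexp (\<mu> * z) - 1) * complex_of_real (exp y) + (complex_of_real (exp y) - 1))"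
    by (simp add: algebra_simps)
  also have "\<dots> \<le> (\<mu> * \<bar>z\<bar>) * exp K + (\<mu> * K) * exp K"
  proof (rule norm_triangle_le[OF add_mono[OF _ 2]])
    show "norm ((iexp (\<mu> * z) - 1) * complex_of_real (exp y)) \<le> (\<mu> * \<bar>z\<bar>) * exp K"
      unfolding norm_mult using 1 y \<mu> by (intro mult_mono) auto
  qed
  also have "\<dots> = ((\<bar>z\<bar> + K) * exp K) * \<mu>" by (simp add: algebra_simps)
  finally show ?thesis using \<mu> by (simp add: norm_divide divide_le_eq)
qed

text \<open>A difference quotient at 0 of the entire function exp (i z w + p w + q w^2), taken along
  w = 1 / (n + 1); the quadratic term does not reach the derivative.\<close>

lemma iexp_exp_difference_tendsto:
  "(\<lambda>n. (iexp (1 / real (Suc n) * z) * complex_of_real (exp (1 / real (Suc n) * p + (1 / real (Suc n))\<^sup>2 * q)) - 1) / (1 / real (Suc n)))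
    \<longlonglongrightarrow> \<i> * z + p"
proof -
  have "((\<lambda>w::complex. exp (\<i> * z * w + p * w + q * w\<^sup>2)) has_field_derivative (\<i> * z + p)) (at 0)"
    by (auto intro!: derivative_eq_intros)
  then have d: "((\<lambda>w::complex. (exp (\<i> * z * w + p * w + q * w\<^sup>2) - 1) / w) \<longlongrightarrow> \<i> * z + p) (at 0)"
    by (simp add: has_field_derivative_iff)
  have "filterlim (\<lambda>n. complex_of_real (1 / real (Suc n))) (at 0) sequentially"
    unfolding filterlim_at
  proof
    show "(\<lambda>n. complex_of_real (1 / real (Suc n))) \<longlonglongrightarrow> 0"
      using tendsto_of_real[OF LIMSEQ_inverse_real_of_nat, where 'a=complex] by (simp add: inverse_eq_divide)
  qed (simp del: of_nat_Suc)
  from filterlim_compose[OF d this]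
  show ?thesis
    by (simp add: exp_of_real[symmetric] exp_add[symmetric] algebra_simps power2_eq_square del: of_nat_Suc)
qed

text \<open>The derivative of the exponential martingale of \<open>l * X + \<mu> * pval\<close> at \<open>\<mu> = 0\<close>.\<close>

lemma exp_martingale_deriv:
  fixes W :: "(real \<Rightarrow> real) \<Rightarrow> complex"
  assumes st: "0 \<le> s" "s \<le> t" and g: "glued \<alpha> c" and C: "\<And>k. \<bar>\<alpha> k\<bar> \<le> C" "\<And>k. \<bar>c k\<bar> \<le> C"
    and W: "W \<in> borel_measurable (F s)" "\<And>\<omega>. norm (W \<omega>) \<le> B"
  shows "(CLINT \<omega>|P. W \<omega> * iexp (l * (\<omega> t - \<omega> s)) *
     (\<i> * (pval \<alpha> c t \<omega> - pval \<alpha> c s \<omega>) + l * integral {s..t} (\<lambda>r. c (lphase r \<omega>)))) = 0"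
proof -
  have B0: "0 \<le> B" using W(2)[of undefined] norm_ge_zero order_trans by blast
  have C0: "0 \<le> C" using C(1)[of 0] by linarith
  have C2: "\<bar>(c k)\<^sup>2\<bar> \<le> C\<^sup>2" for k
    using abs_le_square_iff[THEN iffD1, OF order_trans[OF C(2)[of k] abs_ge_self]] by simp
  have WP[measurable]: "W \<in> borel_measurable P" by (rule measurable_from_subalg[OF subalgebra_P W(1)])
  have t0: "0 \<le> t" using st by simp
  note [measurable] = coord_measurable_P[OF st(1)] coord_measurable_P[OF t0]
    pval_measurable_P[OF st(1) g] pval_measurable_P[OF t0 g]
  let ?I1 = "\<lambda>\<omega>. integral {s..t} (\<lambda>r. c (lphase r \<omega>))" and ?I2 = "\<lambda>\<omega>. integral {s..t} (\<lambda>r. (c (lphase r \<omega>))\<^sup>2)"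
  have [measurable]: "?I1 \<in> borel_measurable P" "?I2 \<in> borel_measurable P"
    using step_integral_measurable[of c C s t, OF C(2) st] step_integral_measurable[of "\<lambda>k. (c k)\<^sup>2" "C\<^sup>2" s t, OF C2 st]
    by (auto intro: measurable_from_subalg[OF subalgebra_P])
  define W' where "W' \<omega> = W \<omega> * iexp (l * (\<omega> t - \<omega> s))" for \<omega>
  have W'm[measurable]: "W' \<in> borel_measurable P" unfolding W'_def[abs_def] by measurable
  have W'b: "norm (W' \<omega>) \<le> B" for \<omega> using W(2) by (simp add: W'_def norm_mult)
  define Z where "Z \<omega> = pval \<alpha> c t \<omega> - pval \<alpha> c s \<omega>" for \<omega>
  have Zm[measurable]: "Z \<in> borel_measurable P" unfolding Z_def[abs_def] by measurable
  define E where "E \<mu> \<omega> = iexp (\<mu> * Z \<omega>) * complex_of_real (exp (\<mu> * (l * ?I1 \<omega>) + \<mu>\<^sup>2 * (?I2 \<omega> / 2)))" for \<mu> \<omega>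
  have Em[measurable]: "E \<mu> \<in> borel_measurable P" for \<mu> unfolding E_def[abs_def] by measurable
  have fam: "(CLINT \<omega>|P. W' \<omega> * E \<mu> \<omega> * complex_of_real (exp (l\<^sup>2 * (t - s) / 2))) = (CLINT \<omega>|P. W \<omega>)" for \<mu>
  proof -
    \<comment> \<open>The coordinate process is itself a glued functional, with zero offsets and
      slopes 1, so the combination has slopes \<open>l + \<mu> * c k\<close>.\<close>
    have g': "glued (\<lambda>k. \<mu> * \<alpha> k) (\<lambda>k. l + \<mu> * c k)"
      using g unfolding glued_def by (simp add: algebra_simps) (metis distrib_left mult.assoc mult.left_commute)
    have pv: "pval (\<lambda>k. \<mu> * \<alpha> k) (\<lambda>k. l + \<mu> * c k) t \<omega> - pval (\<lambda>k. \<mu> * \<alpha> k) (\<lambda>k. l + \<mu> * c k) s \<omega> =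
        l * (\<omega> t - \<omega> s) + \<mu> * Z \<omega>" for \<omega>
      by (simp add: pval_def Z_def algebra_simps)
    have b: "\<bar>l + \<mu> * c k\<bar> \<le> \<bar>l\<bar> + \<bar>\<mu>\<bar> * C" for k
      using mult_left_mono[OF C(2)[of k], of "\<bar>\<mu>\<bar>"] by (simp add: abs_mult[symmetric] order_trans[OF abs_triangle_ineq])
    have I: "integral {s..t} (\<lambda>r. (l + \<mu> * c (lphase r \<omega>))\<^sup>2) = l\<^sup>2 * (t - s) + 2 * \<mu> * l * ?I1 \<omega> + \<mu>\<^sup>2 * ?I2 \<omega>"
      if "\<omega> \<in> path_space" for \<omega>
    proof -
      have "((\<lambda>r. l\<^sup>2 + (2 * \<mu> * l) * c (lphase r \<omega>) + \<mu>\<^sup>2 * (c (lphase r \<omega>))\<^sup>2) has_integral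
          (l\<^sup>2 * (t - s) + (2 * \<mu> * l) * ?I1 \<omega> + \<mu>\<^sup>2 * ?I2 \<omega>)) {s..t}"
        using has_integral_const_real[of "l\<^sup>2" s t] st
        by (intro has_integral_add has_integral_mult_right integrable_integral step_integrable[OF that, of c C, OF C(2)] step_integrable[OF that, of "\<lambda>k. (c k)\<^sup>2", OF C2])
           (simp add: mult.commute)
      then show ?thesis by (intro integral_unique) (simp add: power2_eq_square algebra_simps)
    qed
    have "(CLINT \<omega>|P. W' \<omega> * E \<mu> \<omega> * complex_of_real (exp (l\<^sup>2 * (t - s) / 2))) =
      (CLINT \<omega>|P. W \<omega> * iexp (l * (\<omega> t - \<omega> s) + \<mu> * Z \<omega>) * exp (1 / 2 * integral {s..t} (\<lambda>r. (l + \<mu> * c (lphase r \<omega>))\<^sup>2)))"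
    proof (rule Bochner_Integration.integral_cong)
      fix \<omega> assume "\<omega> \<in> space P"
      then have \<omega>: "\<omega> \<in> path_space" by simp
      have "exp (1 / 2 * integral {s..t} (\<lambda>r. (l + \<mu> * c (lphase r \<omega>))\<^sup>2)) =
          exp (\<mu> * (l * ?I1 \<omega>) + \<mu>\<^sup>2 * (?I2 \<omega> / 2)) * exp (l\<^sup>2 * (t - s) / 2)"
        unfolding I[OF \<omega>] exp_add[symmetric] by (simp add: algebra_simps add_divide_distrib diff_divide_distrib)
      moreover have "iexp (l * (\<omega> t - \<omega> s) + \<mu> * Z \<omega>) = iexp (l * (\<omega> t - \<omega> s)) * iexp (\<mu> * Z \<omega>)"
        unfolding exp_add[symmetric] by (simp add: algebra_simps)
      ultimately show "W' \<omega> * E \<mu> \<omega> * complex_of_real (exp (l\<^sup>2 * (t - s) / 2)) =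
         W \<omega> * iexp (l * (\<omega> t - \<omega> s) + \<mu> * Z \<omega>) * exp (1 / 2 * integral {s..t} (\<lambda>r. (l + \<mu> * c (lphase r \<omega>))\<^sup>2))"
        by (simp only: W'_def E_def of_real_mult mult_ac)
    qed simp
    also have "\<dots> = (CLINT \<omega>|P. W \<omega>)"
      using exp_martingale[OF st g' b W] unfolding pv .
    finally show ?thesis .
  qed
  \<comment> \<open>With \<mu> \<le> 1 absorbing the quadratic term, \<open>K\<close> bounds the
    real exponent and \<open>\<mu> * K\<close> bounds it to first order;
    \<open>iexp_exp_difference_bound\<close> asks for both.\<close>
  define K where "K = \<bar>l\<bar> * (C * (t - s)) + C\<^sup>2 * (t - s)"
  have Kb: "\<bar>\<mu> * (l * ?I1 \<omega>) + \<mu>\<^sup>2 * (?I2 \<omega> / 2)\<bar> \<le> \<mu> * K" "\<bar>\<mu> * (l * ?I1 \<omega>) + \<mu>\<^sup>2 * (?I2 \<omega> / 2)\<bar> \<le> K"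
    if "0 < \<mu>" "\<mu> \<le> 1" "\<omega> \<in> path_space" for \<mu> \<omega>
  proof -
    have 1: "\<bar>?I1 \<omega>\<bar> \<le> C * (t - s)" by (rule step_integral_bound[OF C(2) st(2) that(3)])
    have 2: "\<bar>?I2 \<omega>\<bar> \<le> C\<^sup>2 * (t - s)" by (rule step_integral_bound[OF C2 st(2) that(3)])
    have "\<bar>l * ?I1 \<omega> + \<mu> * (?I2 \<omega> / 2)\<bar> \<le> \<bar>l\<bar> * \<bar>?I1 \<omega>\<bar> + \<bar>\<mu>\<bar> * \<bar>?I2 \<omega> / 2\<bar>"
      by (metis abs_mult abs_triangle_ineq)
    also have "\<dots> \<le> \<bar>l\<bar> * (C * (t - s)) + 1 * (C\<^sup>2 * (t - s))"
      using 1 2 that by (intro add_mono mult_left_mono mult_mono) auto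
    finally have 3: "\<bar>l * ?I1 \<omega> + \<mu> * (?I2 \<omega> / 2)\<bar> \<le> K" by (simp add: K_def)
    have 4: "\<mu> * (l * ?I1 \<omega>) + \<mu>\<^sup>2 * (?I2 \<omega> / 2) = \<mu> * (l * ?I1 \<omega> + \<mu> * (?I2 \<omega> / 2))"
      by (simp add: algebra_simps power2_eq_square)
    show "\<bar>\<mu> * (l * ?I1 \<omega>) + \<mu>\<^sup>2 * (?I2 \<omega> / 2)\<bar> \<le> \<mu> * K"
      unfolding 4 abs_mult using 3 that by (intro mult_mono) auto
    also have "\<mu> * K \<le> 1 * K" using that 3 by (intro mult_right_mono) auto
    finally show "\<bar>\<mu> * (l * ?I1 \<omega>) + \<mu>\<^sup>2 * (?I2 \<omega> / 2)\<bar> \<le> K" by simp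
  qed
  define \<mu> where "\<mu> n = 1 / real (Suc n)" for n
  have \<mu>: "0 < \<mu> n" "\<mu> n \<le> 1" for n by (auto simp: \<mu>_def)
  have Eb: "norm ((E (\<mu> n) \<omega> - 1) / \<mu> n) \<le> (\<bar>Z \<omega>\<bar> + K) * exp K" if "\<omega> \<in> path_space" for n \<omega>
    unfolding E_def by (rule iexp_exp_difference_bound[OF \<mu>(1) Kb[OF \<mu> that]])
  have Zi: "integrable P (\<lambda>\<omega>. B * ((\<bar>Z \<omega>\<bar> + K) * exp K))"
    unfolding Z_def using pval_integrable[OF st(1) g C] pval_integrable[OF t0 g C] by auto
  have diff0: "(CLINT \<omega>|P. W' \<omega> * ((E (\<mu> n) \<omega> - 1) / \<mu> n)) = 0" for n
  proof -
    have iE: "integrable P (\<lambda>\<omega>. W' \<omega> * E m \<omega>)" if "m \<in> {0, \<mu> n}" for m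
    proof (rule integrable_const_bound[of _ "B * exp K"])
      show "AE \<omega> in P. norm (W' \<omega> * E m \<omega>) \<le> B * exp K"
      proof (rule AE_I2)
        fix \<omega> assume "\<omega> \<in> space P"
        then have "\<bar>\<mu> n * (l * ?I1 \<omega>) + (\<mu> n)\<^sup>2 * (?I2 \<omega> / 2)\<bar> \<le> K" using Kb(2)[OF \<mu>] by simp
        then have "norm (E m \<omega>) \<le> exp K" using that by (auto simp: E_def norm_mult)
        then show "norm (W' \<omega> * E m \<omega>) \<le> B * exp K"
          unfolding norm_mult using W'b B0 by (intro mult_mono) auto
      qed
    qed measurable
    let ?e = "complex_of_real (exp (l\<^sup>2 * (t - s) / 2))"
    \<comment> \<open>The right-hand side does not involve \<open>m\<close>. Hence the expectations
      at \<mu> n and at 0 agree and every difference quotient has mean zero.\<close>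
    have f: "(CLINT \<omega>|P. W' \<omega> * E m \<omega>) * ?e = (CLINT \<omega>|P. W \<omega>)" for m
      using fam[of m] by (subst (asm) integral_mult_left_zero)
    have "(CLINT \<omega>|P. W' \<omega> * E (\<mu> n) \<omega>) * ?e = (CLINT \<omega>|P. W' \<omega> * E 0 \<omega>) * ?e"
      unfolding f ..
    then have eq: "(CLINT \<omega>|P. W' \<omega> * E (\<mu> n) \<omega>) = (CLINT \<omega>|P. W' \<omega> * E 0 \<omega>)" by simp
    have "(CLINT \<omega>|P. W' \<omega> * ((E (\<mu> n) \<omega> - 1) / \<mu> n)) = (CLINT \<omega>|P. (W' \<omega> * E (\<mu> n) \<omega> - W' \<omega> * E 0 \<omega>) / \<mu> n)"
      by (intro Bochner_Integration.integral_cong) (simp_all add: E_def right_diff_distrib)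
    also have "\<dots> = 0"
      using eq iE by (subst integral_divide_zero) simp
    finally show ?thesis .
  qed
  have "(\<lambda>n. CLINT \<omega>|P. W' \<omega> * ((E (\<mu> n) \<omega> - 1) / \<mu> n)) \<longlonglongrightarrow> (CLINT \<omega>|P. W' \<omega> * (\<i> * Z \<omega> + l * ?I1 \<omega>))"
  proof (rule integral_dominated_convergence[OF _ _ Zi])
    show "AE \<omega> in P. (\<lambda>n. W' \<omega> * ((E (\<mu> n) \<omega> - 1) / \<mu> n)) \<longlonglongrightarrow> W' \<omega> * (\<i> * Z \<omega> + l * ?I1 \<omega>)"
    proof (rule AE_I2)
      fix \<omega>
      show "(\<lambda>n. W' \<omega> * ((E (\<mu> n) \<omega> - 1) / \<mu> n)) \<longlonglongrightarrow> W' \<omega> * (\<i> * Z \<omega> + l * ?I1 \<omega>)"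
        using iexp_exp_difference_tendsto[of "Z \<omega>" "l * ?I1 \<omega>" "?I2 \<omega> / 2"]
        unfolding E_def \<mu>_def by (intro tendsto_mult_left) (simp del: of_nat_Suc)
    qed
    show "AE \<omega> in P. norm (W' \<omega> * ((E (\<mu> n) \<omega> - 1) / \<mu> n)) \<le> B * ((\<bar>Z \<omega>\<bar> + K) * exp K)" for n
      unfolding norm_mult using W'b Eb B0 by (intro AE_I2 mult_mono) auto
  qed measurable
  then have "(\<lambda>n. 0) \<longlonglongrightarrow> (CLINT \<omega>|P. W' \<omega> * (\<i> * Z \<omega> + l * ?I1 \<omega>))" unfolding diff0 .
  then have "(CLINT \<omega>|P. W' \<omega> * (\<i> * Z \<omega> + l * ?I1 \<omega>)) = 0" by (simp add: LIMSEQ_const_iff)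
  then show ?thesis by (simp add: W'_def Z_def)
qed

end

section \<open>The law of the down-crossing times\<close>

text \<open>Applied to distance 0, the case of a down-crossing that is already completed.\<close>

lemma gauss_interval_zero: "0 < h \<Longrightarrow> measure (gauss h) {- (0::real)..0} = 0"
  by (simp add: measure_def emeasure_density nn_integral_indicator_singleton)

context levels
begin

text \<open>The offsets are forced by continuity at the alternating levels and by the normalisation
  that the first down-crossing ends at height 0. Each leg between the levels then raises the
  unfolded path by b - a.\<close>

definition ya :: "nat \<Rightarrow> real" where
  "ya k = (if even k then 2 * (b - a) * real (k div 2) - 2 * b + a else 2 * (b - a) * real (k div 2) + a)"

definition yc :: "nat \<Rightarrow> real" where "yc k = (if even k then 1 else - 1)"

text \<open>The path unfolded at its successive crossing times: the \<open>n\<close>-th down-crossing is completed when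
  \<open>unfolded\<close> first reaches \<open>goal n\<close>.\<close>

definition unfolded :: "real \<Rightarrow> (real \<Rightarrow> real) \<Rightarrow> real" where "unfolded = pval ya yc"

definition goal :: "nat \<Rightarrow> real" where "goal n = 2 * (b - a) * (real n - 1)"

text \<open>The negative of the classical reflected path: minus \<open>unfolded\<close> until the
  goal is reached, then \<open>unfolded\<close> minus twice the goal. Both branches equal
  \<open>- goal n\<close> at that moment.\<close>

definition reflected :: "nat \<Rightarrow> real \<Rightarrow> (real \<Rightarrow> real) \<Rightarrow> real" where
  "reflected n = pval (\<lambda>k. if k < 2 * n then - ya k else ya k - 2 * goal n)
     (\<lambda>k. if k < 2 * n then - yc k else yc k)"

lemma glued_unfolded: "glued ya yc"
  unfolding glued_def
proof
  fix k
  obtain m where "k = 2 * m \<or> k = Suc (2 * m)" by (metis oddE evenE Suc_eq_plus1)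
  then show "ya k + yc k * lev k = ya (Suc k) + yc (Suc k) * lev k"
    by (auto simp: ya_def yc_def lev_def algebra_simps)
qed

lemma glued_reflected:
  assumes "1 \<le> n"
  shows "glued (\<lambda>k. if k < 2 * n then - ya k else ya k - 2 * goal n) (\<lambda>k. if k < 2 * n then - yc k else yc k)"
  unfolding glued_def
proof
  fix k
  have g: "ya k + yc k * lev k = ya (Suc k) + yc (Suc k) * lev k"
    using glued_unfolded by (simp add: glued_def)
  consider "Suc k < 2 * n" | "Suc k = 2 * n" | "2 * n \<le> k" by linarith
  then show "(if k < 2 * n then - ya k else ya k - 2 * goal n) + (if k < 2 * n then - yc k else yc k) * lev k =
     (if Suc k < 2 * n then - ya (Suc k) else ya (Suc k) - 2 * goal n) + (if Suc k < 2 * n then - yc (Suc k) else yc (Suc k)) * lev k"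
  proof cases
    \<comment> \<open>The only phase change at which the sign pattern is broken: the level is
      \<open>a\<close>, the unfolded path is at \<open>goal n\<close>, and both sides are
      \<open>- goal n\<close>.\<close>
    case 2
    then obtain m where m: "n = Suc m" "k = 2 * m + 1" using assms by (cases n) auto
    then show ?thesis by (auto simp: ya_def yc_def lev_def goal_def algebra_simps)
  qed (use g in auto)
qed

context
  fixes \<omega> :: "real \<Rightarrow> real"
  assumes \<omega>: "\<omega> \<in> path_space"
begin

text \<open>In phase 2m the path is at most \<open>b\<close>, which leaves the unfolded path b - a
  or more below \<open>goal (m + 1)\<close>; in phase 2m + 1 it is at least \<open>a\<close>, which
  allows exactly \<open>goal (m + 1)\<close>. Before \<sigma> (2n) one has m < n.\<close>

lemma before_goal:
  assumes t: "0 \<le> t" "ereal t < \<sigma> (2 * n) \<omega>"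
  shows "unfolded t \<omega> \<le> goal n"
proof -
  let ?k = "phase t \<omega>"
  have k: "?k < 2 * n" using phase_less_iff[OF \<omega> t(1), of "2 * n"] t(2) by (meson not_less)
  define m where "m = ?k div 2"
  have "m < n" using k by (simp add: m_def less_mult_imp_div_less)
  then have m: "real m \<le> real n - 1" by linarith
  have "2 * (b - a) * real m \<le> goal n" unfolding goal_def using m ab by (intro mult_left_mono) auto
  then show ?thesis
    using before_crossing[OF t(1) phase_ge[OF \<omega> t(1)] phase_less[OF \<omega>]] ab
    by (cases "even ?k") (auto simp: unfolded_def pval_def ya_def yc_def m_def)
qed

lemma at_goal:
  assumes n: "1 \<le> n" and t: "\<sigma> (2 * n) \<omega> = ereal t"
  shows "unfolded t \<omega> = goal n"
proof -
  obtain m where m: "2 * n = Suc (2 * m + 1)" "n = Suc m" using n by (cases n) auto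
  have lt: "\<sigma> (2 * m + 1) \<omega> < ereal t"
  proof -
    have "\<sigma> (2 * m + 1) \<omega> \<le> ereal t" using crossing_time_le_Suc[of "2 * m + 1" \<omega>] t m by simp
    then have "\<sigma> (2 * m + 1) \<omega> \<noteq> \<infinity>" by auto
    then show ?thesis using crossing_strict[OF \<omega>, of "2 * m + 1"] t m by simp
  qed
  have "\<omega> t = a"
    using crossing_value[OF \<omega> t[unfolded m(1)] lt] by (simp add: lev_def)
  moreover have "phase t \<omega> = 2 * n"
    using crossing_strict[OF \<omega>, of "2 * n"] t n by (intro phase_eqI[OF \<omega>]) auto
  ultimately show ?thesis by (simp add: unfolded_def pval_def ya_def yc_def goal_def algebra_simps)
qed

lemma reflected_eq:
  assumes "0 \<le> t"
  shows "reflected n t \<omega> = (if ereal t < \<sigma> (2 * n) \<omega> then - unfolded t \<omega> else unfolded t \<omega> - 2 * goal n)"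
  using phase_less_iff[OF \<omega> assms, of "2 * n"]
  by (auto simp: reflected_def unfolded_def pval_def not_less)

end

text \<open>The way the unfolded path still has to go to its n-th goal. The conditional law of
  \<sigma> (2n) given the past depends on the past through this quantity while the goal is
  pending.\<close>

definition distance :: "nat \<Rightarrow> real \<Rightarrow> (real \<Rightarrow> real) \<Rightarrow> real" where
  "distance n t \<omega> = (if ereal t < \<sigma> (2 * n) \<omega> then goal n - unfolded t \<omega> else 0)"

lemma distance_nonneg: "\<omega> \<in> path_space \<Longrightarrow> 0 \<le> t \<Longrightarrow> 0 \<le> distance n t \<omega>"
  using before_goal[of \<omega> t n] by (simp add: distance_def)

text \<open>Goals are spaced by 2 (b - a). Two pending goals differ by this amount, the goal being
  approached contributes all of its remaining distance, and goals already reached contribute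
  nothing.\<close>

lemma distance_step:
  assumes \<omega>: "\<omega> \<in> path_space" and t: "0 \<le> t"
  shows "distance (Suc n) t \<omega> - distance n t \<omega> =
    (if phase t \<omega> div 2 < n then 2 * (b - a)
     else if phase t \<omega> div 2 = n then goal (Suc n) - unfolded t \<omega> else 0)"
proof -
  have *: "ereal t < \<sigma> (2 * m) \<omega> \<longleftrightarrow> phase t \<omega> div 2 < m" for m
    using phase_less_iff[OF \<omega> t, of "2 * m"] by (auto simp: not_le[symmetric])
  show ?thesis
    unfolding distance_def * by (auto simp: goal_def algebra_simps)
qed

lemma goal_minus_unfolded:
  assumes \<omega>: "\<omega> \<in> path_space" and t: "0 \<le> t"
  shows "goal (Suc (phase t \<omega> div 2)) - unfolded t \<omega> = (if even (phase t \<omega>) then 2 * b - \<omega> t - a else \<omega> t - a)"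
  by (auto simp: goal_def unfolded_def pval_def ya_def yc_def algebra_simps)

lemma distance_mono: 
  assumes \<omega>: "\<omega> \<in> path_space" and t: "0 \<le> t"
  shows "distance n t \<omega> \<le> distance (Suc n) t \<omega>"
proof -
  have "0 \<le> goal (Suc (phase t \<omega> div 2)) - unfolded t \<omega>"
    unfolding goal_minus_unfolded[OF \<omega> t]
    using before_crossing[OF t phase_ge[OF \<omega> t] phase_less[OF \<omega>]] ab by auto
  then have "0 \<le> distance (Suc n) t \<omega> - distance n t \<omega>"
    unfolding distance_step[OF \<omega> t] using ab by auto
  then show ?thesis by simp
qed

text \<open>The bound is free of \<open>n\<close>, although the distances grow linearly in
  \<open>n\<close>. Multiplied by \<open>Delta G n\<close> it becomes the summable majorant of the
  penalisation series.\<close>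

lemma distance_step_bound:
  assumes \<omega>: "\<omega> \<in> path_space" and t: "0 \<le> t"
  shows "distance (Suc n) t \<omega> - distance n t \<omega> \<le> 2 * (b - a) + 2 * \<bar>b\<bar> + \<bar>a\<bar> + \<bar>\<omega> t\<bar>"
  using goal_minus_unfolded[OF \<omega> t] unfolding distance_step[OF \<omega> t] using ab
  by (auto split: if_splits)

end

context wiener
begin

lemma distance_measurable:
  assumes t: "0 \<le> t"
  shows "distance n t \<in> borel_measurable P"
proof -
  have [measurable]: "unfolded t \<in> borel_measurable P"
    unfolding unfolded_def by (rule pval_measurable_P[OF t glued_unfolded])
  show ?thesis unfolding distance_def by measurable
qed

lemma distance_integrable:
  assumes t: "0 \<le> t"
  shows "integrable P (distance n t)"
proof (induction n)
  case 0
  have "integrable P (distance 0 t) \<longleftrightarrow> integrable P (\<lambda>\<omega>. 0 :: real)"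
    using t by (intro Bochner_Integration.integrable_cong) (auto simp: distance_def zero_ereal_def)
  then show ?case by simp
next
  case (Suc n)
  show ?case
  proof (rule Bochner_Integration.integrable_bound)
    show "integrable P (\<lambda>\<omega>. distance n t \<omega> + (2 * (b - a) + 2 * \<bar>b\<bar> + \<bar>a\<bar> + \<bar>\<omega> t\<bar>))"
      using Suc coord_integrable[OF t] by auto
    show "AE \<omega> in P. norm (distance (Suc n) t \<omega>) \<le> norm (distance n t \<omega> + (2 * (b - a) + 2 * \<bar>b\<bar> + \<bar>a\<bar> + \<bar>\<omega> t\<bar>))"
    proof (rule AE_I2)
      fix \<omega> assume "\<omega> \<in> space P"
      then have "\<omega> \<in> path_space" by simp
      then show "norm (distance (Suc n) t \<omega>) \<le> norm (distance n t \<omega> + (2 * (b - a) + 2 * \<bar>b\<bar> + \<bar>a\<bar> + \<bar>\<omega> t\<bar>))"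
        using distance_step_bound[of \<omega> t n] distance_nonneg[of \<omega> t n] distance_nonneg[of \<omega> t "Suc n"] t by simp
    qed
  qed (rule distance_measurable[OF t])
qed

text \<open>Let y be the distance at time s. If the goal is reached by t, then D' = D - 2y, so
  either D > y, or D < y and D' < -y; if it is not reached, then D \<le> y and D' = -D \<ge> -y. Off
  the null event D = y, reaching the goal is therefore the disjoint union of D > y and D' < -y, and
  each of these has a Gaussian conditional probability.\<close>

lemma crossing_probability:
  assumes st: "0 \<le> s" "s < t" and A: "A \<in> sets (F s)"
  shows "prob (A \<inter> {\<omega> \<in> path_space. ereal t < \<sigma> (2 * n) \<omega>}) =
    (\<integral>\<omega>. indicator A \<omega> * measure (gauss (t - s)) {- distance n s \<omega>..distance n s \<omega>} \<partial>P)"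
proof (cases "n = 0")
  case True
  have "A \<inter> {\<omega> \<in> path_space. ereal t < \<sigma> (2 * n) \<omega>} = {}" using True st by (auto simp: zero_ereal_def)
  moreover have "distance n s \<omega> = 0" for \<omega> using True st by (simp add: distance_def zero_ereal_def)
  ultimately show ?thesis using gauss_interval_zero[of "t - s"] st by simp
next
  case False
  then have n: "1 \<le> n" by simp
  define h where "h = t - s"
  have h: "0 < h" and t0: "0 \<le> t" using st by (auto simp: h_def)
  interpret G: real_distribution "gauss h" by (rule real_distribution_gauss[OF h])
  \<comment> \<open>The raw filtration at \<open>s\<close> decides \<sigma> \<ge> s, not \<sigma> >
    s. On the difference the unfolded path is exactly at the goal, so y = 0 and nothing is gained or
    lost.\<close>
  define A' where "A' = A \<inter> {\<omega> \<in> path_space. ereal s \<le> \<sigma> (2 * n) \<omega>}"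
  define y where "y \<omega> = goal n - unfolded s \<omega>" for \<omega>
  define D where "D \<omega> = unfolded t \<omega> - unfolded s \<omega>" for \<omega>
  define D' where "D' \<omega> = reflected n t \<omega> - reflected n s \<omega>" for \<omega>
  have A'm[measurable]: "A' \<in> sets (F s)" unfolding A'_def using A crossing_ge_sets by (rule sets.Int)
  have ApP: "A' \<subseteq> path_space" using sets.sets_into_space[OF A'm] by simp
  have A'P[measurable]: "A' \<in> sets P" and AP: "A \<in> sets P"
    using A'm A subalgebra_P[of s] by (auto simp: subalgebra_def)
  have ym[measurable]: "y \<in> borel_measurable (F s)"
    unfolding y_def[abs_def] unfolded_def using pval_measurable[OF st(1) glued_unfolded] by measurable
  have yP[measurable]: "y \<in> borel_measurable P" by (rule measurable_from_subalg[OF subalgebra_P ym])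
  have gD: "gaussian_indep P (F s) h D"
    unfolding D_def[abs_def] h_def unfolded_def
    by (rule gaussian_pval_increment[OF st glued_unfolded]) (simp add: yc_def)
  have gD': "gaussian_indep P (F s) h D'"
    unfolding D'_def[abs_def] h_def reflected_def
    by (rule gaussian_pval_increment[OF st glued_reflected[OF n]]) (simp add: yc_def)
  note [measurable] = gaussian_indep_measurable[OF gD] gaussian_indep_measurable[OF gD']
  have y0: "0 \<le> y \<omega>" if "\<omega> \<in> A'" for \<omega>
  proof (cases "ereal s < \<sigma> (2 * n) \<omega>")
    case True then show ?thesis using before_goal[of \<omega> s n] st that ApP by (auto simp: y_def)
  next
    case False
    then have "\<sigma> (2 * n) \<omega> = ereal s" using that by (auto simp: A'_def)
    then show ?thesis using at_goal[of \<omega> n s] n that ApP by (auto simp: y_def)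
  qed
  let ?C = "{\<omega> \<in> path_space. ereal t < \<sigma> (2 * n) \<omega>}"
  have CP[measurable]: "?C \<in> sets P"
  proof -
    have "?C = {\<omega> \<in> space path_algebra. ereal t < \<sigma> (2 * n) \<omega>}" by simp
    also have "\<dots> \<in> sets path_algebra" by measurable
    finally show ?thesis by simp
  qed
  have refl: "reflected n s \<omega> = - unfolded s \<omega>" if "\<omega> \<in> A'" for \<omega>
  proof (cases "ereal s < \<sigma> (2 * n) \<omega>")
    case True then show ?thesis using reflected_eq[of \<omega> s n] st that ApP by auto
  next
    case False
    then have "\<sigma> (2 * n) \<omega> = ereal s" using that by (auto simp: A'_def)
    then show ?thesis using at_goal[of \<omega> n s] reflected_eq[of \<omega> s n] st n that ApP by auto
  qed
  have pw: "indicator (A' - ?C) \<omega> = indicator A' \<omega> * (if y \<omega> < D \<omega> then 1 else 0) + indicator A' \<omega> * (if D' \<omega> < - y \<omega> then 1 else (0::real))"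
    if "\<omega> \<in> path_space" "D \<omega> \<noteq> y \<omega>" for \<omega>
  proof (cases "\<omega> \<in> A'")
    case True
    show ?thesis
    proof (cases "ereal t < \<sigma> (2 * n) \<omega>")
      case lt: True
      then have "D \<omega> \<le> y \<omega>" "D' \<omega> = - D \<omega>"
        using before_goal[OF that(1) t0 lt] reflected_eq[OF that(1) t0, of n] refl[OF True] by (auto simp: D_def D'_def y_def)
      then show ?thesis using lt that by simp
    next
      case False
      then have "D' \<omega> = D \<omega> - 2 * y \<omega>"
        using reflected_eq[OF that(1) t0, of n] refl[OF True] by (auto simp: D_def D'_def y_def)
      then show ?thesis using False True that by auto
    qed
  qed simp
  have fr1: "(\<integral>\<omega>. indicator A' \<omega> * (if y \<omega> < D \<omega> then 1 else 0) \<partial>P) = (\<integral>\<omega>. indicator A' \<omega> * measure (gauss h) {y \<omega><..} \<partial>P)"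
      "integrable P (\<lambda>\<omega>. indicator A' \<omega> * measure (gauss h) {y \<omega><..})"
    using gaussian_indep_region[OF prob_space_axioms subalgebra_P gD h A'm, of "\<lambda>\<omega> x. y \<omega> < x"]
    by (simp_all add: greaterThan_def)
  have fr2: "(\<integral>\<omega>. indicator A' \<omega> * (if D' \<omega> < - y \<omega> then 1 else 0) \<partial>P) = (\<integral>\<omega>. indicator A' \<omega> * measure (gauss h) {..< - y \<omega>} \<partial>P)"
      "integrable P (\<lambda>\<omega>. indicator A' \<omega> * measure (gauss h) {..< - y \<omega>})"
    using gaussian_indep_region[OF prob_space_axioms subalgebra_P gD' h A'm, of "\<lambda>\<omega> x. x < - y \<omega>"]
    by (simp_all add: lessThan_def)
  have "prob (A' - ?C) = (\<integral>\<omega>. indicator (A' - ?C) \<omega> \<partial>P)" using ApP by (simp add: Int_absorb2 Diff_subset subset_iff Int_commute inf.absorb2)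
  also have "\<dots> = (\<integral>\<omega>. indicator A' \<omega> * (if y \<omega> < D \<omega> then 1 else 0) + indicator A' \<omega> * (if D' \<omega> < - y \<omega> then 1 else (0::real)) \<partial>P)"
  proof (rule integral_cong_AE)
    show "AE \<omega> in P. indicator (A' - ?C) \<omega> = indicator A' \<omega> * (if y \<omega> < D \<omega> then 1 else 0) + indicator A' \<omega> * (if D' \<omega> < - y \<omega> then 1 else (0::real))"
      using gaussian_indep_null[OF prob_space_axioms subalgebra_P gD h ym] AE_space
      by eventually_elim (use pw in auto)
  qed measurable
  also have "\<dots> = (\<integral>\<omega>. indicator A' \<omega> * (if y \<omega> < D \<omega> then 1 else 0) \<partial>P) + (\<integral>\<omega>. indicator A' \<omega> * (if D' \<omega> < - y \<omega> then 1 else (0::real)) \<partial>P)"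
    by (rule Bochner_Integration.integral_add; rule integrable_const_bound[of _ 1]) (auto simp: indicator_def)
  also have "\<dots> = (\<integral>\<omega>. indicator A' \<omega> * measure (gauss h) {y \<omega><..} + indicator A' \<omega> * measure (gauss h) {..< - y \<omega>} \<partial>P)"
    unfolding fr1(1) fr2(1) using fr1(2) fr2(2) by simp
  finally have 1: "prob (A' - ?C) = \<dots>" .
  have "prob (A' \<inter> ?C) = prob A' - prob (A' - ?C)"
    using finite_measure_Diff'[OF A'P CP] by simp
  also have "\<dots> = (\<integral>\<omega>. indicator A' \<omega> - (indicator A' \<omega> * measure (gauss h) {y \<omega><..} + indicator A' \<omega> * measure (gauss h) {..< - y \<omega>}) \<partial>P)"
    unfolding 1 using fr1(2) fr2(2) ApP A'P
    by (subst Bochner_Integration.integral_diff)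
       (auto simp: Int_absorb2 emeasure_eq_measure intro!: integrable_real_indicator)
  also have "\<dots> = (\<integral>\<omega>. indicator A \<omega> * measure (gauss h) {- distance n s \<omega>..distance n s \<omega>} \<partial>P)"
  proof (rule Bochner_Integration.integral_cong)
    fix \<omega> assume "\<omega> \<in> space P"
    then have \<omega>: "\<omega> \<in> path_space" by simp
    show "indicator A' \<omega> - (indicator A' \<omega> * measure (gauss h) {y \<omega><..} + indicator A' \<omega> * measure (gauss h) {..< - y \<omega>}) =
       indicator A \<omega> * measure (gauss h) {- distance n s \<omega>..distance n s \<omega>}"
    proof (cases "\<omega> \<in> A'")
      case True
      have dy: "distance n s \<omega> = y \<omega>"
      proof (cases "ereal s < \<sigma> (2 * n) \<omega>")
        case False
        then have "\<sigma> (2 * n) \<omega> = ereal s" using True by (auto simp: A'_def)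
        then show ?thesis using at_goal[OF \<omega> n] False by (simp add: y_def distance_def)
      qed (simp add: distance_def y_def)
      have "measure (gauss h) {- y \<omega>..y \<omega>} = measure (gauss h) (space (gauss h) - ({y \<omega><..} \<union> {..< - y \<omega>}))"
        by (rule arg_cong[where f="measure (gauss h)"]) auto
      also have "\<dots> = 1 - measure (gauss h) ({y \<omega><..} \<union> {..< - y \<omega>})"
        by (rule G.prob_compl) auto
      also have "measure (gauss h) ({y \<omega><..} \<union> {..< - y \<omega>}) = measure (gauss h) {y \<omega><..} + measure (gauss h) {..< - y \<omega>}"
        using y0[OF True] by (intro G.finite_measure_Union) auto
      finally show ?thesis using True unfolding dy by (simp add: A'_def)
    next
      case False
      then have "\<omega> \<notin> A \<or> distance n s \<omega> = 0" using \<omega> by (auto simp: A'_def distance_def)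
      then show ?thesis using False gauss_interval_zero[OF h] by auto
    qed
  qed simp
  finally have "prob (A' \<inter> ?C) = (\<integral>\<omega>. indicator A \<omega> * measure (gauss h) {- distance n s \<omega>..distance n s \<omega>} \<partial>P)" .
  moreover have "A' \<inter> ?C = A \<inter> ?C" using st less_trans[of "ereal s" "ereal t"] by (auto simp: A'_def intro: less_imp_le)
  ultimately show ?thesis by (simp add: h_def)
qed

end

section \<open>The penalised limit\<close>

lemma gauss_interval_measurable:
  assumes h: "0 < h" and d[measurable]: "d \<in> borel_measurable M"
  shows "(\<lambda>\<omega>. measure (gauss h) {- d \<omega>..d \<omega>}) \<in> borel_measurable M"
proof -
  interpret real_distribution "gauss h" by (rule real_distribution_gauss[OF h])
  have "measure (gauss h) {- d \<omega>..d \<omega>} = (\<integral>x. (if - d \<omega> \<le> x \<and> x \<le> d \<omega> then 1 else 0) \<partial>gauss h)" for \<omega>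
  proof -
    have "(\<integral>x. (if - d \<omega> \<le> x \<and> x \<le> d \<omega> then 1 else 0) \<partial>gauss h) = (\<integral>x. indicator {- d \<omega>..d \<omega>} x \<partial>gauss h)"
      by (intro Bochner_Integration.integral_cong) (auto simp: indicator_def)
    also have "\<dots> = measure (gauss h) {- d \<omega>..d \<omega>}" by simp
    finally show ?thesis ..
  qed
  moreover have "(\<lambda>\<omega>. \<integral>x. (if - d \<omega> \<le> x \<and> x \<le> d \<omega> then 1 else 0 :: real) \<partial>gauss h) \<in> borel_measurable M"
    by (rule borel_measurable_lebesgue_integral) measurable
  ultimately show ?thesis by simp
qed

locale downcross = wiener +
  fixes G :: "nat \<Rightarrow> real"
  assumes G_nonneg: "0 \<le> G n" and G_antimono: "antimono G" and G_0: "G 0 = 1" and G_lim: "G \<longlonglongrightarrow> 0"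
begin

lemma G_Suc: "G (Suc n) \<le> G n"
  using G_antimono by (simp add: antimono_def)

lemma G_le_1: "G n \<le> 1"
  using G_antimono G_0 by (metis antimonoD le0)

lemma Delta_bounds: "0 \<le> Delta G n" "Delta G n \<le> 1"
  using G_Suc[of n] G_le_1[of n] G_nonneg[of "Suc n"] by (auto simp: Delta_def)

lemma Delta_sums: "Delta G sums 1"
  using telescope_sums'[OF G_lim] G_0 by (simp add: Delta_def[abs_def])

text \<open>Offset and slope of the summand of \<open>M_down\<close> that is active in phase
  \<open>k\<close>, as an affine function of the path value. The slope \<open>mc\<close> is the
  integrand of M with respect to the coordinate process.\<close>

definition ma :: "nat \<Rightarrow> real" where
  "ma k = (let m = k div 2 in if even k then (G m * (2 * b - a) - G (Suc m) * a) / (2 * (b - a))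
     else (G (Suc m) * (2 * b - a) - G m * a) / (2 * (b - a)))"

definition mc :: "nat \<Rightarrow> real" where
  "mc k = (if even k then - Delta G (k div 2) else Delta G (k div 2)) / (2 * (b - a))"

abbreviation Mt :: "real \<Rightarrow> (real \<Rightarrow> real) \<Rightarrow> real" where "Mt \<equiv> pval ma mc"

lemma M_affine:
  "ma k + mc k * x = (let m = k div 2 in if even k then G m * (2 * b - a - x) + G (Suc m) * (x - a)
     else G (Suc m) * (2 * b - a - x) + G m * (x - a)) / (2 * (b - a))"
proof -
  have "A / d + B / d * x = (A + B * x) / d" for A B d :: real by (simp add: add_divide_distrib)
  then show ?thesis
    unfolding ma_def mc_def Let_def Delta_def
    by (cases "even k") (simp_all only: if_True if_False, simp_all add: algebra_simps)
qed

lemma two_M_affine: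
  "2 * (b - a) * (ma k + mc k * x) = (let m = k div 2 in if even k then G m * (2 * b - a - x) + G (Suc m) * (x - a)
     else G (Suc m) * (2 * b - a - x) + G m * (x - a))"
  unfolding M_affine times_divide_eq_right by (rule nonzero_mult_div_cancel_left) (use ab in simp)

text \<open>At \<open>b\<close> the two formulas with the same m exchange equal weights b - a. At
  \<open>a\<close> the odd phase of index m and the even phase of index m + 1 both reduce to
  \<open>G (m + 1)\<close>.\<close>

lemma glued_M: "glued ma mc"
  unfolding glued_def M_affine
proof
  fix k
  obtain m where "k = 2 * m \<or> k = Suc (2 * m)" by (metis oddE evenE Suc_eq_plus1)
  then show "(let m = k div 2 in if even k then G m * (2 * b - a - lev k) + G (Suc m) * (lev k - a)
     else G (Suc m) * (2 * b - a - lev k) + G m * (lev k - a)) / (2 * (b - a)) =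
    (let m = Suc k div 2 in if even (Suc k) then G m * (2 * b - a - lev k) + G (Suc m) * (lev k - a)
     else G (Suc m) * (2 * b - a - lev k) + G m * (lev k - a)) / (2 * (b - a))"
    by (auto simp: lev_def Let_def)
qed

lemma mc_bound: "\<bar>mc k\<bar> \<le> 1 / (2 * (b - a))"
  using Delta_bounds[of "k div 2"] ab by (cases "even k") (auto simp: mc_def abs_divide intro!: divide_right_mono)

lemma M_coeff_bound:
  obtains C where "\<And>k. \<bar>ma k\<bar> \<le> C" "\<And>k. \<bar>mc k\<bar> \<le> C"
proof (rule that)
  let ?C = "(1 * \<bar>2 * b - a\<bar> + 1 * \<bar>a\<bar> + 1) / (2 * (b - a))"
  fix k
  have e: "\<bar>x * (2 * b - a) - y * a\<bar> \<le> 1 * \<bar>2 * b - a\<bar> + 1 * \<bar>a\<bar>" if "0 \<le> x" "x \<le> 1" "0 \<le> y" "y \<le> 1" for x y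
  proof -
    have "\<bar>x * (2 * b - a) - y * a\<bar> \<le> \<bar>x\<bar> * \<bar>2 * b - a\<bar> + \<bar>y\<bar> * \<bar>a\<bar>"
      by (metis abs_mult abs_triangle_ineq4)
    also have "\<dots> \<le> 1 * \<bar>2 * b - a\<bar> + 1 * \<bar>a\<bar>" using that by (intro add_mono mult_right_mono) auto
    finally show ?thesis .
  qed
  have "\<bar>ma k\<bar> \<le> (1 * \<bar>2 * b - a\<bar> + 1 * \<bar>a\<bar>) / (2 * (b - a))"
    using ab e[of "G (k div 2)" "G (Suc (k div 2))"] e[of "G (Suc (k div 2))" "G (k div 2)"] G_nonneg G_le_1
    by (auto simp: ma_def Let_def abs_divide intro!: divide_right_mono)
  also have "\<dots> \<le> ?C" using ab by (intro divide_right_mono) auto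
  finally show "\<bar>ma k\<bar> \<le> ?C" .
  show "\<bar>mc k\<bar> \<le> ?C" using ab by (intro order_trans[OF mc_bound] divide_right_mono) auto
qed

text \<open>The intervals between consecutive crossing times are disjoint, so a single summand
  survives, the one with index half the phase.\<close>

lemma M_down_eq:
  assumes \<omega>: "\<omega> \<in> path_space" and t: "0 \<le> t"
  shows "M_down a b G t \<omega> = Mt t \<omega>"
proof -
  let ?k = "phase t \<omega>"
  have ind: "indicator {\<sigma> k \<omega>..<\<sigma> (Suc k) \<omega>} (ereal t) = (of_bool (?k = k) :: real)" for k
    using phase_eqI[OF \<omega>, of k t] phase_ge[OF \<omega> t] phase_less[OF \<omega>, of t] by (auto simp: indicator_def)
  have 1: "M_down a b G t \<omega> = (\<Sum>n. of_bool (?k = 2 * n) *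
       (G n / 2 * (1 + (b - \<omega> t) / (b - a)) + G (n + 1) / 2 * ((\<omega> t - a) / (b - a))) +
     of_bool (?k = Suc (2 * n)) *
       (G (n + 1) / 2 * (1 + (b - \<omega> t) / (b - a)) + G n / 2 * ((\<omega> t - a) / (b - a))))"
    using ind[of "2 * n" for n] ind[of "Suc (2 * n)" for n] unfolding M_down_def by simp
  have terms: "x / 2 * (1 + (b - \<omega> t) / (b - a)) + y / 2 * ((\<omega> t - a) / (b - a)) =
      (x * (2 * b - a - \<omega> t) + y * (\<omega> t - a)) / (2 * (b - a))" for x y
    using ab by (simp add: divide_simps)
  have oddD_Suc: "odd k \<Longrightarrow> k = Suc (2 * (k div 2))" for k :: nat by presburger
  show ?thesis
    unfolding 1 terms
    by (subst suminf_finite[of "{?k div 2}"])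
       (auto simp: pval_def M_affine Let_def dest: oddD_Suc)
qed

lemma two_M_eq:
  assumes \<omega>: "\<omega> \<in> path_space" and t: "0 \<le> t"
  shows "2 * (b - a) * Mt t \<omega> = Delta G (phase t \<omega> div 2) * (goal (Suc (phase t \<omega> div 2)) - unfolded t \<omega>)
      + 2 * (b - a) * G (Suc (phase t \<omega> div 2))"
  unfolding goal_minus_unfolded[OF \<omega> t]
  unfolding pval_def two_M_affine by (auto simp: Delta_def Let_def algebra_simps)

text \<open>This is where M comes from: up to a constant it is the series of limits of the scaled
  probabilities. With m completed down-crossings, the terms below m vanish, term m is the part
  linear in the path, and the tail telescopes to \<open>2 * (b - a) * G (Suc m)\<close>.\<close>

lemma M_sums:
  assumes \<omega>: "\<omega> \<in> path_space" and t: "0 \<le> t"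
  shows "(\<lambda>n. Delta G n * (distance (Suc n) t \<omega> - distance n t \<omega>)) sums (2 * (b - a) * Mt t \<omega>)"
proof -
  define m where "m = phase t \<omega> div 2"
  let ?f = "\<lambda>n. Delta G n * (distance (Suc n) t \<omega> - distance n t \<omega>)"
  have "(\<lambda>n. G (n + Suc m) - G (Suc n + Suc m)) sums (G (0 + Suc m) - 0)"
    by (rule telescope_sums'[of "\<lambda>n. G (n + Suc m)"]) (rule LIMSEQ_ignore_initial_segment[OF G_lim])
  then have "(\<lambda>n. 2 * (b - a) * (G (n + Suc m) - G (Suc n + Suc m))) sums (2 * (b - a) * (G (Suc m)))"
    by (intro sums_mult) simp
  moreover have "2 * (b - a) * (G (n + Suc m) - G (Suc n + Suc m)) = ?f (n + Suc m)" for n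
    unfolding distance_step[OF \<omega> t] m_def[symmetric] by (simp add: Delta_def)
  ultimately have "(\<lambda>n. ?f (n + Suc m)) sums (2 * (b - a) * G (Suc m))" by simp
  then have "?f sums (2 * (b - a) * G (Suc m) + (\<Sum>n<Suc m. ?f n))"
    by (subst (asm) sums_iff_shift) simp
  moreover have "(\<Sum>n<Suc m. ?f n) = Delta G m * (goal (Suc m) - unfolded t \<omega>)"
    unfolding distance_step[OF \<omega> t] m_def[symmetric] by simp
  moreover have "2 * (b - a) * Mt t \<omega> = 2 * (b - a) * G (Suc m) + Delta G m * (goal (Suc m) - unfolded t \<omega>)"
    unfolding two_M_eq[OF \<omega> t] m_def by (rule add.commute)
  ultimately show ?thesis by simp
qed

lemma M_nonneg:
  assumes \<omega>: "\<omega> \<in> path_space" and t: "0 \<le> t"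
  shows "0 \<le> Mt t \<omega>"
proof -
  have "0 \<le> 2 * (b - a) * Mt t \<omega>"
    by (rule sums_le[OF _ sums_zero M_sums[OF \<omega> t]])
       (intro allI mult_nonneg_nonneg Delta_bounds, simp add: distance_mono[OF \<omega> t])
  then show ?thesis using ab by (simp add: zero_le_mult_iff)
qed

lemma M_integrable: "0 \<le> t \<Longrightarrow> integrable P (Mt t)"
proof -
  assume t: "0 \<le> t"
  obtain C where "\<And>k. \<bar>ma k\<bar> \<le> C" "\<And>k. \<bar>mc k\<bar> \<le> C" using M_coeff_bound by blast
  then show ?thesis by (rule pval_integrable[OF t glued_M])
qed

text \<open>A path started at 0 is in phase 1 at once when \<open>b < 0\<close>; for
  \<open>b = 0\<close> gluing makes the formulas of phases 0 and 1 agree.\<close>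

definition m0 :: real where "m0 = (if b < 0 then ma 1 else ma 0)"

lemma M_0: "AE \<omega> in P. Mt 0 \<omega> = m0"
  using start_zero AE_space
  by eventually_elim (auto simp: pval_zero[OF _ glued_M] m0_def)

text \<open>Both cases are (1 - g) x + 2 (b - a) g with g = \<open>G (Suc 0)\<close> in [0, 1] and x
  > 0: x is -a when b < 0 and 2b - a otherwise. The weights 1 - g and g cannot both vanish.\<close>

lemma m0_pos: "0 < m0"
proof -
  let ?d = "Delta G 0" and ?g = "G (Suc 0)"
  have d: "?d = 1 - ?g" using G_0 by (simp add: Delta_def)
  have g: "0 \<le> ?g" "?g \<le> 1" using G_nonneg G_le_1 by auto
  have pos: "0 < (1 - ?g) * x + 2 * (b - a) * ?g" if "0 < x" for x
  proof (cases "?g = 0")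
    case False
    then have "0 < 2 * (b - a) * ?g" using g ab by simp
    moreover have "0 \<le> (1 - ?g) * x" using g that by simp
    ultimately show ?thesis by linarith
  qed (use that in simp)
  have "2 * (b - a) * m0 = (1 - ?g) * (if b < 0 then - a else 2 * b - a) + 2 * (b - a) * ?g"
    using G_0 two_M_affine[of 0 0] two_M_affine[of 1 0] by (auto simp: m0_def Let_def algebra_simps)
  moreover have "0 < (if b < 0 then - a else 2 * b - a)" using ab by auto
  ultimately have "0 < 2 * (b - a) * m0" using pos by metis
  then show ?thesis using ab by (simp add: zero_less_mult_iff)
qed

text \<open>The case \<open>l = 0\<close> of \<open>exp_martingale_deriv\<close>, in which the
  correction term drops out.\<close>

lemma M_martingale:
  assumes st: "0 \<le> s" "s \<le> t" and W: "W \<in> borel_measurable (F s)" "\<And>\<omega>. norm (W \<omega> :: complex) \<le> B"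
  shows "(CLINT \<omega>|P. W \<omega> * Mt t \<omega>) = (CLINT \<omega>|P. W \<omega> * Mt s \<omega>)"
proof -
  obtain C where C: "\<And>k. \<bar>ma k\<bar> \<le> C" "\<And>k. \<bar>mc k\<bar> \<le> C" using M_coeff_bound by blast
  have i: "integrable P (\<lambda>\<omega>. W \<omega> * Mt u \<omega>)" if "0 \<le> u" for u
  proof (rule Bochner_Integration.integrable_bound)
    show "integrable P (\<lambda>\<omega>. B * Mt u \<omega>)" using M_integrable[OF that] by simp
    show "(\<lambda>\<omega>. W \<omega> * complex_of_real (Mt u \<omega>)) \<in> borel_measurable P"
      using measurable_from_subalg[OF subalgebra_P W(1)] pval_measurable_P[OF that glued_M] by measurable
    have B0: "0 \<le> B" using W(2)[of undefined] norm_ge_zero order_trans by blast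
    show "AE \<omega> in P. norm (W \<omega> * complex_of_real (Mt u \<omega>)) \<le> norm (B * Mt u \<omega>)"
      using W(2) B0 by (intro AE_I2) (simp add: norm_mult abs_mult mult_right_mono)
  qed
  have "(CLINT \<omega>|P. \<i> * (W \<omega> * Mt t \<omega> - W \<omega> * Mt s \<omega>)) = 0"
    using exp_martingale_deriv[OF st glued_M C W, of 0] by (simp add: algebra_simps)
  then have "\<i> * ((CLINT \<omega>|P. W \<omega> * Mt t \<omega>) - (CLINT \<omega>|P. W \<omega> * Mt s \<omega>)) = 0"
    using i st by (simp add: integral_mult_right_zero del: mult_eq_0_iff)
  then show ?thesis by simp
qed

lemma M_expectation: assumes "0 \<le> t" shows "expectation (Mt t) = m0"
proof -
  have "(CLINT \<omega>|P. 1 * complex_of_real (Mt t \<omega>)) = (CLINT \<omega>|P. 1 * complex_of_real (Mt 0 \<omega>))"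
    using assms by (intro M_martingale[of 0 t "\<lambda>_. 1" 1]) auto
  then have "expectation (Mt t) = expectation (Mt 0)" by (simp flip: of_real_mult)
  also have "expectation (Mt 0) = expectation (\<lambda>_. m0)"
    using M_0 pval_measurable_P[OF order_refl glued_M] by (intro integral_cong_AE) auto
  finally show ?thesis using prob_space by simp
qed

text \<open>Having exactly n down-crossings by time t is the difference of two nested events of the
  form t < \<sigma> (2n). Expectation and series are exchanged because \<open>Delta G\<close> is
  summable.\<close>

lemma Delta_downcrossings_expectation:
  assumes A: "A \<in> sets P" and t: "0 \<le> t"
  shows "(\<integral>\<omega>. indicator A \<omega> * Delta G (downcrossings a b t \<omega>) \<partial>P) =
    (\<Sum>n. Delta G n * (prob (A \<inter> {\<omega> \<in> path_space. ereal t < \<sigma> (2 * Suc n) \<omega>}) -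
       prob (A \<inter> {\<omega> \<in> path_space. ereal t < \<sigma> (2 * n) \<omega>})))"
proof -
  let ?E = "\<lambda>n. {\<omega> \<in> path_space. ereal t < \<sigma> (2 * n) \<omega>}"
  have Em: "A \<inter> ?E n \<in> sets P" for n
  proof -
    have "?E n = {\<omega> \<in> space path_algebra. ereal t < \<sigma> (2 * n) \<omega>}" by simp
    also have "\<dots> \<in> sets path_algebra" by measurable
    finally show ?thesis using A by auto
  qed
  have mono: "?E n \<subseteq> ?E (Suc n)" for n
    using crossing_time_mono[of "2 * n" "2 * Suc n"] by (auto intro: less_le_trans)
  define f where "f n \<omega> = Delta G n * indicator (A \<inter> (?E (Suc n) - ?E n)) \<omega>" for n \<omega>
  have S: "A \<inter> (?E (Suc n) - ?E n) = (A \<inter> ?E (Suc n)) - (A \<inter> ?E n)" for n by auto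
  have Sm: "A \<inter> (?E (Suc n) - ?E n) \<in> sets P" for n unfolding S using Em by (intro sets.Diff)
  have f: "integrable P (f n)" for n
    unfolding f_def using Sm by (intro integrable_mult_right integrable_real_indicator) (auto simp: emeasure_eq_measure)
  have intf: "(\<integral>\<omega>. f n \<omega> \<partial>P) = Delta G n * (prob (A \<inter> ?E (Suc n)) - prob (A \<inter> ?E n))" for n
  proof -
    have "(\<integral>\<omega>. f n \<omega> \<partial>P) = Delta G n * prob (A \<inter> (?E (Suc n) - ?E n))"
      using sets.sets_into_space[OF Sm[of n]] by (simp add: f_def Int_absorb2)
    also have "prob (A \<inter> (?E (Suc n) - ?E n)) = prob (A \<inter> ?E (Suc n)) - prob (A \<inter> ?E n)"
      unfolding S using mono[of n] by (intro finite_measure_Diff Em) auto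
    finally show ?thesis .
  qed
  have fval: "f n \<omega> = (if n = downcrossings a b t \<omega> then indicator A \<omega> * Delta G n else 0)" if "\<omega> \<in> path_space" for n \<omega>
  proof -
    have mem: "\<omega> \<in> ?E m \<longleftrightarrow> phase t \<omega> div 2 < m" for m
      using phase_less_iff[OF that t, of "2 * m"] that by (auto simp: not_le[symmetric])
    have "\<omega> \<in> A \<inter> (?E (Suc n) - ?E n) \<longleftrightarrow> \<omega> \<in> A \<and> n = downcrossings a b t \<omega>"
      unfolding Int_iff Diff_iff mem downcrossings_eq[OF that t] by auto
    then show ?thesis unfolding f_def indicator_def by simp
  qed
  have pw: "(\<Sum>n. f n \<omega>) = indicator A \<omega> * Delta G (downcrossings a b t \<omega>)" "summable (\<lambda>n. norm (f n \<omega>))" if "\<omega> \<in> path_space" for \<omega>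
  proof -
    show "(\<Sum>n. f n \<omega>) = indicator A \<omega> * Delta G (downcrossings a b t \<omega>)"
      unfolding fval[OF that] by (rule sums_unique[OF sums_single, symmetric])
    show "summable (\<lambda>n. norm (f n \<omega>))"
      by (rule summable_finite[of "{downcrossings a b t \<omega>}"]) (auto simp: fval[OF that])
  qed
  have "(\<integral>\<omega>. indicator A \<omega> * Delta G (downcrossings a b t \<omega>) \<partial>P) = (\<integral>\<omega>. (\<Sum>n. f n \<omega>) \<partial>P)"
    by (intro Bochner_Integration.integral_cong) (auto simp: pw)
  also have "\<dots> = (\<Sum>n. \<integral>\<omega>. f n \<omega> \<partial>P)"
  proof (rule integral_suminf[OF f])
    show "AE \<omega> in P. summable (\<lambda>n. norm (f n \<omega>))" using pw(2) by (intro AE_I2) simp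
    show "summable (\<lambda>n. \<integral>\<omega>. norm (f n \<omega>) \<partial>P)"
    proof (rule summable_comparison_test'[OF sums_summable[OF Delta_sums], of 0])
      fix n
      have "(\<integral>\<omega>. norm (f n \<omega>) \<partial>P) \<le> (\<integral>\<omega>. Delta G n \<partial>P)"
      proof (intro integral_mono integrable_norm f)
        show "norm (f n \<omega>) \<le> Delta G n" for \<omega> using Delta_bounds[of n] by (simp add: f_def indicator_def)
      qed simp
      then show "norm (\<integral>\<omega>. norm (f n \<omega>) \<partial>P) \<le> Delta G n" using prob_space by simp
    qed
  qed
  finally show ?thesis unfolding intf .
qed

text \<open>Dominated convergence in \<open>crossing_probability\<close>: the scaled Gaussian
  probability of the interval is at most, and tends to, sqrt (2 / \<pi>) times the distance, which
  is integrable.\<close>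

lemma crossing_probability_asymp:
  assumes s: "0 \<le> s" and A: "A \<in> sets (F s)"
  shows "((\<lambda>t. sqrt (t - s) * prob (A \<inter> {\<omega> \<in> path_space. ereal t < \<sigma> (2 * n) \<omega>}))
    \<longlongrightarrow> sqrt (2 / pi) * (\<integral>\<omega>. indicator A \<omega> * distance n s \<omega> \<partial>P)) at_top"
proof -
  have AP[measurable]: "A \<in> sets P" using A subalgebra_P[of s] by (auto simp: subalgebra_def)
  note [measurable] = distance_measurable[OF s]
  \<comment> \<open>The case split gives a measurable function for every real \<open>h\<close>, as
    dominated convergence along \<open>at_top\<close> requires.\<close>
  define g where "g h \<omega> = indicator A \<omega> * (if 0 < h then sqrt h * measure (gauss h) {- distance n s \<omega>..distance n s \<omega>} else 0)" for h \<omega>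
  have gm[measurable]: "g h \<in> borel_measurable P" for h
  proof (cases "0 < h")
    case True
    note [measurable] = gauss_interval_measurable[OF True distance_measurable[OF s, of n]]
    show ?thesis using True unfolding g_def[abs_def] by simp
  next
    case False then show ?thesis by (simp add: g_def[abs_def])
  qed
  have "((\<lambda>h. \<integral>\<omega>. g h \<omega> \<partial>P) \<longlongrightarrow> (\<integral>\<omega>. indicator A \<omega> * (sqrt (2 / pi) * distance n s \<omega>) \<partial>P)) at_top"
  proof (rule integral_dominated_convergence_at_top[where w="\<lambda>\<omega>. sqrt (2 / pi) * distance n s \<omega>"])
    show "integrable P (\<lambda>\<omega>. sqrt (2 / pi) * distance n s \<omega>)" by (intro integrable_mult_right distance_integrable[OF s])
    show "AE \<omega> in P. ((\<lambda>h. g h \<omega>) \<longlongrightarrow> indicator A \<omega> * (sqrt (2 / pi) * distance n s \<omega>)) at_top"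
    proof (rule AE_I2)
      fix \<omega> assume "\<omega> \<in> space P"
      then have d: "0 \<le> distance n s \<omega>" using distance_nonneg[OF _ s] by simp
      have "((\<lambda>h. indicator A \<omega> * (sqrt h * measure (gauss h) {- distance n s \<omega>..distance n s \<omega>})) \<longlongrightarrow> indicator A \<omega> * (sqrt (2 / pi) * distance n s \<omega>)) at_top"
        by (intro tendsto_mult_left gauss_interval_scaled_tendsto[OF d])
      moreover have "\<forall>\<^sub>F h in at_top. indicator A \<omega> * (sqrt h * measure (gauss h) {- distance n s \<omega>..distance n s \<omega>}) = g h \<omega>"
        using eventually_gt_at_top[of 0] by eventually_elim (simp add: g_def)
      ultimately show "((\<lambda>h. g h \<omega>) \<longlongrightarrow> indicator A \<omega> * (sqrt (2 / pi) * distance n s \<omega>)) at_top"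
        by (rule Lim_transform_eventually)
    qed
    show "\<forall>\<^sub>F h in at_top. AE \<omega> in P. norm (g h \<omega>) \<le> sqrt (2 / pi) * distance n s \<omega>"
      using eventually_gt_at_top[of 0]
    proof eventually_elim
      fix h :: real assume h: "0 < h"
      show "AE \<omega> in P. norm (g h \<omega>) \<le> sqrt (2 / pi) * distance n s \<omega>"
      proof (rule AE_I2)
        fix \<omega> assume "\<omega> \<in> space P"
        then have d: "0 \<le> distance n s \<omega>" using distance_nonneg[OF _ s] by simp
        then have c0: "0 \<le> sqrt (2 / pi) * distance n s \<omega>" by (intro mult_nonneg_nonneg) auto
        show "norm (g h \<omega>) \<le> sqrt (2 / pi) * distance n s \<omega>"
        proof (cases "\<omega> \<in> A")
          case True
          then show ?thesis
            using gauss_interval_scaled_bound[OF h order_refl d] gauss_interval_zero[OF h] h by (simp add: g_def abs_mult)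
        next
          case False
          then have "g h \<omega> = 0" by (simp add: g_def)
          then show ?thesis using c0 by (simp only: norm_zero)
        qed
      qed
    qed
  qed measurable
  also have "(\<integral>\<omega>. indicator A \<omega> * (sqrt (2 / pi) * distance n s \<omega>) \<partial>P) = sqrt (2 / pi) * (\<integral>\<omega>. indicator A \<omega> * distance n s \<omega> \<partial>P)"
    unfolding mult.left_commute[of _ "sqrt (2 / pi)"] by (rule integral_mult_right_zero)
  finally have "((\<lambda>t. \<integral>\<omega>. g (t - s) \<omega> \<partial>P) \<longlongrightarrow> sqrt (2 / pi) * (\<integral>\<omega>. indicator A \<omega> * distance n s \<omega> \<partial>P)) at_top"
    by (rule filterlim_compose) real_asymp
  moreover have "\<forall>\<^sub>F t in at_top. (\<integral>\<omega>. g (t - s) \<omega> \<partial>P) = sqrt (t - s) * prob (A \<inter> {\<omega> \<in> path_space. ereal t < \<sigma> (2 * n) \<omega>})"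
    using eventually_gt_at_top[of s]
  proof eventually_elim
    fix t assume t: "s < t"
    have "(\<integral>\<omega>. g (t - s) \<omega> \<partial>P) = (\<integral>\<omega>. sqrt (t - s) * (indicator A \<omega> * measure (gauss (t - s)) {- distance n s \<omega>..distance n s \<omega>}) \<partial>P)"
      using t by (simp add: g_def mult_ac)
    also have "\<dots> = sqrt (t - s) * (\<integral>\<omega>. indicator A \<omega> * measure (gauss (t - s)) {- distance n s \<omega>..distance n s \<omega>} \<partial>P)"
      by (rule integral_mult_right_zero)
    finally show "(\<integral>\<omega>. g (t - s) \<omega> \<partial>P) = sqrt (t - s) * prob (A \<inter> {\<omega> \<in> path_space. ereal t < \<sigma> (2 * n) \<omega>})"
      unfolding crossing_probability[OF s t A] .
  qed
  ultimately show ?thesis by (rule Lim_transform_eventually)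
qed

text \<open>Combines the Lipschitz estimate for Gaussian intervals with the bound on distance
  increments. The right-hand side depends on neither \<open>n\<close> nor \<open>t\<close>, as
  Tannery's theorem demands.\<close>

lemma crossing_probability_bound:
  assumes st: "0 \<le> s" "s < t" and A: "A \<in> sets (F s)"
  shows "norm (sqrt (t - s) * (prob (A \<inter> {\<omega> \<in> path_space. ereal t < \<sigma> (2 * Suc n) \<omega>}) -
      prob (A \<inter> {\<omega> \<in> path_space. ereal t < \<sigma> (2 * n) \<omega>}))) \<le>
    sqrt (2 / pi) * expectation (\<lambda>\<omega>. 2 * (b - a) + 2 * \<bar>b\<bar> + \<bar>a\<bar> + \<bar>\<omega> s\<bar>)"
proof -
  have h: "0 < t - s" using st by simp
  interpret Gh: prob_space "gauss (t - s)" using real_distribution_gauss[OF h] by (simp add: real_distribution_def)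
  let ?th = "\<lambda>n \<omega>. measure (gauss (t - s)) {- distance n s \<omega>..distance n s \<omega>}"
  have AP[measurable]: "A \<in> sets P" using A subalgebra_P[of s] by (auto simp: subalgebra_def)
  note [measurable] = distance_measurable[OF st(1)]
  have thme: "?th n \<in> borel_measurable P" for n
    by (rule gauss_interval_measurable[OF h distance_measurable[OF st(1)]])
  have i: "integrable P (\<lambda>\<omega>. indicator A \<omega> * ?th n \<omega>)" for n
    using thme[of n] by (intro integrable_const_bound[of _ 1]) (auto simp: indicator_def)
  have ih: "integrable P (\<lambda>\<omega>. sqrt (2 / pi) * (2 * (b - a) + 2 * \<bar>b\<bar> + \<bar>a\<bar> + \<bar>\<omega> s\<bar>))"
    using coord_integrable[OF st(1)] by auto
  have eq: "sqrt (t - s) * (prob (A \<inter> {\<omega> \<in> path_space. ereal t < \<sigma> (2 * Suc n) \<omega>}) -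
      prob (A \<inter> {\<omega> \<in> path_space. ereal t < \<sigma> (2 * n) \<omega>})) = (\<integral>\<omega>. sqrt (t - s) * (indicator A \<omega> * ?th (Suc n) \<omega> - indicator A \<omega> * ?th n \<omega>) \<partial>P)"
    unfolding crossing_probability[OF st A] using i by (subst integral_mult_right_zero) (subst Bochner_Integration.integral_diff; simp)
  have "norm (\<integral>\<omega>. sqrt (t - s) * (indicator A \<omega> * ?th (Suc n) \<omega> - indicator A \<omega> * ?th n \<omega>) \<partial>P) \<le>
      (\<integral>\<omega>. norm (sqrt (t - s) * (indicator A \<omega> * ?th (Suc n) \<omega> - indicator A \<omega> * ?th n \<omega>)) \<partial>P)"
    by (rule integral_norm_bound)
  also have "\<dots> \<le> (\<integral>\<omega>. sqrt (2 / pi) * (2 * (b - a) + 2 * \<bar>b\<bar> + \<bar>a\<bar> + \<bar>\<omega> s\<bar>) \<partial>P)"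
  proof (rule integral_mono)
    show "integrable P (\<lambda>\<omega>. norm (sqrt (t - s) * (indicator A \<omega> * ?th (Suc n) \<omega> - indicator A \<omega> * ?th n \<omega>)))"
      using i by (intro integrable_norm integrable_mult_right Bochner_Integration.integrable_diff)
    fix \<omega> assume "\<omega> \<in> space P"
    then have \<omega>: "\<omega> \<in> path_space" by simp
    note b = gauss_interval_scaled_bound[OF h distance_nonneg[OF \<omega> st(1)] distance_mono[OF \<omega> st(1)], of n]
    have "sqrt (t - s) * (?th (Suc n) \<omega> - ?th n \<omega>) \<le> sqrt (2 / pi) * (2 * (b - a) + 2 * \<bar>b\<bar> + \<bar>a\<bar> + \<bar>\<omega> s\<bar>)"
      by (rule order_trans[OF b(2) mult_left_mono[OF distance_step_bound[OF \<omega> st(1)]]]) simp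
    then show "norm (sqrt (t - s) * (indicator A \<omega> * ?th (Suc n) \<omega> - indicator A \<omega> * ?th n \<omega>)) \<le> sqrt (2 / pi) * (2 * (b - a) + 2 * \<bar>b\<bar> + \<bar>a\<bar> + \<bar>\<omega> s\<bar>)"
      using b(1) by (cases "\<omega> \<in> A") auto
  qed (rule ih)
  also have "\<dots> = sqrt (2 / pi) * expectation (\<lambda>\<omega>. 2 * (b - a) + 2 * \<bar>b\<bar> + \<bar>a\<bar> + \<bar>\<omega> s\<bar>)"
    by (rule integral_mult_right_zero)
  finally show ?thesis unfolding eq .
qed

text \<open>\<open>M_sums\<close> integrated over \<open>A\<close>; the increments have an
  integrable majorant free of \<open>n\<close>, which permits the exchange.\<close>

lemma M_expectation_series:
  assumes s: "0 \<le> s" and A: "A \<in> sets P"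
  shows "(\<Sum>n. Delta G n * ((\<integral>\<omega>. indicator A \<omega> * distance (Suc n) s \<omega> \<partial>P) - (\<integral>\<omega>. indicator A \<omega> * distance n s \<omega> \<partial>P))) =
    2 * (b - a) * (\<integral>\<omega>. indicator A \<omega> * Mt s \<omega> \<partial>P)"
proof -
  let ?H = "\<lambda>\<omega>. 2 * (b - a) + 2 * \<bar>b\<bar> + \<bar>a\<bar> + \<bar>\<omega> s\<bar>"
  define f where "f n \<omega> = indicator A \<omega> * (Delta G n * (distance (Suc n) s \<omega> - distance n s \<omega>))" for n \<omega>
  have di: "integrable P (\<lambda>\<omega>. indicator A \<omega> * distance n s \<omega>)" for n
    using integrable_real_mult_indicator[OF A distance_integrable[OF s, of n]] by (simp add: mult.commute)
  have feq: "f n = (\<lambda>\<omega>. Delta G n * (indicator A \<omega> * distance (Suc n) s \<omega> - indicator A \<omega> * distance n s \<omega>))" for n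
    by (auto simp: f_def algebra_simps)
  have fi: "integrable P (f n)" for n
    unfolding feq using di by (intro integrable_mult_right Bochner_Integration.integrable_diff)
  have intf: "(\<integral>\<omega>. f n \<omega> \<partial>P) = Delta G n * ((\<integral>\<omega>. indicator A \<omega> * distance (Suc n) s \<omega> \<partial>P) - (\<integral>\<omega>. indicator A \<omega> * distance n s \<omega> \<partial>P))" for n
    unfolding feq using di by (subst integral_mult_right_zero) (subst Bochner_Integration.integral_diff; simp)
  have nb: "norm (f n \<omega>) \<le> Delta G n * ?H \<omega>" if "\<omega> \<in> path_space" for n \<omega>
    using distance_mono[OF that s, of n] distance_step_bound[OF that s, of n] Delta_bounds[of n] ab
    by (auto simp: f_def indicator_def abs_mult intro!: mult_left_mono mult_nonneg_nonneg)
  have Hi: "integrable P ?H" using coord_integrable[OF s] by auto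
  have "(\<integral>\<omega>. (\<Sum>n. f n \<omega>) \<partial>P) = (\<Sum>n. \<integral>\<omega>. f n \<omega> \<partial>P)"
  proof (rule integral_suminf[OF fi])
    show "AE \<omega> in P. summable (\<lambda>n. norm (f n \<omega>))"
    proof (rule AE_I2)
      fix \<omega> assume "\<omega> \<in> space P"
      then show "summable (\<lambda>n. norm (f n \<omega>))"
        using nb by (intro summable_comparison_test'[OF summable_mult2[OF sums_summable[OF Delta_sums], of "?H \<omega>"], of 0]) auto
    qed
    show "summable (\<lambda>n. \<integral>\<omega>. norm (f n \<omega>) \<partial>P)"
    proof (rule summable_comparison_test'[OF summable_mult2[OF sums_summable[OF Delta_sums], of "expectation ?H"], of 0])
      fix n
      have "(\<integral>\<omega>. norm (f n \<omega>) \<partial>P) \<le> (\<integral>\<omega>. Delta G n * ?H \<omega> \<partial>P)"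
        using fi Hi nb by (intro integral_mono integrable_norm integrable_mult_right) auto
      then show "norm (\<integral>\<omega>. norm (f n \<omega>) \<partial>P) \<le> Delta G n * expectation ?H" by simp
    qed
  qed
  also have "(\<integral>\<omega>. (\<Sum>n. f n \<omega>) \<partial>P) = (\<integral>\<omega>. 2 * (b - a) * (indicator A \<omega> * Mt s \<omega>) \<partial>P)"
  proof (rule Bochner_Integration.integral_cong)
    fix \<omega> assume "\<omega> \<in> space P"
    then have \<omega>: "\<omega> \<in> path_space" by simp
    show "(\<Sum>n. f n \<omega>) = 2 * (b - a) * (indicator A \<omega> * Mt s \<omega>)"
      unfolding f_def using sums_unique[OF sums_mult[OF M_sums[OF \<omega> s], of "indicator A \<omega>"]] by (simp add: mult_ac)
  qed simp
  also have "\<dots> = 2 * (b - a) * (\<integral>\<omega>. indicator A \<omega> * Mt s \<omega> \<partial>P)" by (rule integral_mult_right_zero)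
  finally show ?thesis unfolding intf by simp
qed

text \<open>Termwise limits come from \<open>crossing_probability_asymp\<close>, the summable
  majorant from \<open>crossing_probability_bound\<close>; Tannery's theorem exchanges limit and
  series, and \<open>M_expectation_series\<close> evaluates the result.\<close>

lemma penalisation_asymp:
  assumes s: "0 \<le> s" and A: "A \<in> sets (F s)"
  shows "((\<lambda>t. sqrt (t - s) * (\<integral>\<omega>. indicator A \<omega> * Delta G (downcrossings a b t \<omega>) \<partial>P))
    \<longlongrightarrow> sqrt (2 / pi) * (2 * (b - a) * (\<integral>\<omega>. indicator A \<omega> * Mt s \<omega> \<partial>P))) at_top"
proof -
  have AP: "A \<in> sets P" using A subalgebra_P[of s] by (auto simp: subalgebra_def)
  let ?u = "\<lambda>n t. prob (A \<inter> {\<omega> \<in> path_space. ereal t < \<sigma> (2 * n) \<omega>})"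
  let ?e = "\<lambda>n. \<integral>\<omega>. indicator A \<omega> * distance n s \<omega> \<partial>P"
  let ?K = "sqrt (2 / pi) * expectation (\<lambda>\<omega>. 2 * (b - a) + 2 * \<bar>b\<bar> + \<bar>a\<bar> + \<bar>\<omega> s\<bar>)"
  let ?F = "\<lambda>n t. Delta G n * (sqrt (t - s) * (?u (Suc n) t - ?u n t))"
  let ?b = "\<lambda>n. Delta G n * (sqrt (2 / pi) * (?e (Suc n) - ?e n))"
  have tan: "(\<forall>\<^sub>F t in at_top. summable (\<lambda>n. norm (?F n t))) \<and> summable (\<lambda>n. norm (?b n)) \<and>
      ((\<lambda>t. \<Sum>n. ?F n t) \<longlongrightarrow> (\<Sum>n. ?b n)) at_top"
  proof (rule tannerys_theorem)
    fix n
    have "((\<lambda>t. sqrt (t - s) * ?u (Suc n) t - sqrt (t - s) * ?u n t) \<longlongrightarrow> sqrt (2 / pi) * ?e (Suc n) - sqrt (2 / pi) * ?e n) at_top"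
      by (intro tendsto_diff crossing_probability_asymp[OF s A])
    then show "((\<lambda>t. ?F n t) \<longlongrightarrow> ?b n) at_top"
      unfolding right_diff_distrib[of "sqrt _"] by (intro tendsto_mult_left)
  next
    have "norm (?F n t) \<le> Delta G n * ?K" if "s < t" for n t
      unfolding norm_mult[of "Delta G n"]
      using crossing_probability_bound[OF s that A, of n] Delta_bounds[of n] by (intro mult_mono) auto
    then show "\<forall>\<^sub>F (n, t) in sequentially \<times>\<^sub>F at_top. norm (?F n t) \<le> Delta G n * ?K"
      unfolding eventually_prod_filter
      by (intro exI[of _ "\<lambda>_. True"] exI[of _ "\<lambda>t. s < t"]) (auto intro: eventually_gt_at_top)
    show "summable (\<lambda>n. Delta G n * ?K)" by (rule summable_mult2[OF sums_summable[OF Delta_sums]])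
  qed simp
  \<comment> \<open>A nonzero factor may be moved out of the series because summability with and
    without it is equivalent.\<close>
  have pull: "(\<Sum>n. Delta G n * (c * x n)) = c * (\<Sum>n. Delta G n * x n)"
    if "summable (\<lambda>n. norm (Delta G n * (c * x n)))" "c \<noteq> 0" for c x
  proof -
    have "summable (\<lambda>n. c * (Delta G n * x n))"
      using summable_norm_cancel[OF that(1)] by (simp only: mult.left_commute)
    then have "summable (\<lambda>n. Delta G n * x n)" using that(2) by (simp add: summable_cmult_iff)
    then show ?thesis unfolding mult.left_commute[of _ c] by (rule suminf_mult)
  qed
  have b: "(\<Sum>n. ?b n) = sqrt (2 / pi) * (2 * (b - a) * (\<integral>\<omega>. indicator A \<omega> * Mt s \<omega> \<partial>P))"
    using pull[OF tan[THEN conjunct2, THEN conjunct1]] M_expectation_series[OF s AP] by simp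
  have "\<forall>\<^sub>F t in at_top. (\<Sum>n. ?F n t) = sqrt (t - s) * (\<integral>\<omega>. indicator A \<omega> * Delta G (downcrossings a b t \<omega>) \<partial>P)"
    using eventually_gt_at_top[of s] tan[THEN conjunct1]
  proof eventually_elim
    fix t assume t: "s < t" and sm: "summable (\<lambda>n. norm (?F n t))"
    show "(\<Sum>n. ?F n t) = sqrt (t - s) * (\<integral>\<omega>. indicator A \<omega> * Delta G (downcrossings a b t \<omega>) \<partial>P)"
      using pull[OF sm] Delta_downcrossings_expectation[OF AP, of t] s t by simp
  qed
  then show ?thesis
    using tan[THEN conjunct2, THEN conjunct2] unfolding b by (rule Lim_transform_eventually[rotated])
qed

text \<open>Numerator and denominator have the common rate 1 / sqrt (t - s). The denominator is the
  case of the whole space, where the martingale property turns the limit into a multiple of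
  \<open>m0\<close>.\<close>

theorem penalisation_limit:
  assumes s: "0 \<le> s" and A: "A \<in> sets (F s)"
  shows "((\<lambda>t. (\<integral>\<omega>. indicator A \<omega> * Delta G (downcrossings a b t \<omega>) \<partial>P) /
             (\<integral>\<omega>. Delta G (downcrossings a b t \<omega>) \<partial>P))
        \<longlongrightarrow> 1 / m0 * (\<integral>\<omega>. indicator A \<omega> * M_down a b G s \<omega> \<partial>P)) at_top"
proof -
  let ?E = "\<integral>\<omega>. indicator A \<omega> * Mt s \<omega> \<partial>P"
  let ?c = "sqrt (2 / pi) * (2 * (b - a))"
  have c0: "?c \<noteq> 0" using ab by simp
  have path_sets: "path_space \<in> sets (F s)" using sets.top[of "F s"] by simp
  have 1: "(\<integral>\<omega>. indicator path_space \<omega> * f \<omega> \<partial>P) = integral\<^sup>L P f" for f :: "_ \<Rightarrow> real"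
    by (intro Bochner_Integration.integral_cong) auto
  have "((\<lambda>t. (sqrt (t - s) * (\<integral>\<omega>. indicator A \<omega> * Delta G (downcrossings a b t \<omega>) \<partial>P)) /
       (sqrt (t - s) * (\<integral>\<omega>. Delta G (downcrossings a b t \<omega>) \<partial>P))) \<longlongrightarrow> (?c * ?E) / (?c * m0)) at_top"
  proof (rule tendsto_divide)
    show "((\<lambda>t. sqrt (t - s) * (\<integral>\<omega>. indicator A \<omega> * Delta G (downcrossings a b t \<omega>) \<partial>P)) \<longlongrightarrow> ?c * ?E) at_top"
      using penalisation_asymp[OF s A] by (simp only: mult.assoc)
    show "((\<lambda>t. sqrt (t - s) * (\<integral>\<omega>. Delta G (downcrossings a b t \<omega>) \<partial>P)) \<longlongrightarrow> ?c * m0) at_top"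
      using penalisation_asymp[OF s path_sets] unfolding 1 M_expectation[OF s] by (simp only: mult.assoc)
    show "?c * m0 \<noteq> 0" using c0 m0_pos by simp
  qed
  moreover have "\<forall>\<^sub>F t in at_top. (sqrt (t - s) * (\<integral>\<omega>. indicator A \<omega> * Delta G (downcrossings a b t \<omega>) \<partial>P)) /
       (sqrt (t - s) * (\<integral>\<omega>. Delta G (downcrossings a b t \<omega>) \<partial>P)) =
       (\<integral>\<omega>. indicator A \<omega> * Delta G (downcrossings a b t \<omega>) \<partial>P) / (\<integral>\<omega>. Delta G (downcrossings a b t \<omega>) \<partial>P)"
    using eventually_gt_at_top[of s] by eventually_elim simp
  ultimately have "((\<lambda>t. (\<integral>\<omega>. indicator A \<omega> * Delta G (downcrossings a b t \<omega>) \<partial>P) / (\<integral>\<omega>. Delta G (downcrossings a b t \<omega>) \<partial>P))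
      \<longlongrightarrow> (?c * ?E) / (?c * m0)) at_top"
    by (rule Lim_transform_eventually)
  moreover have "(?c * ?E) / (?c * m0) = 1 / m0 * ?E" using c0 by simp
  moreover have "?E = (\<integral>\<omega>. indicator A \<omega> * M_down a b G s \<omega> \<partial>P)"
    by (intro Bochner_Integration.integral_cong) (auto simp: M_down_eq s)
  ultimately show ?thesis by simp
qed

end

section \<open>The drift and its bounded approximations\<close>

lemma integral_derivative_interior:
  fixes f :: "real \<Rightarrow> 'a::banach"
  assumes f: "f integrable_on {s..t}" and x: "s < x" "x < t" and c: "isCont f x"
  shows "((\<lambda>u. integral {s..u} f) has_vector_derivative f x) (at x)"
proof -
  have "((\<lambda>u. integral {s..u} f) has_vector_derivative f x) (at x within ({s..t} - {}))"
    using x c by (intro integral_has_vector_derivative_continuous_at[OF f]) (auto intro: continuous_at_imp_continuous_within)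
  then show ?thesis using x by (simp add: at_within_Icc_at)
qed

text \<open>The integrand is the derivative of V r (m - i l J r), since J' = -\<xi> and V' = -i l
  \<rho> V off the finite set. In the application m is the terminal value of M, \<xi> the
  coefficient of M and \<rho> a trial drift.\<close>

lemma phase_factor_ftc:
  fixes \<rho> \<xi> :: "real \<Rightarrow> real" and l :: real and m :: complex
  assumes st: "s \<le> t" and T: "finite T" and \<rho>: "\<rho> integrable_on {s..t}" and \<xi>: "\<xi> integrable_on {s..t}"
    and c: "\<And>r. s < r \<Longrightarrow> r < t \<Longrightarrow> r \<notin> T \<Longrightarrow> isCont \<rho> r \<and> isCont \<xi> r"
  defines "V \<equiv> \<lambda>r. iexp (- l * integral {s..r} \<rho>)" and "J \<equiv> \<lambda>r. integral {s..t} \<xi> - integral {s..r} \<xi>"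
  shows "((\<lambda>r. V r * (- \<i> * l * \<rho> r * (m - \<i> * l * J r) + \<i> * l * \<xi> r)) has_integral
     (V t * m - (m - \<i> * l * integral {s..t} \<xi>))) {s..t}"
proof -
  define \<Phi> where "\<Phi> r = V r * (m - \<i> * l * J r)" for r
  have "((\<lambda>r. V r * (- \<i> * l * \<rho> r * (m - \<i> * l * J r) + \<i> * l * \<xi> r)) has_integral (\<Phi> t - \<Phi> s)) {s..t}"
  proof (rule fundamental_theorem_of_calculus_interior_strong[OF T st])
    fix r assume r: "r \<in> {s<..<t} - T"
    note d = integral_derivative_interior[OF \<rho>, of r] integral_derivative_interior[OF \<xi>, of r]
    have d1: "((\<lambda>u. integral {s..u} \<rho>) has_field_derivative \<rho> r) (at r)"
      and d2: "((\<lambda>u. integral {s..u} \<xi>) has_field_derivative \<xi> r) (at r)"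
      using d r c[of r] by (auto simp: has_real_derivative_iff_has_vector_derivative)
    have dV: "(V has_vector_derivative (- \<i> * l * \<rho> r * V r)) (at r)"
    proof -
      have "((\<lambda>u. - l * integral {s..u} \<rho>) has_vector_derivative (- l * \<rho> r)) (at r)"
        using d1 by (auto intro!: derivative_eq_intros simp flip: has_real_derivative_iff_has_vector_derivative)
      from vector_diff_chain_at[OF this has_vector_derivative_iexp[of "- l * integral {s..r} \<rho>" UNIV]]
      show ?thesis by (simp add: V_def o_def scaleR_conv_of_real mult_ac)
    qed
    have dJ: "((\<lambda>u. complex_of_real (J u)) has_vector_derivative (- complex_of_real (\<xi> r))) (at r)"
    proof -
      have "(J has_real_derivative (- \<xi> r)) (at r)"
        unfolding J_def using d2 by (auto intro!: derivative_eq_intros)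
      from has_vector_derivative_of_real[OF this, where 'a=complex] show ?thesis by simp
    qed
    show "(\<Phi> has_vector_derivative (V r * (- \<i> * l * \<rho> r * (m - \<i> * l * J r) + \<i> * l * \<xi> r))) (at r)"
      unfolding \<Phi>_def
      by (rule has_vector_derivative_eq_rhs, (rule derivative_intros dV dJ)+) (simp add: algebra_simps)
  next
    have "continuous_on {s..t} (\<lambda>r. integral {s..r} \<rho>)" "continuous_on {s..t} (\<lambda>r. integral {s..r} \<xi>)"
      using \<rho> \<xi> by (auto intro: indefinite_integral_continuous_1)
    then show "continuous_on {s..t} \<Phi>" unfolding \<Phi>_def V_def J_def
      by (auto intro!: continuous_intros)
  qed
  moreover have "\<Phi> t = V t * m" "\<Phi> s = m - \<i> * l * integral {s..t} \<xi>"
    by (auto simp: \<Phi>_def J_def V_def)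
  ultimately show ?thesis by simp
qed

context levels
begin

text \<open>The left phase makes these processes progressively measurable for the raw filtration; up
  to any horizon they differ from their counterparts with \<open>phase\<close> at finitely many
  times only.\<close>

abbreviation state :: "(nat \<Rightarrow> real \<Rightarrow> 'b) \<Rightarrow> real \<Rightarrow> (real \<Rightarrow> real) \<Rightarrow> 'b" where
  "state h r \<omega> \<equiv> h (lphase r \<omega>) (\<omega> r)"

lemma state_joint_measurable:
  fixes h :: "nat \<Rightarrow> real \<Rightarrow> real"
  assumes t: "0 \<le> t" and s: "0 \<le> s" and h: "\<And>k. h k \<in> borel_measurable borel"
  shows "(\<lambda>p. indicator {s..t} (fst p) * state h (fst p) (snd p)) \<in> borel_measurable (borel \<Otimes>\<^sub>M path_filtration t)"
proof -
  have "(\<lambda>p. indicator {s..t} (fst p) * h (lphase (max 0 (min (fst p) t)) (snd p)) (snd p (max 0 (min (fst p) t))))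
    \<in> borel_measurable (borel \<Otimes>\<^sub>M path_filtration t)"
    using joint_measurable[OF t h] by measurable
  moreover have "indicator {s..t} (fst p) * h (lphase (max 0 (min (fst p) t)) (snd p)) (snd p (max 0 (min (fst p) t))) =
     indicator {s..t} (fst p) * state h (fst p) (snd p)" for p
    using s by (auto simp: indicator_def min_def max_def)
  ultimately show ?thesis by simp
qed

lemma state_measurable_time:
  fixes h :: "nat \<Rightarrow> real \<Rightarrow> real"
  assumes \<omega>: "\<omega> \<in> path_space" and s: "0 \<le> s" and h: "\<And>k. h k \<in> borel_measurable borel"
  shows "(\<lambda>r. indicator {s..t} r * state h r \<omega>) \<in> borel_measurable borel"
proof (cases "0 \<le> t")
  case True
  have "(\<lambda>r. (r, \<omega>)) \<in> measurable borel (borel \<Otimes>\<^sub>M path_filtration t)"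
    using \<omega> by (intro measurable_Pair) auto
  from measurable_compose[OF this state_joint_measurable[OF True s h]] show ?thesis by simp
next
  case False
  then show ?thesis using s by (simp add: indicator_def)
qed

lemma state_integrable:
  fixes h :: "nat \<Rightarrow> real \<Rightarrow> real"
  assumes \<omega>: "\<omega> \<in> path_space" and s: "0 \<le> s" and h: "\<And>k. h k \<in> borel_measurable borel" and R: "\<And>k x. \<bar>h k x\<bar> \<le> R"
  shows "set_integrable lborel {s..t} (\<lambda>r. state h r \<omega>)" "(\<lambda>r. state h r \<omega>) integrable_on {s..t}"
    "integral {s..t} (\<lambda>r. state h r \<omega>) = (\<integral>r. indicator {s..t} r * state h r \<omega> \<partial>lborel)"
proof -
  show 1: "set_integrable lborel {s..t} (\<lambda>r. state h r \<omega>)"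
  proof (rule set_integrable_bound[where f="\<lambda>_. R"])
    show "set_integrable lborel {s..t} (\<lambda>_. R)" by (rule borel_integrable_atLeastAtMost') simp
    show "set_borel_measurable lborel {s..t} (\<lambda>r. state h r \<omega>)"
      using state_measurable_time[OF \<omega> s h, of t] by (simp add: set_borel_measurable_def)
  qed (use R in \<open>auto intro: order_trans[OF _ abs_ge_self]\<close>)
  then show "(\<lambda>r. state h r \<omega>) integrable_on {s..t}" by (rule set_borel_integral_eq_integral)
  show "integral {s..t} (\<lambda>r. state h r \<omega>) = (\<integral>r. indicator {s..t} r * state h r \<omega> \<partial>lborel)"
    using set_borel_integral_eq_integral(2)[OF 1] by (simp add: set_lebesgue_integral_def)
qed

lemma state_integral_joint_measurable:
  fixes h :: "nat \<Rightarrow> real \<Rightarrow> real"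
  assumes t: "0 \<le> t" and s: "0 \<le> s" and h: "\<And>k. h k \<in> borel_measurable borel" and R: "\<And>k x. \<bar>h k x\<bar> \<le> R"
  shows "(\<lambda>p. integral {s..min t (fst p)} (\<lambda>q. state h q (snd p))) \<in> borel_measurable (borel \<Otimes>\<^sub>M path_filtration t)"
proof -
  let ?N = "borel \<Otimes>\<^sub>M path_filtration t :: (real \<times> (real \<Rightarrow> real)) measure"
  let ?g = "\<lambda>p. indicator {s..t} (fst p) * state h (fst p) (snd p)"
  have m: "(\<lambda>x. ?g (snd x, snd (fst x))) \<in> borel_measurable (?N \<Otimes>\<^sub>M lborel)"
    by (rule measurable_compose[OF _ state_joint_measurable[OF t s h]]) measurable
  have m2: "(\<lambda>x. (if snd x \<le> fst (fst x) then 1 else 0) * ?g (snd x, snd (fst x))) \<in> borel_measurable (?N \<Otimes>\<^sub>M lborel)"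
    using m by measurable
  have "(\<lambda>p. \<integral>q. (if q \<le> fst p then 1 else 0) * ?g (q, snd p) \<partial>lborel) \<in> borel_measurable ?N"
    using m2 by (intro lborel.borel_measurable_lebesgue_integral) (simp add: case_prod_beta')
  moreover have "integral {s..min t (fst p)} (\<lambda>q. state h q (snd p)) = (\<integral>q. (if q \<le> fst p then 1 else 0) * ?g (q, snd p) \<partial>lborel)"
    if "p \<in> space ?N" for p
  proof -
    have "snd p \<in> path_space" using that by (auto simp: space_pair_measure)
    note state_integrable(3)[OF this s h R, of "min t (fst p)"]
    also have "(\<integral>r. indicator {s..min t (fst p)} r * state h r (snd p) \<partial>lborel) = (\<integral>q. (if q \<le> fst p then 1 else 0) * ?g (q, snd p) \<partial>lborel)"
      by (intro Bochner_Integration.integral_cong) (auto simp: indicator_def)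
    finally show ?thesis .
  qed
  ultimately show ?thesis by (subst measurable_cong) auto
qed

lemma state_integral_measurable:
  fixes h :: "nat \<Rightarrow> real \<Rightarrow> real"
  assumes t: "0 \<le> t" and s: "0 \<le> s" and h: "\<And>k. h k \<in> borel_measurable borel" and R: "\<And>k x. \<bar>h k x\<bar> \<le> R"
  shows "(\<lambda>\<omega>. integral {s..t} (\<lambda>q. state h q \<omega>)) \<in> borel_measurable (path_filtration t)"
  using measurable_compose[OF measurable_Pair1' state_integral_joint_measurable[OF t s h R], of t] by simp

lemma state_isCont:
  assumes \<omega>: "\<omega> \<in> path_space" and t: "0 \<le> t"
  obtains T where "finite T" "\<And>r h. 0 < r \<Longrightarrow> r < t \<Longrightarrow> r \<notin> T \<Longrightarrow> \<forall>k. continuous_on UNIV (h k :: real \<Rightarrow> real) \<Longrightarrow>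
      isCont (\<lambda>r. state h r \<omega>) r"
    "\<And>r. 0 \<le> r \<Longrightarrow> r \<le> t \<Longrightarrow> r \<notin> T \<Longrightarrow> phase r \<omega> = lphase r \<omega>"
proof -
  obtain T where T: "finite T" "\<And>u v. 0 \<le> u \<Longrightarrow> u \<le> v \<Longrightarrow> v \<le> t \<Longrightarrow> T \<inter> {u..v} = {} \<Longrightarrow>
       phase u \<omega> = phase v \<omega> \<and> lphase u \<omega> = phase v \<omega>"
    using change_times[OF \<omega> t] by metis
  have 1: "isCont (\<lambda>r. state h r \<omega>) r" if r: "0 < r" "r < t" "r \<notin> T" and h: "\<forall>k. continuous_on UNIV (h k)" for r and h :: "nat \<Rightarrow> real \<Rightarrow> real"
  proof -
    have "open (- T \<inter> {0<..<t})" using T(1) by (intro open_Int) (auto intro: finite_imp_closed)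
    moreover have "r \<in> - T \<inter> {0<..<t}" using r by simp
    ultimately obtain d where d: "0 < d" "cball r d \<subseteq> - T \<inter> {0<..<t}" unfolding open_contains_cball by blast
    have sub: "{r - d..r + d} \<subseteq> - T \<inter> {0<..<t}" using d(2) by (auto simp: cball_def dist_real_def subset_iff abs_le_iff)
    have k: "lphase u \<omega> = phase (r + d) \<omega>" if "u \<in> {r - d..r + d}" for u
    proof -
      have "r + d \<in> {r - d..r + d}" using d(1) by simp
      then have "u \<in> {0<..<t}" "r + d \<in> {0<..<t}" using that sub by blast+
      moreover have "{u..r + d} \<subseteq> {r - d..r + d}" using that by auto
      then have "T \<inter> {u..r + d} = {}" using sub by blast
      ultimately show ?thesis using T(2)[of u "r + d"] that by auto
    qed
    have "\<forall>\<^sub>F u in nhds r. state h u \<omega> = h (phase (r + d) \<omega>) (\<omega> u)"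
      using eventually_nhds_in_open[of "{r - d<..<r + d}" r] d(1)
      by (auto elim!: eventually_mono simp: k)
    moreover have "isCont (\<lambda>u. h (phase (r + d) \<omega>) (\<omega> u)) r"
    proof (rule isCont_o2[where f=\<omega>])
      show "isCont \<omega> r"
        using continuous_on_interior[OF path_cont[OF \<omega>], of r] r by simp
      show "isCont (h (phase (r + d) \<omega>)) (\<omega> r)" using h by (simp add: continuous_on_eq_continuous_at)
    qed
    ultimately show "isCont (\<lambda>r. state h r \<omega>) r" by (rule isCont_cong[THEN iffD2])
  qed
  show ?thesis
  proof (rule that[OF T(1) 1])
    show "phase r \<omega> = lphase r \<omega>" if "0 \<le> r" "r \<le> t" "r \<notin> T" for r
      using T(2)[of r r] that by auto
  qed
qed

end

context downcross
begin

text \<open>Holding \<open>U\<close> fixed leaves the characteristic function of the increment after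
  \<open>r\<close>.\<close>

lemma freeze_iexp:
  fixes U :: "(real \<Rightarrow> real) \<Rightarrow> complex"
  assumes rt: "0 \<le> r" "r \<le> t" and U: "U \<in> borel_measurable (F r)" "integrable P U"
  shows "(CLINT \<omega>|P. U \<omega> * iexp (l * (\<omega> t - \<omega> r))) = complex_of_real (exp (- (l\<^sup>2 * (t - r) / 2))) * (CLINT \<omega>|P. U \<omega>)"
proof (cases "r = t")
  case True then show ?thesis by simp
next
  case False
  with rt have lt: "r < t" by simp
  have h: "0 < t - r" using lt by simp
  note [measurable] = U(1) coord_measurable_P[OF rt(1)] measurable_from_subalg[OF subalgebra_P U(1)]
  have [measurable]: "(\<lambda>\<omega>. \<omega> t) \<in> borel_measurable P" using rt by (intro coord_measurable_P) simp
  let ?f = "\<lambda>p. U (fst p) * iexp (l * snd p)"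
  have fm: "?f \<in> borel_measurable (F r \<Otimes>\<^sub>M borel)" by measurable
  have int: "integrable P (\<lambda>\<omega>. ?f (\<omega>, \<omega> t - \<omega> r))"
    by (rule Bochner_Integration.integrable_bound[OF U(2)]) (measurable, simp add: norm_mult)
  have "(CLINT \<omega>|P. U \<omega> * iexp (l * (\<omega> t - \<omega> r))) = (CLINT \<omega>|P. ?f (\<omega>, \<omega> t - \<omega> r))" by simp
  also have "\<dots> = (CLINT \<omega>|P. (CLINT x|gauss (t - r). ?f (\<omega>, x)))"
    by (rule gaussian_indep_freeze(1)[OF prob_space_axioms subalgebra_P increment_gaussian[OF rt(1) lt] h fm int])
  also have "\<dots> = (CLINT \<omega>|P. U \<omega> * complex_of_real (exp (- (l\<^sup>2 * (t - r) / 2))))"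
  proof (intro Bochner_Integration.integral_cong refl)
    fix \<omega>
    have "(CLINT x|gauss (t - r). ?f (\<omega>, x)) = U \<omega> * char (gauss (t - r)) l"
      unfolding char_def by (simp add: integral_mult_right_zero)
    then show "(CLINT x|gauss (t - r). ?f (\<omega>, x)) = U \<omega> * complex_of_real (exp (- (l\<^sup>2 * (t - r) / 2)))"
      by (simp add: char_gauss[OF h])
  qed
  also have "\<dots> = (CLINT \<omega>|P. U \<omega>) * complex_of_real (exp (- (l\<^sup>2 * (t - r) / 2)))" by (rule integral_mult_left_zero)
  finally show ?thesis by (simp only: mult.commute)
qed

lemma bounded_mult_M_integrable:
  fixes W :: "(real \<Rightarrow> real) \<Rightarrow> complex"
  assumes t: "0 \<le> t" and W: "W \<in> borel_measurable P" "\<And>\<omega>. norm (W \<omega>) \<le> B"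
  shows "integrable P (\<lambda>\<omega>. W \<omega> * Mt t \<omega>)"
proof (rule Bochner_Integration.integrable_bound)
  show "integrable P (\<lambda>\<omega>. B * Mt t \<omega>)" using M_integrable[OF t] by simp
  show "(\<lambda>\<omega>. W \<omega> * complex_of_real (Mt t \<omega>)) \<in> borel_measurable P"
    using W(1) pval_measurable_P[OF t glued_M] by measurable
  have "0 \<le> B" using W(2)[of undefined] norm_ge_zero order_trans by blast
  then show "AE \<omega> in P. norm (W \<omega> * complex_of_real (Mt t \<omega>)) \<le> norm (B * Mt t \<omega>)"
    using W(2) by (intro AE_I2) (simp add: norm_mult abs_mult mult_right_mono)
qed

abbreviation mc_at :: "nat \<Rightarrow> real \<Rightarrow> real" where "mc_at \<equiv> \<lambda>k x. mc k"

text \<open>The subtracted integral is the covariation of the coordinate process and M. With this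
  correction \<open>exp_martingale_deriv\<close> allows M at time t to be replaced by M at time r,
  after which \<open>freeze_iexp\<close> averages the remaining increment.\<close>

lemma tilted_martingale:
  fixes W :: "(real \<Rightarrow> real) \<Rightarrow> complex"
  assumes rt: "0 \<le> r" "r \<le> t" and W: "W \<in> borel_measurable (F r)" "\<And>\<omega>. norm (W \<omega>) \<le> B"
  shows "(CLINT \<omega>|P. W \<omega> * iexp (l * (\<omega> t - \<omega> r)) * (Mt t \<omega> - \<i> * l * integral {r..t} (\<lambda>q. state mc_at q \<omega>))) =
     complex_of_real (exp (- (l\<^sup>2 * (t - r) / 2))) * (CLINT \<omega>|P. W \<omega> * Mt r \<omega>)"
proof -
  obtain C where C: "\<And>k. \<bar>ma k\<bar> \<le> C" "\<And>k. \<bar>mc k\<bar> \<le> C" using M_coeff_bound by blast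
  have t0: "0 \<le> t" using rt by simp
  note [measurable] = measurable_from_subalg[OF subalgebra_P W(1)] coord_measurable_P[OF rt(1)] coord_measurable_P[OF t0]
    pval_measurable_P[OF rt(1) glued_M] pval_measurable_P[OF t0 glued_M]
  let ?I = "\<lambda>\<omega>. integral {r..t} (\<lambda>q. mc (lphase q \<omega>))"
  have [measurable]: "?I \<in> borel_measurable P"
    by (rule measurable_from_subalg[OF subalgebra_P step_integral_measurable[of mc C, OF C(2) rt]])
  let ?W = "\<lambda>\<omega>. W \<omega> * iexp (l * (\<omega> t - \<omega> r))"
  have Wm: "?W \<in> borel_measurable P" by measurable
  have Wb: "norm (?W \<omega>) \<le> B" for \<omega> using W(2) by (simp add: norm_mult)
  have B0: "0 \<le> B" using W(2)[of undefined] norm_ge_zero order_trans by blast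
  have i1: "integrable P (\<lambda>\<omega>. ?W \<omega> * Mt u \<omega>)" if "0 \<le> u" for u
    using bounded_mult_M_integrable[OF that Wm Wb] .
  have i2: "integrable P (\<lambda>\<omega>. ?W \<omega> * (\<i> * l * ?I \<omega>))"
  proof (rule integrable_const_bound)
    show "AE \<omega> in P. norm (?W \<omega> * (\<i> * l * ?I \<omega>)) \<le> B * (\<bar>l\<bar> * (C * (t - r)))"
    proof (rule AE_I2)
      fix \<omega> assume "\<omega> \<in> space P"
      then have "\<bar>?I \<omega>\<bar> \<le> C * (t - r)" using step_integral_bound[of mc C r t \<omega>] C rt by simp
      then have "norm (\<i> * l * ?I \<omega>) \<le> \<bar>l\<bar> * (C * (t - r))" by (simp add: norm_mult mult_left_mono)
      then show "norm (?W \<omega> * (\<i> * l * ?I \<omega>)) \<le> B * (\<bar>l\<bar> * (C * (t - r)))"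
        unfolding norm_mult[of "?W \<omega>"] using Wb B0 by (intro mult_mono) auto
    qed
  qed measurable
  have "(CLINT \<omega>|P. \<i> * (?W \<omega> * (Mt t \<omega> - \<i> * l * ?I \<omega>) - ?W \<omega> * Mt r \<omega>)) = 0"
    using exp_martingale_deriv[OF rt glued_M C W, of l] by (simp add: algebra_simps)
  then have "(CLINT \<omega>|P. ?W \<omega> * (Mt t \<omega> - \<i> * l * ?I \<omega>) - ?W \<omega> * Mt r \<omega>) = 0"
    by (subst (asm) integral_mult_right_zero) simp
  moreover have "integrable P (\<lambda>\<omega>. ?W \<omega> * (Mt t \<omega> - \<i> * l * ?I \<omega>))"
  proof -
    have e: "?W \<omega> * (x - y) = ?W \<omega> * x - ?W \<omega> * y" for \<omega> x y by (rule right_diff_distrib)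
    show ?thesis unfolding e by (rule Bochner_Integration.integrable_diff[OF i1[OF t0] i2])
  qed
  ultimately have "(CLINT \<omega>|P. ?W \<omega> * (Mt t \<omega> - \<i> * l * ?I \<omega>)) = (CLINT \<omega>|P. ?W \<omega> * Mt r \<omega>)"
    using i1[OF rt(1)] by simp
  also have "\<dots> = (CLINT \<omega>|P. (W \<omega> * Mt r \<omega>) * iexp (l * (\<omega> t - \<omega> r)))"
    by (simp only: mult_ac)
  also have "\<dots> = complex_of_real (exp (- (l\<^sup>2 * (t - r) / 2))) * (CLINT \<omega>|P. W \<omega> * Mt r \<omega>)"
  proof (rule freeze_iexp[OF rt])
    show "(\<lambda>\<omega>. W \<omega> * complex_of_real (Mt r \<omega>)) \<in> borel_measurable (F r)"
      using W(1) pval_measurable[OF rt(1) glued_M] by measurable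
    show "integrable P (\<lambda>\<omega>. W \<omega> * complex_of_real (Mt r \<omega>))"
      by (rule bounded_mult_M_integrable[OF rt(1) _ W(2)]) measurable
  qed
  finally show ?thesis .
qed

text \<open>A bounded continuous version of the drift \<open>mc / M\<close>, exact on \<open>M \<ge> e\<close>.\<close>

definition drift_trunc :: "real \<Rightarrow> nat \<Rightarrow> real \<Rightarrow> real" where
  "drift_trunc e k x = mc k * max (ma k + mc k * x) 0 / (max (ma k + mc k * x) e)\<^sup>2"

text \<open>The defect in the relation drift times M = coefficient of M; for positive
  \<open>e\<close> it vanishes wherever M is at least \<open>e\<close>.\<close>

definition drift_resid :: "real \<Rightarrow> nat \<Rightarrow> real \<Rightarrow> real" where
  "drift_resid e k x = mc k - drift_trunc e k x * (ma k + mc k * x)"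

abbreviation mc_max :: real where "mc_max \<equiv> 1 / (2 * (b - a))"

lemma drift_trunc_continuous: "0 < e \<Longrightarrow> continuous_on UNIV (drift_trunc e k)"
  unfolding drift_trunc_def[abs_def] by (intro continuous_intros) (auto simp: max_def)

lemma drift_trunc_measurable [measurable]: "drift_trunc e k \<in> borel_measurable borel"
  unfolding drift_trunc_def[abs_def] by measurable

lemma drift_resid_measurable [measurable]: "drift_resid e k \<in> borel_measurable borel"
  unfolding drift_resid_def[abs_def] by measurable

lemma drift_trunc_bound:
  assumes e: "0 < e" shows "\<bar>drift_trunc e k x\<bar> \<le> mc_max / e"
proof -
  define y where "y = ma k + mc k * x"
  have p: "0 < max y e" using e by auto
  have "max y 0 / (max y e)\<^sup>2 \<le> max y e / (max y e)\<^sup>2" using e by (intro divide_right_mono) auto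
  also have "\<dots> = 1 / max y e" using p by (simp add: power2_eq_square)
  also have "\<dots> \<le> 1 / e" using e by (intro divide_left_mono) auto
  finally have "\<bar>mc k\<bar> * (max y 0 / (max y e)\<^sup>2) \<le> mc_max * (1 / e)"
    using mc_bound ab by (intro mult_mono) auto
  then show ?thesis by (simp add: drift_trunc_def y_def abs_mult)
qed

text \<open>The true drift is a majorant for all its truncations, which lets \<open>e\<close> tend
  to 0 inside the time integral. At M = 0 both sides are 0 by the convention on division.\<close>

lemma drift_trunc_le: 
  assumes e: "0 < e" and y: "0 \<le> ma k + mc k * x"
  shows "\<bar>drift_trunc e k x\<bar> \<le> \<bar>mc k / (ma k + mc k * x)\<bar>"
proof -
  define y' where "y' = ma k + mc k * x"
  have y0: "0 \<le> y'" using y by (simp add: y'_def)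
  have "y' / (max y' e)\<^sup>2 \<le> 1 / y'"
  proof (cases "y' = 0")
    case False
    then have "y' * y' \<le> (max y' e)\<^sup>2" "0 < y'" "0 < (max y' e)\<^sup>2"
      using y0 e by (auto simp: power2_eq_square intro!: mult_mono)
    then show ?thesis by (simp add: field_simps)
  qed simp
  then have "\<bar>mc k\<bar> * (y' / (max y' e)\<^sup>2) \<le> \<bar>mc k\<bar> * (1 / y')" by (intro mult_left_mono) auto
  then show ?thesis using y0 by (simp add: drift_trunc_def y'_def[symmetric] abs_mult max_absorb1)
qed

lemma drift_trunc_tendsto:
  assumes y: "0 \<le> ma k + mc k * x"
  shows "(\<lambda>n. drift_trunc (1 / real (Suc n)) k x) \<longlonglongrightarrow> mc k / (ma k + mc k * x)"
proof (cases "ma k + mc k * x = 0")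
  case True then show ?thesis by (simp add: drift_trunc_def)
next
  case False
  define y' where "y' = ma k + mc k * x"
  have p: "0 < y'" using False y by (simp add: y'_def)
  have "\<forall>\<^sub>F n in sequentially. 1 / real (Suc n) < y'"
    using order_tendstoD(2)[OF LIMSEQ_inverse_real_of_nat p] by (simp add: inverse_eq_divide)
  then have "\<forall>\<^sub>F n in sequentially. mc k / y' = drift_trunc (1 / real (Suc n)) k x"
    by eventually_elim (use p in \<open>simp add: drift_trunc_def y'_def[symmetric] max_absorb1 power2_eq_square\<close>)
  then show ?thesis unfolding y'_def[symmetric] by (rule Lim_transform_eventually[OF tendsto_const])
qed

text \<open>With y the value of M, the residual is the slope times 1 - y^2 / (max y e)^2, a factor
  in [0, 1]. Hence the bound is uniform in \<open>e\<close>, although the one for the truncated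
  drift blows up.\<close>

lemma drift_resid_bound:
  assumes e: "0 < e" and y: "0 \<le> ma k + mc k * x"
  shows "\<bar>drift_resid e k x\<bar> \<le> mc_max"
proof -
  define y' where "y' = ma k + mc k * x"
  have y0: "0 \<le> y'" using y by (simp add: y'_def)
  have "y' * y' \<le> (max y' e)\<^sup>2" "0 < (max y' e)\<^sup>2"
    using y0 e by (auto simp: power2_eq_square intro!: mult_mono)
  then have "0 \<le> y' * y' / (max y' e)\<^sup>2" "y' * y' / (max y' e)\<^sup>2 \<le> 1" by (auto simp: divide_le_eq)
  then have "\<bar>1 - y' * y' / (max y' e)\<^sup>2\<bar> \<le> 1" by linarith
  then have "\<bar>mc k\<bar> * \<bar>1 - y' * y' / (max y' e)\<^sup>2\<bar> \<le> mc_max * 1"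
    using mc_bound ab by (intro mult_mono) auto
  moreover have "drift_resid e k x = mc k * (1 - y' * y' / (max y' e)\<^sup>2)"
    unfolding drift_resid_def drift_trunc_def y'_def[symmetric] using y0 by (simp add: max_absorb1 algebra_simps)
  ultimately show ?thesis by (simp add: abs_mult)
qed

text \<open>At a zero of M with nonzero slope the residual equals the slope for every
  \<open>e\<close>; the second hypothesis excludes exactly this case.\<close>

lemma drift_resid_tendsto:
  assumes y: "0 \<le> ma k + mc k * x" and n: "mc k = 0 \<or> ma k + mc k * x \<noteq> 0"
  shows "(\<lambda>n. drift_resid (1 / real (Suc n)) k x) \<longlonglongrightarrow> 0"
proof (cases "mc k = 0")
  case True then show ?thesis by (simp add: drift_resid_def drift_trunc_def)
next
  case False
  have "(\<lambda>n. drift_resid (1 / real (Suc n)) k x) \<longlonglongrightarrow> mc k - mc k / (ma k + mc k * x) * (ma k + mc k * x)"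
    unfolding drift_resid_def by (intro tendsto_intros drift_trunc_tendsto[OF y])
  then show ?thesis using n False by auto
qed

lemma state_M:
  assumes "\<omega> \<in> path_space" "0 < r"
  shows "ma (lphase r \<omega>) + mc (lphase r \<omega>) * \<omega> r = Mt r \<omega>"
  using pval_eq_lphase[OF assms glued_M] by simp

lemma state_M_nonneg:
  assumes "\<omega> \<in> path_space" "0 < r"
  shows "0 \<le> ma (lphase r \<omega>) + mc (lphase r \<omega>) * \<omega> r"
  unfolding state_M[OF assms] using M_nonneg assms by simp

end

section \<open>The Girsanov estimate\<close>

context downcross
begin

lemma measurable_lift_joint:
  assumes "f \<in> borel_measurable (borel \<Otimes>\<^sub>M F t)"
  shows "f \<in> borel_measurable (lborel \<Otimes>\<^sub>M P)"
proof -
  have "(\<lambda>\<omega>. \<omega>) \<in> measurable P (F t)"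
    using subalgebra_P[of t] by (auto intro!: measurableI simp: subalgebra_def)
  then have "(\<lambda>p. (fst p, snd p)) \<in> measurable (lborel \<Otimes>\<^sub>M P) (borel \<Otimes>\<^sub>M F t)"
    by (intro measurable_Pair measurable_compose[OF measurable_snd]) auto
  from measurable_compose[OF this assms] show ?thesis by simp
qed

lemma residual_measurable:
  assumes st: "0 \<le> s" "s \<le> t"
  shows "(\<lambda>r. indicator {s<..t} r * (\<integral>\<omega>. \<bar>state (drift_resid e) r \<omega>\<bar> \<partial>P)) \<in> borel_measurable lborel"
proof -
  have t0: "0 \<le> t" using st by simp
  have "(\<lambda>p. \<bar>indicator {s..t} (fst p) * state (drift_resid e) (fst p) (snd p)\<bar>) \<in> borel_measurable (lborel \<Otimes>\<^sub>M P)"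
    by (rule borel_measurable_abs[OF measurable_lift_joint[OF state_joint_measurable[OF t0 st(1) drift_resid_measurable]]])
  then have "(\<lambda>r. \<integral>\<omega>. \<bar>indicator {s..t} r * state (drift_resid e) r \<omega>\<bar> \<partial>P) \<in> borel_measurable lborel"
    by (intro borel_measurable_lebesgue_integral) (simp add: case_prod_beta')
  then have "(\<lambda>r. indicator {s<..t} r * (\<integral>\<omega>. \<bar>indicator {s..t} r * state (drift_resid e) r \<omega>\<bar> \<partial>P)) \<in> borel_measurable lborel"
    by measurable
  moreover have "indicator {s<..t} r * (\<integral>\<omega>. \<bar>indicator {s..t} r * state (drift_resid e) r \<omega>\<bar> \<partial>P) =
      indicator {s<..t} r * (\<integral>\<omega>. \<bar>state (drift_resid e) r \<omega>\<bar> \<partial>P)" for r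
    by (simp add: indicator_def)
  ultimately show ?thesis by simp
qed

lemma residual_bound:
  assumes e: "0 < e" and r: "0 < r"
  shows "integrable P (\<lambda>\<omega>. \<bar>state (drift_resid e) r \<omega>\<bar>)" "(\<integral>\<omega>. \<bar>state (drift_resid e) r \<omega>\<bar> \<partial>P) \<le> mc_max"
proof -
  have b: "AE \<omega> in P. \<bar>state (drift_resid e) r \<omega>\<bar> \<le> mc_max"
    using drift_resid_bound[OF e state_M_nonneg] r by (intro AE_I2) simp
  have m: "(\<lambda>\<omega>. \<bar>state (drift_resid e) r \<omega>\<bar>) \<in> borel_measurable P"
    by (rule borel_measurable_abs[OF measurable_from_subalg[OF subalgebra_P lphase_fun_measurable[OF less_imp_le[OF r] drift_resid_measurable]]])
  show i: "integrable P (\<lambda>\<omega>. \<bar>state (drift_resid e) r \<omega>\<bar>)"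
    by (rule integrable_const_bound[of _ mc_max]) (use b m in simp_all)
  show "(\<integral>\<omega>. \<bar>state (drift_resid e) r \<omega>\<bar> \<partial>P) \<le> mc_max" by (rule integral_le_const[OF i b])
qed

text \<open>With the exact drift in \<open>V\<close>, the difference on the left would be zero. For
  a trial drift it is written by \<open>phase_factor_ftc\<close> as a time integral whose integrand
  at r has conditional expectation proportional to coefficient minus drift times M, that is, to the
  residual. \<open>V\<close> has modulus 1, so the residual enters through its absolute value
  alone.\<close>

lemma girsanov_estimate:
  fixes l :: real
  assumes st: "0 \<le> s" "s \<le> t" and A: "A \<in> sets (F s)" and e: "0 < e"
  defines "V \<equiv> \<lambda>r \<omega>. iexp (- l * integral {s..r} (\<lambda>q. state (drift_trunc e) q \<omega>))"
  shows "norm ((CLINT \<omega>|P. indicator A \<omega> * iexp (l * (\<omega> t - \<omega> s)) * V t \<omega> * Mt t \<omega>) -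
      complex_of_real (exp (- (l\<^sup>2 * (t - s) / 2))) * (CLINT \<omega>|P. indicator A \<omega> * complex_of_real (Mt s \<omega>))) \<le>
    \<bar>l\<bar> * (\<integral>r. indicator {s<..t} r * (\<integral>\<omega>. \<bar>state (drift_resid e) r \<omega>\<bar> \<partial>P) \<partial>lborel)"
proof -
  have t0: "0 \<le> t" using st by simp
  let ?R = "mc_max / e" and ?K = "mc_max * (t - s)"
  have mb0: "0 < mc_max" using ab by simp
  have R0: "0 \<le> ?R" using mb0 e by simp
  have K0: "0 \<le> ?K" using mb0 st by (intro mult_nonneg_nonneg) auto
  have \<xi>m: "\<And>k. mc_at k \<in> borel_measurable borel" by simp
  have \<rho>m: "\<And>k. drift_trunc e k \<in> borel_measurable borel" by (rule drift_trunc_measurable)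
  have \<rho>b: "\<And>k x. \<bar>drift_trunc e k x\<bar> \<le> ?R" by (rule drift_trunc_bound[OF e])
  have AP: "A \<in> sets P" using A subalgebra_P[of s] by (auto simp: subalgebra_def)
  note [measurable] = AP coord_measurable_P[OF st(1)] coord_measurable_P[OF t0] pval_measurable_P[OF t0 glued_M]
  define Ea where "Ea \<omega> = indicator A \<omega> * iexp (l * (\<omega> t - \<omega> s))" for \<omega> :: "real \<Rightarrow> real"
  have Eam[measurable]: "Ea \<in> borel_measurable P" unfolding Ea_def[abs_def] by measurable
  have Eab: "norm (Ea \<omega>) \<le> 1" for \<omega> by (simp add: Ea_def norm_mult indicator_def)
  define J where "J r \<omega> = integral {s..t} (\<lambda>q. state mc_at q \<omega>) - integral {s..r} (\<lambda>q. state mc_at q \<omega>)" for r \<omega>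
  have J_eq: "J r \<omega> = integral {r..t} (\<lambda>q. state mc_at q \<omega>)" if "\<omega> \<in> path_space" "s \<le> r" "r \<le> t" for r \<omega>
  proof -
    have "(\<lambda>q. state mc_at q \<omega>) integrable_on {s..t}" by (rule state_integrable(2)[OF that(1) st(1) \<xi>m mc_bound])
    from Henstock_Kurzweil_Integration.integral_combine[OF that(2,3) this] show ?thesis by (simp add: J_def)
  qed
  have Jb: "\<bar>J r \<omega>\<bar> \<le> ?K" if "\<omega> \<in> path_space" "s \<le> r" "r \<le> t" for r \<omega>
  proof -
    have "\<bar>J r \<omega>\<bar> \<le> mc_max * (t - r)" unfolding J_eq[OF that]
      by (rule step_integral_bound[OF mc_bound that(3,1)])
    also have "\<dots> \<le> ?K" using that mb0 by (intro mult_left_mono) auto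
    finally show ?thesis .
  qed
  define g where "g r \<omega> = V r \<omega> * (- \<i> * l * state (drift_trunc e) r \<omega> * (Mt t \<omega> - \<i> * l * J r \<omega>) + \<i> * l * state mc_at r \<omega>)" for r \<omega>
  \<comment> \<open>The half-open interval omits r = s, in particular r = 0, where the left phase
    need not describe M.\<close>
  define f where "f r \<omega> = indicator {s<..t} r *\<^sub>R (Ea \<omega> * g r \<omega>)" for r \<omega>
  \<comment> \<open>A majorant uniform in r and affine in the absolute value of M at time t, hence
    integrable; it justifies Fubini on the bounded time interval.\<close>
  let ?B = "\<lambda>\<omega>. \<bar>l\<bar> * ?R * (\<bar>Mt t \<omega>\<bar> + \<bar>l\<bar> * ?K) + \<bar>l\<bar> * mc_max"
  have gb: "norm (g r \<omega>) \<le> ?B \<omega>" if "\<omega> \<in> path_space" "s \<le> r" "r \<le> t" for r \<omega>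
  proof -
    have "norm (complex_of_real (Mt t \<omega>) - \<i> * l * J r \<omega>) \<le> norm (complex_of_real (Mt t \<omega>)) + norm (\<i> * l * J r \<omega>)"
      by (rule norm_triangle_ineq4)
    also have "\<dots> = \<bar>Mt t \<omega>\<bar> + \<bar>l\<bar> * \<bar>J r \<omega>\<bar>" by (simp add: norm_mult)
    also have "\<dots> \<le> \<bar>Mt t \<omega>\<bar> + \<bar>l\<bar> * ?K" using Jb[OF that] by (intro add_left_mono mult_left_mono) auto
    finally have 1: "norm (complex_of_real (Mt t \<omega>) - \<i> * l * J r \<omega>) \<le> \<bar>Mt t \<omega>\<bar> + \<bar>l\<bar> * ?K" .
    have "norm (g r \<omega>) = norm (- \<i> * l * state (drift_trunc e) r \<omega> * (Mt t \<omega> - \<i> * l * J r \<omega>) + \<i> * l * state mc_at r \<omega>)"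
      by (simp add: g_def V_def norm_mult)
    also have "\<dots> \<le> norm (- \<i> * l * state (drift_trunc e) r \<omega> * (Mt t \<omega> - \<i> * l * J r \<omega>)) + norm (\<i> * l * state mc_at r \<omega>)"
      by (rule norm_triangle_ineq)
    also have "\<dots> = \<bar>l\<bar> * \<bar>state (drift_trunc e) r \<omega>\<bar> * norm (complex_of_real (Mt t \<omega>) - \<i> * l * J r \<omega>) + \<bar>l\<bar> * \<bar>state mc_at r \<omega>\<bar>"
      by (simp add: norm_mult)
    also have "\<dots> \<le> ?B \<omega>"
      using 1 \<rho>b mc_bound R0 by (intro add_mono mult_mono) auto
    finally show ?thesis .
  qed
  have fb: "norm (f r \<omega>) \<le> indicator {s<..t} r * ?B \<omega>" if "\<omega> \<in> path_space" for r \<omega>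
  proof (cases "r \<in> {s<..t}")
    case True
    then have "norm (Ea \<omega>) * norm (g r \<omega>) \<le> 1 * ?B \<omega>"
      using gb[OF that, of r] Eab by (intro mult_mono) auto
    then show ?thesis using True by (simp add: f_def norm_mult)
  qed (simp add: f_def)
  have fm: "(\<lambda>p. f (fst p) (snd p)) \<in> borel_measurable (lborel \<Otimes>\<^sub>M P)"
  proof -
    note [measurable] =
      measurable_lift_joint[OF state_joint_measurable[of t s "drift_trunc e", OF t0 st(1) \<rho>m]]
      measurable_lift_joint[OF state_joint_measurable[of t s mc_at, OF t0 st(1) \<xi>m]]
      measurable_lift_joint[OF state_integral_joint_measurable[of t s "drift_trunc e", OF t0 st(1) \<rho>m \<rho>b]]
      measurable_lift_joint[OF state_integral_joint_measurable[of t s mc_at, OF t0 st(1) \<xi>m mc_bound]]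
      measurable_from_subalg[OF subalgebra_P state_integral_measurable[of t s mc_at, OF t0 st(1) \<xi>m mc_bound]]
    let ?V = "\<lambda>p. iexp (- l * integral {s..min t (fst p)} (\<lambda>q. state (drift_trunc e) q (snd p)))"
    let ?J = "\<lambda>p. integral {s..t} (\<lambda>q. state mc_at q (snd p)) - integral {s..min t (fst p)} (\<lambda>q. state mc_at q (snd p))"
    have "(\<lambda>p. indicator {s<..t} (fst p) *\<^sub>R (Ea (snd p) * (?V p *
        (- \<i> * l * (indicator {s..t} (fst p) * state (drift_trunc e) (fst p) (snd p)) * (Mt t (snd p) - \<i> * l * ?J p)
         + \<i> * l * (indicator {s..t} (fst p) * state mc_at (fst p) (snd p)))))) \<in> borel_measurable (lborel \<Otimes>\<^sub>M P)"
      by measurable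
    moreover have "indicator {s<..t} (fst p) *\<^sub>R (Ea (snd p) * (?V p *
        (- \<i> * l * (indicator {s..t} (fst p) * state (drift_trunc e) (fst p) (snd p)) * (Mt t (snd p) - \<i> * l * ?J p)
         + \<i> * l * (indicator {s..t} (fst p) * state mc_at (fst p) (snd p))))) = f (fst p) (snd p)" for p
      by (auto simp: f_def g_def V_def J_def indicator_def min_absorb2)
    ultimately show ?thesis by simp
  qed
  have fm1: "(\<lambda>\<omega>. f r \<omega>) \<in> borel_measurable P" for r
    using measurable_compose[OF measurable_Pair1' fm, of r] by simp
  have fm2: "(\<lambda>r. f r \<omega>) \<in> borel_measurable lborel" if "\<omega> \<in> path_space" for \<omega>
    using measurable_compose[OF measurable_Pair2' fm, of \<omega>] that by simp
  have Bi: "integrable P ?B" using M_integrable[OF t0] by auto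
  have fi: "integrable P (f r)" for r
  proof (rule Bochner_Integration.integrable_bound)
    show "integrable P (\<lambda>\<omega>. indicator {s<..t} r * ?B \<omega>)" using Bi by (intro integrable_mult_right)
    show "AE \<omega> in P. norm (f r \<omega>) \<le> norm (indicator {s<..t} r * ?B \<omega>)"
      using fb by (intro AE_I2) (auto intro: order_trans[OF _ abs_ge_self])
  qed (rule fm1)
  interpret PL: pair_sigma_finite lborel P ..
  have ind_i: "integrable lborel (\<lambda>r. indicator {s<..t} r * c)" for c :: real
    using st by (intro integrable_mult_left integrable_real_indicator) (auto simp: emeasure_lborel_Ioc)
  have prod: "integrable (lborel \<Otimes>\<^sub>M P) (case_prod f)"
  proof (rule PL.Fubini_integrable)
    show "case_prod f \<in> borel_measurable (lborel \<Otimes>\<^sub>M P)" using fm by (simp add: case_prod_beta')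
    show "AE r in lborel. integrable P (\<lambda>\<omega>. case_prod f (r, \<omega>))" using fi by simp
    show "integrable lborel (\<lambda>r. \<integral>\<omega>. norm (case_prod f (r, \<omega>)) \<partial>P)"
    proof (rule Bochner_Integration.integrable_bound[OF ind_i[of "expectation ?B"]])
      show "(\<lambda>r. \<integral>\<omega>. norm (case_prod f (r, \<omega>)) \<partial>P) \<in> borel_measurable lborel"
        using fm by (intro borel_measurable_lebesgue_integral) (simp add: case_prod_beta')
      show "AE r in lborel. norm (\<integral>\<omega>. norm (case_prod f (r, \<omega>)) \<partial>P) \<le> norm (indicator {s<..t} r * expectation ?B)"
      proof (rule AE_I2)
        fix r
        have "(\<integral>\<omega>. norm (f r \<omega>) \<partial>P) \<le> (\<integral>\<omega>. indicator {s<..t} r * ?B \<omega> \<partial>P)"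
          using fb fi Bi by (intro integral_mono integrable_norm integrable_mult_right) auto
        also have "\<dots> = indicator {s<..t} r * expectation ?B" by (rule integral_mult_right_zero)
        finally show "norm (\<integral>\<omega>. norm (case_prod f (r, \<omega>)) \<partial>P) \<le> norm (indicator {s<..t} r * expectation ?B)" by simp
      qed
    qed
  qed
  have pathwise: "(\<integral>r. f r \<omega> \<partial>lborel) = Ea \<omega> * (V t \<omega> * Mt t \<omega> - (Mt t \<omega> - \<i> * l * integral {s..t} (\<lambda>q. state mc_at q \<omega>)))"
    if \<omega>: "\<omega> \<in> path_space" for \<omega>
  proof -
    obtain T where T: "finite T" "\<And>r h. 0 < r \<Longrightarrow> r < t \<Longrightarrow> r \<notin> T \<Longrightarrow> \<forall>k. continuous_on UNIV (h k :: real \<Rightarrow> real) \<Longrightarrow>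
      isCont (\<lambda>r. state h r \<omega>) r"
      using state_isCont[OF \<omega> t0] by metis
    have cont: "isCont (\<lambda>r. state (drift_trunc e) r \<omega>) r \<and> isCont (\<lambda>r. state mc_at r \<omega>) r" if "s < r" "r < t" "r \<notin> T" for r
      using T(2)[of r "drift_trunc e"] T(2)[of r mc_at] that st drift_trunc_continuous[OF e] by simp
    have hi: "((\<lambda>r. g r \<omega>) has_integral (V t \<omega> * Mt t \<omega> - (Mt t \<omega> - \<i> * l * integral {s..t} (\<lambda>q. state mc_at q \<omega>)))) {s..t}"
      using phase_factor_ftc[OF st(2) T(1) state_integrable(2)[OF \<omega> st(1) \<rho>m \<rho>b] state_integrable(2)[OF \<omega> st(1) \<xi>m mc_bound] cont, of l "complex_of_real (Mt t \<omega>)"]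
      unfolding g_def V_def J_def by simp
    then have hi2: "((\<lambda>r. Ea \<omega> * g r \<omega>) has_integral (Ea \<omega> * (V t \<omega> * Mt t \<omega> - (Mt t \<omega> - \<i> * l * integral {s..t} (\<lambda>q. state mc_at q \<omega>))))) {s<..t}"
    proof -
      have "negligible {x \<in> {s..t} - {s<..t}. g x \<omega> \<noteq> 0}" by (rule negligible_subset[of "{s}"]) auto
      moreover have "negligible {x \<in> {s<..t} - {s..t}. g x \<omega> \<noteq> 0}" by (rule negligible_subset[of "{}"]) auto
      ultimately show ?thesis by (intro has_integral_mult_right has_integral_spike_set_eq[THEN iffD1, OF _ _ hi])
    qed
    have "set_integrable lborel {s<..t} (\<lambda>r. Ea \<omega> * g r \<omega>)"
      unfolding set_integrable_def
    proof (rule Bochner_Integration.integrable_bound[OF ind_i[of "?B \<omega>"]])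
      show "(\<lambda>r. indicator {s<..t} r *\<^sub>R (Ea \<omega> * g r \<omega>)) \<in> borel_measurable lborel"
        using fm2[OF \<omega>] unfolding f_def .
      show "AE r in lborel. norm (indicator {s<..t} r *\<^sub>R (Ea \<omega> * g r \<omega>)) \<le> norm (indicator {s<..t} r * ?B \<omega>)"
        using fb[OF \<omega>] unfolding f_def real_norm_def
        by (intro AE_I2) (rule order_trans[OF _ abs_ge_self], blast)
    qed
    from set_borel_integral_eq_integral(2)[OF this] integral_unique[OF hi2]
    show ?thesis unfolding f_def set_lebesgue_integral_def by simp
  qed
  \<comment> \<open>For fixed r all factors known at time r are gathered in \<open>W\<close>. The
    remaining increment is averaged by \<open>tilted_martingale\<close> in the term containing M and
    by \<open>freeze_iexp\<close> in the other; both yield the same Gaussian factor, leaving the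
    residual.\<close>
  have inner: "norm (\<integral>\<omega>. f r \<omega> \<partial>P) \<le> \<bar>l\<bar> * (indicator {s<..t} r * (\<integral>\<omega>. \<bar>state (drift_resid e) r \<omega>\<bar> \<partial>P))" for r
  proof (cases "r \<in> {s<..t}")
    case True
    then have r: "s \<le> r" "r \<le> t" "0 < r" "0 \<le> r" using st by auto
    define W where "W \<omega> = indicator A \<omega> * iexp (l * (\<omega> r - \<omega> s)) * V r \<omega>" for \<omega>
    have [measurable]: "A \<in> sets (F r)" using A subalgebra_path_filtration[OF r(1)] by (auto simp: subalgebra_def)
    note [measurable] = coord_measurable_filtration[OF st(1) r(1)] coord_measurable_filtration[OF r(4) order_refl]
      state_integral_measurable[of r s "drift_trunc e", OF r(4) st(1) \<rho>m \<rho>b]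
      lphase_fun_measurable[of r "drift_trunc e", OF r(4) \<rho>m] lphase_fun_measurable[of r mc_at, OF r(4) \<xi>m]
      lphase_fun_measurable[of r "drift_resid e", OF r(4) drift_resid_measurable]
    have Wm[measurable]: "W \<in> borel_measurable (F r)" unfolding W_def[abs_def] V_def by measurable
    have Wb: "norm (W \<omega>) \<le> 1" for \<omega> by (simp add: W_def V_def norm_mult indicator_def)
    let ?\<rho> = "\<lambda>\<omega>. state (drift_trunc e) r \<omega>" and ?\<xi> = "\<lambda>\<omega>. state mc_at r \<omega>"
    let ?ex = "complex_of_real (exp (- (l\<^sup>2 * (t - r) / 2)))"
    have W\<rho>m: "(\<lambda>\<omega>. W \<omega> * ?\<rho> \<omega>) \<in> borel_measurable (F r)" by measurable
    have W\<rho>b: "norm (W \<omega> * ?\<rho> \<omega>) \<le> ?R" for \<omega>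
      unfolding norm_mult using mult_mono[OF Wb[of \<omega>], of "\<bar>?\<rho> \<omega>\<bar>" ?R] \<rho>b by simp
    have W\<xi>m: "(\<lambda>\<omega>. W \<omega> * ?\<xi> \<omega>) \<in> borel_measurable (F r)" by measurable
    have W\<xi>b: "norm (W \<omega> * ?\<xi> \<omega>) \<le> mc_max" for \<omega>
      unfolding norm_mult using mult_mono[OF Wb[of \<omega>], of "\<bar>?\<xi> \<omega>\<bar>" mc_max] mc_bound by simp
    have W\<xi>i: "integrable P (\<lambda>\<omega>. W \<omega> * ?\<xi> \<omega>)"
      using W\<xi>b measurable_from_subalg[OF subalgebra_P W\<xi>m] by (intro integrable_const_bound[of _ mc_max]) auto
    define X1 where "X1 \<omega> = (W \<omega> * ?\<rho> \<omega>) * iexp (l * (\<omega> t - \<omega> r)) * (Mt t \<omega> - \<i> * l * integral {r..t} (\<lambda>q. state mc_at q \<omega>))" for \<omega>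
    define X2 where "X2 \<omega> = (W \<omega> * ?\<xi> \<omega>) * iexp (l * (\<omega> t - \<omega> r))" for \<omega>
    have X2i: "integrable P X2"
      unfolding X2_def
    proof (rule integrable_const_bound[of _ mc_max])
      show "AE \<omega> in P. norm (W \<omega> * ?\<xi> \<omega> * iexp (l * (\<omega> t - \<omega> r))) \<le> mc_max"
        using W\<xi>b by (intro AE_I2) (simp add: norm_mult)
      note [measurable] = measurable_from_subalg[OF subalgebra_P W\<xi>m] coord_measurable_P[OF r(4)]
      show "(\<lambda>\<omega>. W \<omega> * ?\<xi> \<omega> * iexp (l * (\<omega> t - \<omega> r))) \<in> borel_measurable P" by measurable
    qed
    have split: "f r \<omega> = - \<i> * l * X1 \<omega> + \<i> * l * X2 \<omega>" if "\<omega> \<in> path_space" for \<omega>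
    proof -
      have "iexp (l * (\<omega> t - \<omega> s)) = iexp (l * (\<omega> r - \<omega> s)) * iexp (l * (\<omega> t - \<omega> r))"
        unfolding exp_add[symmetric] by (simp add: algebra_simps)
      then show ?thesis
        using True unfolding f_def g_def J_eq[OF that r(1,2)] X1_def X2_def W_def Ea_def by (simp add: algebra_simps)
    qed
    \<comment> \<open>Integrability is inherited from \<open>f r\<close> and \<open>X2\<close>
      through \<open>split\<close>; the factor \<open>l\<close> stays attached because it may be
      0.\<close>
    have lX1i: "integrable P (\<lambda>\<omega>. \<i> * l * X1 \<omega>)"
    proof -
      have "integrable P (\<lambda>\<omega>. \<i> * l * X2 \<omega> - f r \<omega>)"
        using X2i fi by (intro Bochner_Integration.integrable_diff integrable_mult_right) auto
      moreover have "integrable P (\<lambda>\<omega>. \<i> * l * X2 \<omega> - f r \<omega>) \<longleftrightarrow> integrable P (\<lambda>\<omega>. \<i> * l * X1 \<omega>)"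
        by (intro Bochner_Integration.integrable_cong) (auto simp: split)
      ultimately show ?thesis by simp
    qed
    have "(\<integral>\<omega>. f r \<omega> \<partial>P) = (\<integral>\<omega>. \<i> * l * X2 \<omega> - \<i> * l * X1 \<omega> \<partial>P)"
      by (intro Bochner_Integration.integral_cong) (auto simp: split)
    also have "\<dots> = \<i> * l * (\<integral>\<omega>. X2 \<omega> \<partial>P) - \<i> * l * (\<integral>\<omega>. X1 \<omega> \<partial>P)"
      using X2i lX1i by (subst Bochner_Integration.integral_diff) (simp_all add: integral_mult_right_zero)
    also have "(\<integral>\<omega>. X2 \<omega> \<partial>P) = ?ex * (CLINT \<omega>|P. W \<omega> * ?\<xi> \<omega>)"
      unfolding X2_def by (rule freeze_iexp[OF r(4,2) W\<xi>m W\<xi>i])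
    also have "(\<integral>\<omega>. X1 \<omega> \<partial>P) = ?ex * (CLINT \<omega>|P. (W \<omega> * ?\<rho> \<omega>) * Mt r \<omega>)"
      unfolding X1_def by (rule tilted_martingale[OF r(4,2) W\<rho>m W\<rho>b])
    also have "\<i> * l * (?ex * (CLINT \<omega>|P. W \<omega> * ?\<xi> \<omega>)) - \<i> * l * (?ex * (CLINT \<omega>|P. (W \<omega> * ?\<rho> \<omega>) * Mt r \<omega>)) =
       \<i> * l * ?ex * (CLINT \<omega>|P. W \<omega> * ?\<xi> \<omega> - (W \<omega> * ?\<rho> \<omega>) * Mt r \<omega>)"
      using W\<xi>i bounded_mult_M_integrable[OF r(4) measurable_from_subalg[OF subalgebra_P W\<rho>m] W\<rho>b]
      by (subst Bochner_Integration.integral_diff) (simp_all add: right_diff_distrib mult.assoc)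
    also have "(CLINT \<omega>|P. W \<omega> * ?\<xi> \<omega> - (W \<omega> * ?\<rho> \<omega>) * Mt r \<omega>) = (CLINT \<omega>|P. W \<omega> * state (drift_resid e) r \<omega>)"
    proof (intro Bochner_Integration.integral_cong refl)
      fix \<omega> assume "\<omega> \<in> space P"
      then have "state (drift_resid e) r \<omega> = ?\<xi> \<omega> - ?\<rho> \<omega> * Mt r \<omega>"
        using state_M[of \<omega> r] r by (simp add: drift_resid_def)
      then show "W \<omega> * ?\<xi> \<omega> - (W \<omega> * ?\<rho> \<omega>) * Mt r \<omega> = W \<omega> * state (drift_resid e) r \<omega>"
        by (simp add: right_diff_distrib mult.assoc)
    qed
    finally have eq: "(\<integral>\<omega>. f r \<omega> \<partial>P) = \<i> * l * ?ex * (CLINT \<omega>|P. W \<omega> * state (drift_resid e) r \<omega>)" .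
    note ri = residual_bound(1)[OF e r(3)]
    have "norm (CLINT \<omega>|P. W \<omega> * state (drift_resid e) r \<omega>) \<le> (\<integral>\<omega>. \<bar>state (drift_resid e) r \<omega>\<bar> \<partial>P)"
    proof (rule order_trans[OF integral_norm_bound], rule integral_mono_AE')
      show "AE \<omega> in P. norm (W \<omega> * state (drift_resid e) r \<omega>) \<le> \<bar>state (drift_resid e) r \<omega>\<bar>"
        using Wb by (intro AE_I2) (simp add: norm_mult mult_left_le_one_le)
    qed (use ri in auto)
    then have "\<bar>l\<bar> * exp (- (l\<^sup>2 * (t - r) / 2)) * norm (CLINT \<omega>|P. W \<omega> * state (drift_resid e) r \<omega>) \<le>
        \<bar>l\<bar> * 1 * (\<integral>\<omega>. \<bar>state (drift_resid e) r \<omega>\<bar> \<partial>P)"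
      using r by (intro mult_mono) auto
    then show ?thesis unfolding eq using True by (simp add: norm_mult)
  qed (simp add: f_def)
  have res_i: "integrable lborel (\<lambda>r. indicator {s<..t} r * (\<integral>\<omega>. \<bar>state (drift_resid e) r \<omega>\<bar> \<partial>P))"
  proof (rule Bochner_Integration.integrable_bound[OF ind_i[of mc_max] residual_measurable[OF st]])
    show "AE r in lborel. norm (indicator {s<..t} r * (\<integral>\<omega>. \<bar>state (drift_resid e) r \<omega>\<bar> \<partial>P)) \<le> norm (indicator {s<..t} r * mc_max)"
    proof (rule AE_I2)
      fix r
      have "(\<integral>\<omega>. \<bar>state (drift_resid e) r \<omega>\<bar> \<partial>P) \<le> mc_max" if "r \<in> {s<..t}"
        using residual_bound(2)[OF e, of r] that st by simp
      then show "norm (indicator {s<..t} r * (\<integral>\<omega>. \<bar>state (drift_resid e) r \<omega>\<bar> \<partial>P)) \<le> norm (indicator {s<..t} r * mc_max)"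
        using mb0 by (auto simp: indicator_def)
    qed
  qed
  have fub: "(\<integral>\<omega>. (\<integral>r. f r \<omega> \<partial>lborel) \<partial>P) = (\<integral>r. (\<integral>\<omega>. f r \<omega> \<partial>P) \<partial>lborel)"
    by (rule PL.Fubini_integral[OF prod])
  have EVi: "integrable P (\<lambda>\<omega>. (Ea \<omega> * V t \<omega>) * Mt t \<omega>)"
  proof (rule bounded_mult_M_integrable[OF t0])
    show "norm (Ea \<omega> * V t \<omega>) \<le> 1" for \<omega> using Eab by (simp add: V_def norm_mult)
    note [measurable] = measurable_from_subalg[OF subalgebra_P state_integral_measurable[of t s "drift_trunc e", OF t0 st(1) \<rho>m \<rho>b]]
    show "(\<lambda>\<omega>. Ea \<omega> * V t \<omega>) \<in> borel_measurable P" unfolding V_def by measurable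
  qed
  have EMi: "integrable P (\<lambda>\<omega>. Ea \<omega> * (Mt t \<omega> - \<i> * l * integral {s..t} (\<lambda>q. state mc_at q \<omega>)))"
  proof -
    have "integrable P (\<lambda>\<omega>. (Ea \<omega> * V t \<omega>) * Mt t \<omega> - (\<integral>r. f r \<omega> \<partial>lborel))"
      using PL.integrable_snd[OF prod] EVi by (intro Bochner_Integration.integrable_diff) auto
    moreover have "integrable P (\<lambda>\<omega>. (Ea \<omega> * V t \<omega>) * Mt t \<omega> - (\<integral>r. f r \<omega> \<partial>lborel)) \<longleftrightarrow>
      integrable P (\<lambda>\<omega>. Ea \<omega> * (Mt t \<omega> - \<i> * l * integral {s..t} (\<lambda>q. state mc_at q \<omega>)))"
      by (intro Bochner_Integration.integrable_cong) (auto simp: pathwise algebra_simps)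
    ultimately show ?thesis by simp
  qed
  have "(\<integral>\<omega>. (\<integral>r. f r \<omega> \<partial>lborel) \<partial>P) =
    (\<integral>\<omega>. (Ea \<omega> * V t \<omega>) * Mt t \<omega> - Ea \<omega> * (Mt t \<omega> - \<i> * l * integral {s..t} (\<lambda>q. state mc_at q \<omega>)) \<partial>P)"
    by (intro Bochner_Integration.integral_cong) (auto simp: pathwise algebra_simps)
  also have "\<dots> = (\<integral>\<omega>. (Ea \<omega> * V t \<omega>) * Mt t \<omega> \<partial>P) - (\<integral>\<omega>. Ea \<omega> * (Mt t \<omega> - \<i> * l * integral {s..t} (\<lambda>q. state mc_at q \<omega>)) \<partial>P)"
    by (rule Bochner_Integration.integral_diff[OF EVi EMi])
  also have "(\<integral>\<omega>. Ea \<omega> * (Mt t \<omega> - \<i> * l * integral {s..t} (\<lambda>q. state mc_at q \<omega>)) \<partial>P) =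
      complex_of_real (exp (- (l\<^sup>2 * (t - s) / 2))) * (CLINT \<omega>|P. indicator A \<omega> * complex_of_real (Mt s \<omega>))"
    unfolding Ea_def
    by (rule tilted_martingale[OF st, of _ 1]) (use A in \<open>auto simp: indicator_def\<close>)
  finally have "(\<integral>r. (\<integral>\<omega>. f r \<omega> \<partial>P) \<partial>lborel) = (\<integral>\<omega>. (Ea \<omega> * V t \<omega>) * Mt t \<omega> \<partial>P) -
      complex_of_real (exp (- (l\<^sup>2 * (t - s) / 2))) * (CLINT \<omega>|P. indicator A \<omega> * complex_of_real (Mt s \<omega>))"
    unfolding fub .
  then have "norm ((\<integral>\<omega>. (Ea \<omega> * V t \<omega>) * Mt t \<omega> \<partial>P) -
      complex_of_real (exp (- (l\<^sup>2 * (t - s) / 2))) * (CLINT \<omega>|P. indicator A \<omega> * complex_of_real (Mt s \<omega>))) = norm (\<integral>r. (\<integral>\<omega>. f r \<omega> \<partial>P) \<partial>lborel)"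
    by simp
  also have "\<dots> \<le> (\<integral>r. norm (\<integral>\<omega>. f r \<omega> \<partial>P) \<partial>lborel)" by (rule integral_norm_bound)
  also have "\<dots> \<le> (\<integral>r. \<bar>l\<bar> * (indicator {s<..t} r * (\<integral>\<omega>. \<bar>state (drift_resid e) r \<omega>\<bar> \<partial>P)) \<partial>lborel)"
    using res_i inner by (intro integral_mono_AE') auto
  also have "\<dots> = \<bar>l\<bar> * (\<integral>r. indicator {s<..t} r * (\<integral>\<omega>. \<bar>state (drift_resid e) r \<omega>\<bar> \<partial>P) \<partial>lborel)"
    by (rule integral_mult_right_zero)
  finally show ?thesis by (simp only: Ea_def)
qed

end

section \<open>Brownian motion under the penalised measure\<close>

context downcross
begin

text \<open>At a positive time M can vanish with nonzero slope only if the path takes one of the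
  countably many values - ma k / mc k, a null event. Dominated convergence with the constant
  \<open>mc_max\<close> is then applied first in the path and afterwards in time.\<close>

lemma residual_tendsto:
  assumes s: "0 \<le> s" "s \<le> t"
  shows "(\<lambda>n. \<integral>r. indicator {s<..t} r * (\<integral>\<omega>. \<bar>state (drift_resid (1 / real (Suc n))) r \<omega>\<bar> \<partial>P) \<partial>lborel) \<longlonglongrightarrow> 0"
proof -
  have mb0: "0 < mc_max" using ab by simp
  have t0: "0 \<le> t" using s by simp
  let ?e = "\<lambda>n. 1 / real (Suc n)"
  have rm: "(\<lambda>\<omega>. state (drift_resid (?e n)) r \<omega>) \<in> borel_measurable P" if "0 \<le> r" for n r
    by (rule measurable_from_subalg[OF subalgebra_P lphase_fun_measurable[OF that drift_resid_measurable]])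
  have rb: "\<bar>state (drift_resid (?e n)) r \<omega>\<bar> \<le> mc_max" if "0 < r" "\<omega> \<in> path_space" for n r \<omega>
    by (rule drift_resid_bound[OF _ state_M_nonneg[OF that(2,1)]]) simp
  have inner: "(\<lambda>n. \<integral>\<omega>. \<bar>state (drift_resid (?e n)) r \<omega>\<bar> \<partial>P) \<longlonglongrightarrow> 0" if r: "0 < r" for r
  proof -
    have "AE \<omega> in P. \<omega> r - \<omega> 0 \<noteq> - ma k / mc k" for k
      using gaussian_indep_null[OF prob_space_axioms subalgebra_P increment_gaussian[OF order_refl r], of "\<lambda>_. - ma k / mc k"] r by simp
    then have "AE \<omega> in P. \<forall>k. \<omega> r - \<omega> 0 \<noteq> - ma k / mc k" by (simp add: AE_all_countable)
    then have ae: "AE \<omega> in P. (\<lambda>n. \<bar>state (drift_resid (?e n)) r \<omega>\<bar>) \<longlonglongrightarrow> 0"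
      using start_zero AE_space
    proof eventually_elim
      fix \<omega> assume 1: "\<forall>k. \<omega> r - \<omega> 0 \<noteq> - ma k / mc k" and 2: "\<omega> 0 = 0" and 3: "\<omega> \<in> space P"
      let ?k = "lphase r \<omega>"
      have "mc ?k = 0 \<or> ma ?k + mc ?k * \<omega> r \<noteq> 0"
      proof (rule ccontr)
        assume "\<not> ?thesis"
        then have "mc ?k \<noteq> 0" "mc ?k * \<omega> r = - ma ?k" by auto
        then have "\<omega> r = - ma ?k / mc ?k" by (metis nonzero_mult_div_cancel_left)
        then show False using 1[rule_format, of ?k] unfolding 2 by simp
      qed
      then have "(\<lambda>n. state (drift_resid (?e n)) r \<omega>) \<longlonglongrightarrow> 0"
        using 3 by (intro drift_resid_tendsto state_M_nonneg r) auto
      then show "(\<lambda>n. \<bar>state (drift_resid (?e n)) r \<omega>\<bar>) \<longlonglongrightarrow> 0" by (rule tendsto_rabs_zero)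
    qed
    have "(\<lambda>n. \<integral>\<omega>. \<bar>state (drift_resid (?e n)) r \<omega>\<bar> \<partial>P) \<longlonglongrightarrow> (\<integral>\<omega>. 0 \<partial>P)"
    proof (rule integral_dominated_convergence[where w="\<lambda>_. mc_max", OF _ _ _ ae])
      show "AE \<omega> in P. norm \<bar>state (drift_resid (?e n)) r \<omega>\<bar> \<le> mc_max" for n
        using rb[OF r] by (intro AE_I2) simp
      show "(\<lambda>\<omega>. \<bar>state (drift_resid (?e n)) r \<omega>\<bar>) \<in> borel_measurable P" for n
        by (rule borel_measurable_abs[OF rm]) (use r in simp)
    qed auto
    then show ?thesis by simp
  qed
  have innb: "(\<integral>\<omega>. \<bar>state (drift_resid (?e n)) r \<omega>\<bar> \<partial>P) \<le> mc_max" if r: "0 < r" for n r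
    by (rule residual_bound(2)[OF _ r]) simp
  have "(\<lambda>n. \<integral>r. indicator {s<..t} r * (\<integral>\<omega>. \<bar>state (drift_resid (?e n)) r \<omega>\<bar> \<partial>P) \<partial>lborel) \<longlonglongrightarrow> (\<integral>r. 0 \<partial>(lborel :: real measure))"
  proof (rule integral_dominated_convergence[where w="\<lambda>r. indicator {s<..t} r * mc_max"])
    show "integrable lborel (\<lambda>r. indicator {s<..t} r * mc_max)"
      using s by (intro integrable_mult_left integrable_real_indicator) (auto simp: emeasure_lborel_Ioc)
    show "AE r in lborel. (\<lambda>n. indicator {s<..t} r * (\<integral>\<omega>. \<bar>state (drift_resid (?e n)) r \<omega>\<bar> \<partial>P)) \<longlonglongrightarrow> 0"
    proof (rule AE_I2)
      fix r show "(\<lambda>n. indicator {s<..t} r * (\<integral>\<omega>. \<bar>state (drift_resid (?e n)) r \<omega>\<bar> \<partial>P)) \<longlonglongrightarrow> 0"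
        using inner[of r] s by (cases "r \<in> {s<..t}") auto
    qed
    show "AE r in lborel. norm (indicator {s<..t} r * (\<integral>\<omega>. \<bar>state (drift_resid (?e n)) r \<omega>\<bar> \<partial>P)) \<le> indicator {s<..t} r * mc_max" for n
      using innb[of _ n] s by (intro AE_I2) (auto simp: indicator_def)
    show "(\<lambda>r. indicator {s<..t} r * (\<integral>\<omega>. \<bar>state (drift_resid (?e n)) r \<omega>\<bar> \<partial>P)) \<in> borel_measurable lborel" for n
      by (rule residual_measurable[OF s])
  qed auto
  then show ?thesis by simp
qed

text \<open>At a zero of M this is 0 by the convention on division, and it is also the limit of the
  truncations there.\<close>

definition drift_at :: "nat \<Rightarrow> real \<Rightarrow> real" where "drift_at k x = mc k / (ma k + mc k * x)"

lemma drift_at_measurable [measurable]: "drift_at k \<in> borel_measurable borel"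
  unfolding drift_at_def[abs_def] by measurable

text \<open>The common factor 2 (b - a) of slope and M cancels, and r < \<sigma> (2D + 1) says that
  the current phase is even.\<close>

lemma drift_down_eq:
  assumes \<omega>: "\<omega> \<in> path_space" and r: "0 \<le> r"
  shows "drift_down a b G r \<omega> = drift_at (phase r \<omega>) (\<omega> r)"
proof -
  let ?k = "phase r \<omega>"
  let ?D = "?k div 2"
  have d: "2 * (b - a) \<noteq> 0" using ab by simp
  have c: "(x / (2 * (b - a))) / (y / (2 * (b - a))) = x / y" for x y using d by simp
  have sw: "2 * b - \<omega> r - a = 2 * b - a - \<omega> r" by simp
  have lt: "ereal r < \<sigma> (2 * ?D + 1) \<omega> \<longleftrightarrow> even ?k"
  proof -
    have "?k \<le> 2 * ?D \<longleftrightarrow> even ?k" by (cases "even ?k") (auto elim!: evenE oddE)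
    then show ?thesis using phase_le_iff[OF \<omega>, of r "2 * ?D"] by simp
  qed
  show ?thesis
    unfolding drift_down_def downcrossings_eq[OF \<omega> r] Let_def lt not_less[symmetric] drift_at_def M_affine
    unfolding mc_def c sw by (auto simp: Delta_def Let_def diff_divide_distrib)
qed

text \<open>Phase and left phase disagree at finitely many times up to t, which the integral does
  not see; the right-hand side is measurable in the raw filtration.\<close>

lemma drift_integral_eq:
  assumes \<omega>: "\<omega> \<in> path_space" and t: "0 \<le> t"
  shows "(LBINT r:{0..t}. drift_down a b G r \<omega>) = (\<integral>r. indicator {0..t} r * state drift_at r \<omega> \<partial>lborel)"
proof -
  obtain T where T: "finite T" "\<And>r. 0 \<le> r \<Longrightarrow> r \<le> t \<Longrightarrow> r \<notin> T \<Longrightarrow> phase r \<omega> = lphase r \<omega>"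
    using state_isCont[OF \<omega> t] by metis
  show ?thesis
    unfolding set_lebesgue_integral_def
  proof (rule integral_discrete_difference[of T])
    show "countable T" using T(1) by (rule countable_finite)
    show "indicator {0..t} r *\<^sub>R drift_down a b G r \<omega> = indicator {0..t} r * state drift_at r \<omega>" if "r \<notin> T" for r
      using T(2)[of r] that drift_down_eq[OF \<omega>, of r] by (auto simp: indicator_def)
  qed auto
qed

definition driftless :: "real \<Rightarrow> (real \<Rightarrow> real) \<Rightarrow> real" where
  "driftless t \<omega> = \<omega> t - (LBINT r:{0..t}. drift_down a b G r \<omega>)"

lemma driftless_measurable:
  assumes t: "0 \<le> t"
  shows "driftless t \<in> borel_measurable (F t)"
proof -
  have "(\<lambda>x. indicator {0..t} (snd x) * state drift_at (snd x) (fst x)) \<in> borel_measurable (F t \<Otimes>\<^sub>M lborel)"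
    using measurable_compose[OF _ state_joint_measurable[OF t order_refl drift_at_measurable], of "\<lambda>x. (snd x, fst x)" "F t \<Otimes>\<^sub>M lborel"]
    by simp
  then have [measurable]: "(\<lambda>\<omega>. \<integral>r. indicator {0..t} r * state drift_at r \<omega> \<partial>lborel) \<in> borel_measurable (F t)"
    by (intro lborel.borel_measurable_lebesgue_integral) (simp add: case_prod_beta')
  have [measurable]: "(\<lambda>\<omega>. \<omega> t) \<in> borel_measurable (F t)" using t by (intro coord_measurable_filtration) auto
  have "(\<lambda>\<omega>. \<omega> t - (\<integral>r. indicator {0..t} r * state drift_at r \<omega> \<partial>lborel)) \<in> borel_measurable (F t)" by measurable
  then show ?thesis
    by (rule measurable_cong[THEN iffD1, rotated]) (simp add: driftless_def drift_integral_eq[OF _ t])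
qed

end

section \<open>The penalised measure as a change of density\<close>

locale penalised = downcross + Q: prob_space Q for Q :: "(real \<Rightarrow> real) measure" +
  assumes sets_Q: "sets Q = sets path_algebra"
    and Q_eq: "\<And>s A. 0 \<le> s \<Longrightarrow> A \<in> sets (path_filtration s) \<Longrightarrow>
      measure Q A = 1 / m0 * (\<integral>\<omega>. indicator A \<omega> * M_down a b G s \<omega> \<partial>P)"
begin

lemma space_Q: "space Q = path_space"
  using sets_eq_imp_space_eq[OF sets_Q] by simp

lemma subalgebra_Q: "subalgebra Q (F s)"
  using subalgebra_path_algebra[of s] by (simp add: subalgebra_def space_Q sets_Q)

lemma Q_eq_M:
  assumes s: "0 \<le> s" and A: "A \<in> sets (F s)"
  shows "measure Q A = 1 / m0 * (\<integral>\<omega>. indicator A \<omega> * Mt s \<omega> \<partial>P)"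
proof -
  have "(\<integral>\<omega>. indicator A \<omega> * M_down a b G s \<omega> \<partial>P) = (\<integral>\<omega>. indicator A \<omega> * Mt s \<omega> \<partial>P)"
    by (intro Bochner_Integration.integral_cong) (auto simp: M_down_eq s)
  then show ?thesis unfolding Q_eq[OF s A] by simp
qed

text \<open>The density refers to one \<open>F t\<close> at a time. Expectations under
  \<open>Q\<close> are therefore moved to \<open>P\<close> for functions measurable in some
  \<open>F t\<close>, with M taken at the same time.\<close>

lemma density_Q:
  assumes t: "0 \<le> t"
  shows "restr_to_subalg Q (F t) = density (restr_to_subalg P (F t)) (\<lambda>\<omega>. ennreal (Mt t \<omega> / m0))"
proof (rule measure_eqI)
  show "sets (restr_to_subalg Q (F t)) = sets (density (restr_to_subalg P (F t)) (\<lambda>\<omega>. ennreal (Mt t \<omega> / m0)))"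
    by (simp add: sets_restr_to_subalg[OF subalgebra_Q] sets_restr_to_subalg[OF subalgebra_P])
  fix A assume "A \<in> sets (restr_to_subalg Q (F t))"
  then have A[measurable]: "A \<in> sets (F t)" by (simp add: sets_restr_to_subalg[OF subalgebra_Q])
  have AP: "A \<in> sets P" using A subalgebra_P[of t] by (auto simp: subalgebra_def)
  have [measurable]: "Mt t \<in> borel_measurable (F t)" by (rule pval_measurable[OF t glued_M])
  have i: "integrable P (\<lambda>\<omega>. Mt t \<omega> / m0 * indicator A \<omega>)"
    using integrable_real_mult_indicator[OF AP integrable_divide[OF M_integrable[OF t]]] .
  have "emeasure (density (restr_to_subalg P (F t)) (\<lambda>\<omega>. ennreal (Mt t \<omega> / m0))) A =
      (\<integral>\<^sup>+\<omega>. ennreal (Mt t \<omega> / m0) * indicator A \<omega> \<partial>restr_to_subalg P (F t))"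
    using A by (intro emeasure_density) (simp_all add: sets_restr_to_subalg[OF subalgebra_P] measurable_in_subalg[OF subalgebra_P])
  also have "\<dots> = (\<integral>\<^sup>+\<omega>. ennreal (Mt t \<omega> / m0) * indicator A \<omega> \<partial>P)"
    by (intro nn_integral_subalgebra2[OF subalgebra_P]) measurable
  also have "\<dots> = (\<integral>\<^sup>+\<omega>. ennreal (Mt t \<omega> / m0 * indicator A \<omega>) \<partial>P)"
    by (intro nn_integral_cong) (auto simp: indicator_def)
  also have "\<dots> = ennreal (\<integral>\<omega>. Mt t \<omega> / m0 * indicator A \<omega> \<partial>P)"
    using M_nonneg t m0_pos by (intro nn_integral_eq_integral[OF i] AE_I2) (auto simp: indicator_def)
  also have "(\<integral>\<omega>. Mt t \<omega> / m0 * indicator A \<omega> \<partial>P) = (\<integral>\<omega>. 1 / m0 * (indicator A \<omega> * Mt t \<omega>) \<partial>P)"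
    by (intro Bochner_Integration.integral_cong) auto
  also have "\<dots> = measure Q A" unfolding Q_eq_M[OF t A] by (rule integral_mult_right_zero)
  finally show "emeasure (restr_to_subalg Q (F t)) A = emeasure (density (restr_to_subalg P (F t)) (\<lambda>\<omega>. ennreal (Mt t \<omega> / m0))) A"
    using emeasure_restr_to_subalg[OF subalgebra_Q A] Q.emeasure_eq_measure by simp
qed

lemma nn_integral_Q:
  assumes t: "0 \<le> t" and f[measurable]: "f \<in> borel_measurable (F t)"
  shows "(\<integral>\<^sup>+\<omega>. f \<omega> \<partial>Q) = (\<integral>\<^sup>+\<omega>. ennreal (Mt t \<omega> / m0) * f \<omega> \<partial>P)"
proof -
  have [measurable]: "Mt t \<in> borel_measurable (F t)" by (rule pval_measurable[OF t glued_M])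
  have "(\<integral>\<^sup>+\<omega>. f \<omega> \<partial>Q) = (\<integral>\<^sup>+\<omega>. f \<omega> \<partial>restr_to_subalg Q (F t))"
    by (rule nn_integral_subalgebra2[OF subalgebra_Q f, symmetric])
  also have "\<dots> = (\<integral>\<^sup>+\<omega>. ennreal (Mt t \<omega> / m0) * f \<omega> \<partial>restr_to_subalg P (F t))"
    unfolding density_Q[OF t]
    by (intro nn_integral_density measurable_in_subalg[OF subalgebra_P]) measurable
  also have "\<dots> = (\<integral>\<^sup>+\<omega>. ennreal (Mt t \<omega> / m0) * f \<omega> \<partial>P)"
    by (intro nn_integral_subalgebra2[OF subalgebra_P]) measurable
  finally show ?thesis .
qed

lemma integral_Q:
  fixes f :: "(real \<Rightarrow> real) \<Rightarrow> complex"
  assumes t: "0 \<le> t" and f[measurable]: "f \<in> borel_measurable (F t)"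
  shows "(CLINT \<omega>|Q. f \<omega>) = (CLINT \<omega>|P. f \<omega> * Mt t \<omega>) / m0"
proof -
  have [measurable]: "Mt t \<in> borel_measurable (F t)" by (rule pval_measurable[OF t glued_M])
  have "(CLINT \<omega>|Q. f \<omega>) = (CLINT \<omega>|restr_to_subalg Q (F t). f \<omega>)"
    by (rule integral_subalgebra2[OF subalgebra_Q f, symmetric])
  also have "\<dots> = (CLINT \<omega>|restr_to_subalg P (F t). (Mt t \<omega> / m0) *\<^sub>R f \<omega>)"
    unfolding density_Q[OF t]
  proof (rule integral_density)
    show "AE \<omega> in restr_to_subalg P (F t). 0 \<le> Mt t \<omega> / m0"
      using M_nonneg t m0_pos by (intro AE_I2) (simp add: space_restr_to_subalg)
  qed (auto intro!: measurable_in_subalg[OF subalgebra_P])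
  also have "\<dots> = (CLINT \<omega>|P. (Mt t \<omega> / m0) *\<^sub>R f \<omega>)"
    by (intro integral_subalgebra2[OF subalgebra_P]) measurable
  also have "\<dots> = (CLINT \<omega>|P. (f \<omega> * Mt t \<omega>) / m0)"
    by (intro Bochner_Integration.integral_cong) (auto simp: scaleR_conv_of_real)
  also have "\<dots> = (CLINT \<omega>|P. f \<omega> * Mt t \<omega>) / m0" by (rule integral_divide_zero)
  finally show ?thesis .
qed

text \<open>The density cancels the singularity: M times the absolute drift is at most
  \<open>mc_max\<close>, so under \<open>Q\<close> the absolute drift has expectation at most
  \<open>mc_max / m0\<close> at each positive time. Tonelli gives integrability over [0, t].\<close>

lemma drift_integrable:
  "AE \<omega> in Q. \<forall>t. set_integrable lborel {0..t} (\<lambda>r. state drift_at r \<omega>)"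
proof -
  have one: "AE \<omega> in Q. set_integrable lborel {0..t} (\<lambda>r. state drift_at r \<omega>)" if t: "0 \<le> t" for t
  proof -
    interpret LQ: pair_sigma_finite lborel Q ..
    let ?f = "\<lambda>r \<omega>. ennreal \<bar>indicator {0..t} r * state drift_at r \<omega>\<bar>"
    have idm: "(\<lambda>p. (fst p, snd p)) \<in> measurable (lborel \<Otimes>\<^sub>M Q) (borel \<Otimes>\<^sub>M F t)"
    proof -
      have "(\<lambda>\<omega>. \<omega>) \<in> measurable Q (F t)"
        using subalgebra_Q[of t] by (auto intro!: measurableI simp: subalgebra_def)
      then show ?thesis by (intro measurable_Pair measurable_compose[OF measurable_snd]) auto
    qed
    have jm: "(\<lambda>p. indicator {0..t} (fst p) * state drift_at (fst p) (snd p)) \<in> borel_measurable (lborel \<Otimes>\<^sub>M Q)"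
      using measurable_compose[OF idm state_joint_measurable[OF t order_refl drift_at_measurable]] by simp
    have fm: "case_prod ?f \<in> borel_measurable (lborel \<Otimes>\<^sub>M Q)"
      using jm by (simp add: case_prod_beta')
    have "(\<integral>\<^sup>+\<omega>. (\<integral>\<^sup>+r. ?f r \<omega> \<partial>lborel) \<partial>Q) = (\<integral>\<^sup>+r. (\<integral>\<^sup>+\<omega>. ?f r \<omega> \<partial>Q) \<partial>lborel)"
      by (rule LQ.Fubini'[OF fm])
    also have "\<dots> \<le> (\<integral>\<^sup>+r. ennreal (mc_max / m0) * indicator {0..t} r \<partial>lborel)"
    proof (rule nn_integral_mono_AE)
      have "AE r in lborel. r \<noteq> (0::real)" by (rule AE_lborel_singleton)
      then show "AE r in lborel. (\<integral>\<^sup>+\<omega>. ?f r \<omega> \<partial>Q) \<le> ennreal (mc_max / m0) * indicator {0..t} r"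
      proof eventually_elim
        fix r :: real assume r0: "r \<noteq> 0"
        show "(\<integral>\<^sup>+\<omega>. ?f r \<omega> \<partial>Q) \<le> ennreal (mc_max / m0) * indicator {0..t} r"
        proof (cases "r \<in> {0..t}")
          case True
          then have r: "0 < r" "0 \<le> r" using r0 by auto
          have [measurable]: "(\<lambda>\<omega>. state drift_at r \<omega>) \<in> borel_measurable (F r)"
            by (rule lphase_fun_measurable[OF r(2) drift_at_measurable])
          have "(\<integral>\<^sup>+\<omega>. ?f r \<omega> \<partial>Q) = (\<integral>\<^sup>+\<omega>. ennreal \<bar>state drift_at r \<omega>\<bar> \<partial>Q)" using True by simp
          also have "\<dots> = (\<integral>\<^sup>+\<omega>. ennreal (Mt r \<omega> / m0) * ennreal \<bar>state drift_at r \<omega>\<bar> \<partial>P)"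
            by (rule nn_integral_Q[OF r(2)]) measurable
          also have "\<dots> \<le> (\<integral>\<^sup>+\<omega>. ennreal (mc_max / m0) \<partial>P)"
          proof (rule nn_integral_mono)
            fix \<omega> assume "\<omega> \<in> space P"
            then have \<omega>: "\<omega> \<in> path_space" by simp
            have M0: "0 \<le> Mt r \<omega>" by (rule M_nonneg[OF \<omega> r(2)])
            have "Mt r \<omega> * \<bar>state drift_at r \<omega>\<bar> \<le> mc_max"
              unfolding drift_at_def state_M[OF \<omega> r(1)] using M0 mc_bound[of "lphase r \<omega>"] ab
              by (cases "Mt r \<omega> = 0") (simp_all add: abs_divide)
            then have "Mt r \<omega> / m0 * \<bar>state drift_at r \<omega>\<bar> \<le> mc_max / m0"
              using divide_right_mono[OF _ less_imp_le[OF m0_pos]] unfolding times_divide_eq_left by blast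
            then show "ennreal (Mt r \<omega> / m0) * ennreal \<bar>state drift_at r \<omega>\<bar> \<le> ennreal (mc_max / m0)"
              using M0 m0_pos by (subst ennreal_mult'[symmetric]) (auto intro!: ennreal_leI)
          qed
          also have "\<dots> = ennreal (mc_max / m0)" by (simp add: emeasure_space_1[simplified])
          finally show ?thesis using True by simp
        qed simp
      qed
    qed
    also have "\<dots> = ennreal (mc_max / m0) * ennreal t"
      using t by (simp add: nn_integral_cmult_indicator)
    also have "\<dots> < \<infinity>" by (simp add: ennreal_mult_less_top)
    finally have fin: "(\<integral>\<^sup>+\<omega>. (\<integral>\<^sup>+r. ?f r \<omega> \<partial>lborel) \<partial>Q) \<noteq> \<infinity>" by simp
    have "(\<lambda>\<omega>. \<integral>\<^sup>+r. ?f r \<omega> \<partial>lborel) \<in> borel_measurable Q"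
      using jm by (intro lborel.borel_measurable_nn_integral) (simp add: case_prod_beta' measurable_split_conv measurable_pair_swap_iff[of _ Q])
    from nn_integral_PInf_AE[OF this fin] show ?thesis
      using AE_space
    proof eventually_elim
      fix \<omega> assume f: "(\<integral>\<^sup>+r. ?f r \<omega> \<partial>lborel) \<noteq> \<infinity>" and "\<omega> \<in> space Q"
      then have "\<omega> \<in> path_space" by (simp add: space_Q)
      note m = state_measurable_time[OF this order_refl drift_at_measurable, of t]
      show "set_integrable lborel {0..t} (\<lambda>r. state drift_at r \<omega>)"
        unfolding set_integrable_def
        by (rule integrableI_bounded) (use m f in \<open>auto simp: less_top\<close>)
    qed
  qed
  \<comment> \<open>Integer horizons yield a single exceptional null set for all t.\<close>
  have "AE \<omega> in Q. \<forall>n::nat. set_integrable lborel {0..real n} (\<lambda>r. state drift_at r \<omega>)"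
    by (subst AE_all_countable) (auto intro!: one)
  then show ?thesis
  proof eventually_elim
    fix \<omega> assume n: "\<forall>n::nat. set_integrable lborel {0..real n} (\<lambda>r. state drift_at r \<omega>)"
    show "\<forall>t. set_integrable lborel {0..t} (\<lambda>r. state drift_at r \<omega>)"
    proof
      fix t :: real
      obtain n :: nat where "t < real n" using reals_Archimedean2 by blast
      then show "set_integrable lborel {0..t} (\<lambda>r. state drift_at r \<omega>)"
        by (intro set_integrable_subset[OF n[rule_format, of n]]) auto
    qed
  qed
qed

lemma driftless_continuous: "AE \<omega> in Q. continuous_on {0..} (\<lambda>t. driftless t \<omega>)"
  using drift_integrable AE_space
proof eventually_elim
  fix \<omega> assume i: "\<forall>t. set_integrable lborel {0..t} (\<lambda>r. state drift_at r \<omega>)" and "\<omega> \<in> space Q"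
  then have \<omega>: "\<omega> \<in> path_space" by (simp add: space_Q)
  have eq: "driftless t \<omega> = \<omega> t - integral {0..t} (\<lambda>r. state drift_at r \<omega>)" if "0 \<le> t" for t
    unfolding driftless_def drift_integral_eq[OF \<omega> that]
    using set_borel_integral_eq_integral(2)[OF i[rule_format, of t]] by (simp add: set_lebesgue_integral_def)
  have "continuous_on {0..} (\<lambda>t. \<omega> t - integral {0..t} (\<lambda>r. state drift_at r \<omega>))"
  proof (rule continuous_on_diff[OF path_cont[OF \<omega>]])
    show "continuous_on {0..} (\<lambda>t. integral {0..t} (\<lambda>r. state drift_at r \<omega>))"
      unfolding continuous_on_eq_continuous_within
    proof
      fix t :: real assume t: "t \<in> {0..}"
      have "continuous_on {0..t + 1} (\<lambda>t. integral {0..t} (\<lambda>r. state drift_at r \<omega>))"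
        by (rule indefinite_integral_continuous_1[OF set_borel_integral_eq_integral(1)]) (use i in blast)
      then have "continuous (at t within {0..t + 1}) (\<lambda>t. integral {0..t} (\<lambda>r. state drift_at r \<omega>))"
        using t by (simp add: continuous_on_eq_continuous_within)
      moreover have "at t within {0..t + 1} = at t within {0..}"
        using t by (intro at_within_nhd[of t "{..<t + 1}"]) auto
      ultimately show "continuous (at t within {0..}) (\<lambda>t. integral {0..t} (\<lambda>r. state drift_at r \<omega>))" by simp
    qed
  qed
  then show "continuous_on {0..} (\<lambda>t. driftless t \<omega>)"
    by (rule continuous_on_cong[THEN iffD1, rotated 2]) (auto simp: eq)
qed

lemma driftless_increment:
  "AE \<omega> in Q. \<forall>s t. 0 \<le> s \<and> s \<le> t \<longrightarrow> set_integrable lborel {s..t} (\<lambda>r. state drift_at r \<omega>) \<and>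
     driftless t \<omega> - driftless s \<omega> = \<omega> t - \<omega> s - (\<integral>r. indicator {s..t} r * state drift_at r \<omega> \<partial>lborel)"
  using drift_integrable AE_space
proof eventually_elim
  fix \<omega> assume i: "\<forall>t. set_integrable lborel {0..t} (\<lambda>r. state drift_at r \<omega>)" and "\<omega> \<in> space Q"
  then have \<omega>: "\<omega> \<in> path_space" by (simp add: space_Q)
  have eq: "driftless t \<omega> = \<omega> t - integral {0..t} (\<lambda>r. state drift_at r \<omega>)" if "0 \<le> t" for t
    unfolding driftless_def drift_integral_eq[OF \<omega> that]
    using set_borel_integral_eq_integral(2)[OF i[rule_format, of t]] by (simp add: set_lebesgue_integral_def)
  show "\<forall>s t. 0 \<le> s \<and> s \<le> t \<longrightarrow> set_integrable lborel {s..t} (\<lambda>r. state drift_at r \<omega>) \<and>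
     driftless t \<omega> - driftless s \<omega> = \<omega> t - \<omega> s - (\<integral>r. indicator {s..t} r * state drift_at r \<omega> \<partial>lborel)"
  proof (intro allI impI)
    fix s t :: real assume st: "0 \<le> s \<and> s \<le> t"
    have si: "set_integrable lborel {s..t} (\<lambda>r. state drift_at r \<omega>)"
      by (rule set_integrable_subset[OF i[rule_format, of t]]) (use st in auto)
    have "integral {0..s} (\<lambda>r. state drift_at r \<omega>) + integral {s..t} (\<lambda>r. state drift_at r \<omega>) = integral {0..t} (\<lambda>r. state drift_at r \<omega>)"
      by (rule Henstock_Kurzweil_Integration.integral_combine)
         (use st set_borel_integral_eq_integral(1)[OF i[rule_format, of t]] in auto)
    then show "set_integrable lborel {s..t} (\<lambda>r. state drift_at r \<omega>) \<and>
       driftless t \<omega> - driftless s \<omega> = \<omega> t - \<omega> s - (\<integral>r. indicator {s..t} r * state drift_at r \<omega> \<partial>lborel)"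
      using st si eq[of s] eq[of t] set_borel_integral_eq_integral(2)[OF si] by (simp add: set_lebesgue_integral_def)
  qed
qed

text \<open>The variables \<open>H n\<close> with truncated drift have expectations converging to
  the Gaussian value by \<open>girsanov_estimate\<close> and \<open>residual_tendsto\<close>. Almost
  surely under \<open>Q\<close> they also converge to the variable with the true drift, the
  integrable drift itself being the majorant in time; the two limits must agree.\<close>

lemma driftless_char:
  assumes st: "0 \<le> s" "s < t" and A: "A \<in> sets (F s)"
  shows "(CLINT \<omega>|Q. indicator A \<omega> * iexp (l * (driftless t \<omega> - driftless s \<omega>))) = measure Q A * exp (- (l\<^sup>2 * (t - s) / 2))"
proof -
  have t0: "0 \<le> t" and st': "s \<le> t" using st by auto
  let ?e = "\<lambda>n. 1 / real (Suc n)"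
  have e0: "0 < ?e n" for n by simp
  let ?V = "\<lambda>n \<omega>. iexp (- l * integral {s..t} (\<lambda>q. state (drift_trunc (?e n)) q \<omega>))"
  define H where "H n \<omega> = indicator A \<omega> * iexp (l * (\<omega> t - \<omega> s)) * ?V n \<omega>" for n \<omega>
  have AFt: "A \<in> sets (F t)" using A subalgebra_path_filtration[OF st'] by (auto simp: subalgebra_def)
  have AQ: "A \<in> sets Q" using A subalgebra_Q[of s] by (auto simp: subalgebra_def)
  have Hm: "H n \<in> borel_measurable (F t)" for n
  proof -
    note [measurable] = AFt state_integral_measurable[of t s "drift_trunc (?e n)", OF t0 st(1) drift_trunc_measurable drift_trunc_bound[OF e0]]
      coord_measurable_filtration[OF st(1) st'] coord_measurable_filtration[OF t0 order_refl]
    show ?thesis unfolding H_def[abs_def] by measurable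
  qed
  have HQ: "H n \<in> borel_measurable Q" for n by (rule measurable_from_subalg[OF subalgebra_Q Hm])
  have Hb: "norm (H n \<omega>) \<le> 1" for n \<omega> by (simp add: H_def norm_mult indicator_def)
  let ?ex = "complex_of_real (exp (- (l\<^sup>2 * (t - s) / 2)))"
  have QA: "measure Q A = (CLINT \<omega>|P. indicator A \<omega> * complex_of_real (Mt s \<omega>)) / m0"
  proof -
    have "(CLINT \<omega>|P. indicator A \<omega> * complex_of_real (Mt s \<omega>)) = (CLINT \<omega>|P. complex_of_real (indicator A \<omega> * Mt s \<omega>))"
      by (intro Bochner_Integration.integral_cong) (auto simp: indicator_def)
    also have "\<dots> = complex_of_real (\<integral>\<omega>. indicator A \<omega> * Mt s \<omega> \<partial>P)" by (rule integral_complex_of_real)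
    finally show ?thesis unfolding Q_eq_M[OF st(1) A] by simp
  qed
  have lim1: "(\<lambda>n. (CLINT \<omega>|Q. H n \<omega>)) \<longlonglongrightarrow> ?ex * measure Q A"
  proof (rule LIM_zero_cancel, rule Lim_null_comparison)
    let ?r = "\<lambda>n. \<integral>r. indicator {s<..t} r * (\<integral>\<omega>. \<bar>state (drift_resid (?e n)) r \<omega>\<bar> \<partial>P) \<partial>lborel"
    show "\<forall>\<^sub>F n in sequentially. norm ((CLINT \<omega>|Q. H n \<omega>) - ?ex * measure Q A) \<le> \<bar>l\<bar> * ?r n / m0"
    proof (intro always_eventually allI)
      fix n
      have "(CLINT \<omega>|Q. H n \<omega>) - ?ex * measure Q A =
        ((CLINT \<omega>|P. H n \<omega> * Mt t \<omega>) - ?ex * (CLINT \<omega>|P. indicator A \<omega> * complex_of_real (Mt s \<omega>))) / m0"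
        unfolding integral_Q[OF t0 Hm] QA by (simp add: diff_divide_distrib)
      then have "norm ((CLINT \<omega>|Q. H n \<omega>) - ?ex * measure Q A) =
          norm ((CLINT \<omega>|P. H n \<omega> * Mt t \<omega>) - ?ex * (CLINT \<omega>|P. indicator A \<omega> * complex_of_real (Mt s \<omega>))) / m0"
        using m0_pos by (simp only: norm_divide norm_of_real abs_of_pos)
      also have "\<dots> \<le> \<bar>l\<bar> * ?r n / m0"
        unfolding H_def using m0_pos by (intro divide_right_mono girsanov_estimate[OF st(1) st' A e0]) auto
      finally show "norm ((CLINT \<omega>|Q. H n \<omega>) - ?ex * measure Q A) \<le> \<bar>l\<bar> * ?r n / m0" .
    qed
    have "(\<lambda>n. \<bar>l\<bar> * ?r n / m0) \<longlonglongrightarrow> \<bar>l\<bar> * 0 / m0"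
      using m0_pos by (intro tendsto_intros residual_tendsto[OF st(1) st']) auto
    then show "(\<lambda>n. \<bar>l\<bar> * ?r n / m0) \<longlonglongrightarrow> 0" by simp
  qed
  let ?L = "\<lambda>\<omega>. indicator A \<omega> * iexp (l * (driftless t \<omega> - driftless s \<omega>))"
  have lim2: "(\<lambda>n. (CLINT \<omega>|Q. H n \<omega>)) \<longlonglongrightarrow> (CLINT \<omega>|Q. ?L \<omega>)"
  proof (rule integral_dominated_convergence[where w="\<lambda>_. 1"])
    have "driftless t \<in> borel_measurable Q" "driftless s \<in> borel_measurable Q"
      using driftless_measurable t0 st(1) by (auto intro: measurable_from_subalg[OF subalgebra_Q])
    then show "?L \<in> borel_measurable Q" using AQ by measurable
    show "AE \<omega> in Q. (\<lambda>n. H n \<omega>) \<longlonglongrightarrow> ?L \<omega>"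
      using driftless_increment AE_space
    proof eventually_elim
      fix \<omega> assume inc: "\<forall>s t. 0 \<le> s \<and> s \<le> t \<longrightarrow> set_integrable lborel {s..t} (\<lambda>r. state drift_at r \<omega>) \<and>
         driftless t \<omega> - driftless s \<omega> = \<omega> t - \<omega> s - (\<integral>r. indicator {s..t} r * state drift_at r \<omega> \<partial>lborel)" and "\<omega> \<in> space Q"
      then have \<omega>: "\<omega> \<in> path_space" by (simp add: space_Q)
      have si: "set_integrable lborel {s..t} (\<lambda>r. state drift_at r \<omega>)"
        and d: "driftless t \<omega> - driftless s \<omega> = \<omega> t - \<omega> s - (\<integral>r. indicator {s..t} r * state drift_at r \<omega> \<partial>lborel)"
        using inc st(1) st' by auto
      have conv: "(\<lambda>n. \<integral>r. indicator {s..t} r * state (drift_trunc (?e n)) r \<omega> \<partial>lborel) \<longlonglongrightarrow> (\<integral>r. indicator {s..t} r * state drift_at r \<omega> \<partial>lborel)"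
      proof (rule integral_dominated_convergence[where w="\<lambda>r. \<bar>indicator {s..t} r * state drift_at r \<omega>\<bar>"])
        show "(\<lambda>r. indicator {s..t} r * state drift_at r \<omega>) \<in> borel_measurable lborel"
          using state_measurable_time[OF \<omega> st(1) drift_at_measurable, of t] by simp
        show "(\<lambda>r. indicator {s..t} r * state (drift_trunc (?e n)) r \<omega>) \<in> borel_measurable lborel" for n
          using state_measurable_time[OF \<omega> st(1) drift_trunc_measurable, of t] by simp
        show "integrable lborel (\<lambda>r. \<bar>indicator {s..t} r * state drift_at r \<omega>\<bar>)"
          using si by (intro integrable_abs) (simp add: set_integrable_def)
        have nz: "AE r in lborel. r \<noteq> (0::real)" by (rule AE_lborel_singleton)
        then show "AE r in lborel. (\<lambda>n. indicator {s..t} r * state (drift_trunc (?e n)) r \<omega>) \<longlonglongrightarrow> indicator {s..t} r * state drift_at r \<omega>"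
        proof eventually_elim
          fix r :: real assume "r \<noteq> 0"
          then show "(\<lambda>n. indicator {s..t} r * state (drift_trunc (?e n)) r \<omega>) \<longlonglongrightarrow> indicator {s..t} r * state drift_at r \<omega>"
          proof (cases "r \<in> {s..t}")
            case True
            then have "0 < r" using \<open>r \<noteq> 0\<close> st by auto
            from drift_trunc_tendsto[OF state_M_nonneg[OF \<omega> this]]
            show ?thesis unfolding drift_at_def by (intro tendsto_mult_left)
          qed simp
        qed
        show "AE r in lborel. norm (indicator {s..t} r * state (drift_trunc (?e n)) r \<omega>) \<le> \<bar>indicator {s..t} r * state drift_at r \<omega>\<bar>" for n
          using nz
        proof eventually_elim
          fix r :: real assume "r \<noteq> 0"
          then show "norm (indicator {s..t} r * state (drift_trunc (?e n)) r \<omega>) \<le> \<bar>indicator {s..t} r * state drift_at r \<omega>\<bar>"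
          proof (cases "r \<in> {s..t}")
            case True
            then have "0 < r" using \<open>r \<noteq> 0\<close> st by auto
            from drift_trunc_le[OF e0 state_M_nonneg[OF \<omega> this], of n] True show ?thesis by (simp add: drift_at_def)
          qed simp
        qed
      qed
      have int: "integral {s..t} (\<lambda>q. state (drift_trunc (?e n)) q \<omega>) = (\<integral>r. indicator {s..t} r * state (drift_trunc (?e n)) r \<omega> \<partial>lborel)" for n
        by (rule state_integrable(3)[OF \<omega> st(1) drift_trunc_measurable drift_trunc_bound[OF e0]])
      have "(\<lambda>n. H n \<omega>) \<longlonglongrightarrow> indicator A \<omega> * iexp (l * (\<omega> t - \<omega> s)) * iexp (- l * (\<integral>r. indicator {s..t} r * state drift_at r \<omega> \<partial>lborel))"
        unfolding H_def int by (intro tendsto_intros conv)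
      moreover have "iexp (l * (\<omega> t - \<omega> s)) * iexp (- l * (\<integral>r. indicator {s..t} r * state drift_at r \<omega> \<partial>lborel)) =
          iexp (l * (driftless t \<omega> - driftless s \<omega>))"
        unfolding d exp_add[symmetric] by (simp add: algebra_simps)
      ultimately show "(\<lambda>n. H n \<omega>) \<longlonglongrightarrow> ?L \<omega>" by (simp only: mult.assoc)
    qed
    show "AE \<omega> in Q. norm (H n \<omega>) \<le> 1" for n using Hb by (intro AE_I2)
  qed (use HQ in auto)
  have "(CLINT \<omega>|Q. ?L \<omega>) = ?ex * measure Q A" by (rule LIMSEQ_unique[OF lim2 lim1])
  then show ?thesis by (simp add: mult.commute)
qed

text \<open>On \<open>F 0\<close> the measure \<open>Q\<close> has a density with respect to
  \<open>P\<close>, so the null event carries over.\<close>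

lemma start_zero_Q: "AE \<omega> in Q. \<omega> 0 = 0"
proof -
  let ?f = "\<lambda>\<omega>. indicator {x. x \<noteq> (0::real)} (\<omega> 0) :: ennreal"
  have [measurable]: "(\<lambda>\<omega>. \<omega> 0) \<in> borel_measurable (F 0)" by (intro coord_measurable_filtration) auto
  have fm: "?f \<in> borel_measurable (F 0)" by measurable
  have "(\<integral>\<^sup>+\<omega>. ?f \<omega> \<partial>Q) = (\<integral>\<^sup>+\<omega>. ennreal (Mt 0 \<omega> / m0) * ?f \<omega> \<partial>P)"
    by (rule nn_integral_Q[OF order_refl fm])
  also have "\<dots> = (\<integral>\<^sup>+\<omega>. 0 \<partial>P)"
  proof (rule nn_integral_cong_AE)
    show "AE \<omega> in P. ennreal (Mt 0 \<omega> / m0) * ?f \<omega> = 0" using start_zero by eventually_elim simp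
  qed
  finally have "(\<integral>\<^sup>+\<omega>. ?f \<omega> \<partial>Q) = 0" by simp
  then have "AE \<omega> in Q. ?f \<omega> = 0"
    using measurable_from_subalg[OF subalgebra_Q fm] by (subst (asm) nn_integral_0_iff_AE) auto
  then show ?thesis by eventually_elim (auto simp: indicator_def split: if_splits)
qed

theorem driftless_brownian_motion:
  "brownian_motion Q F driftless"
  unfolding brownian_motion_def
proof (intro conjI allI impI)
  show "prob_space Q" by (rule Q.prob_space_axioms)
  show "driftless t \<in> borel_measurable (F t)" if "0 \<le> t" for t by (rule driftless_measurable[OF that])
  show "AE \<omega> in Q. driftless 0 \<omega> = 0"
    using start_zero_Q AE_space
  proof eventually_elim
    fix \<omega> assume "\<omega> 0 = 0" "\<omega> \<in> space Q"
    moreover have "(\<integral>r. indicator {0..0::real} r * state drift_at r \<omega> \<partial>lborel) = (\<integral>r. 0 \<partial>(lborel :: real measure))"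
      by (rule integral_discrete_difference[of "{0}"]) (auto simp: indicator_def)
    ultimately show "driftless 0 \<omega> = 0"
      using drift_integral_eq[of \<omega> 0] unfolding driftless_def space_Q by (simp only: order_refl) simp
  qed
  show "AE \<omega> in Q. continuous_on {0..} (\<lambda>t. driftless t \<omega>)" by (rule driftless_continuous)
  fix s t :: real assume st: "0 \<le> s \<and> s < t"
  have "gaussian_indep Q (F s) (t - s) (\<lambda>\<omega>. driftless t \<omega> - driftless s \<omega>)"
  proof (rule gaussian_indepI_char[OF Q.prob_space_axioms subalgebra_Q])
    have "driftless t \<in> borel_measurable Q" "driftless s \<in> borel_measurable Q"
      using st by (auto intro!: measurable_from_subalg[OF subalgebra_Q driftless_measurable])
    then show "(\<lambda>\<omega>. driftless t \<omega> - driftless s \<omega>) \<in> borel_measurable Q" by measurable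
    show "0 < t - s" using st by simp
    fix A l assume "A \<in> sets (F s)"
    then show "(CLINT \<omega>|Q. indicator A \<omega> * iexp (l * (driftless t \<omega> - driftless s \<omega>))) = measure Q A * exp (- (l\<^sup>2 * (t - s) / 2))"
      using driftless_char st by auto
  qed
  then show "distributed Q lborel (\<lambda>\<omega>. driftless t \<omega> - driftless s \<omega>) (normal_density 0 (sqrt (t - s)))"
    and "Q.indep_set (sets (F s)) {(\<lambda>\<omega>. driftless t \<omega> - driftless s \<omega>) -` A \<inter> space Q | A. A \<in> sets borel}"
    by (auto simp: gaussian_indep_def)
qed

end

theorem theorem3p21:
  fixes a b :: real
    and G :: "nat \<Rightarrow> real"
    and P :: "(real \<Rightarrow> real) measure"
  assumes "wiener_measure P"
    and "a < b"
    and "\<forall>n. 0 \<le> G n"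
    and "antimono G"
    and "G 0 = 1"
    and "G \<longlonglongrightarrow> 0"
  shows "\<exists>m0. (AE \<omega> in P. M_down a b G 0 \<omega> = m0) \<and>
    (\<forall>s\<ge>0. \<forall>\<Gamma>\<in>sets (path_filtration s).
       ((\<lambda>t. (\<integral>\<omega>. indicator \<Gamma> \<omega> * Delta G (downcrossings a b t \<omega>) \<partial>P) /
             (\<integral>\<omega>. Delta G (downcrossings a b t \<omega>) \<partial>P))
        \<longlongrightarrow> 1 / m0 * (\<integral>\<omega>. indicator \<Gamma> \<omega> * M_down a b G s \<omega> \<partial>P)) at_top) \<and>
    (\<forall>Q. prob_space Q \<and> sets Q = sets path_algebra \<and>
         (\<forall>s\<ge>0. \<forall>\<Gamma>\<in>sets (path_filtration s).
            measure Q \<Gamma> = 1 / m0 * (\<integral>\<omega>. indicator \<Gamma> \<omega> * M_down a b G s \<omega> \<partial>P)) \<longrightarrow>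
       brownian_motion Q path_filtration
         (\<lambda>t \<omega>. \<omega> t - (LBINT s:{0..t}. drift_down a b G s \<omega>)))"
proof -
  interpret downcross a b P G
    using assms by unfold_locales auto
  have 1: "AE \<omega> in P. M_down a b G 0 \<omega> = m0"
    using M_0 AE_space by eventually_elim (simp add: M_down_eq)
  have 2: "brownian_motion Q path_filtration (\<lambda>t \<omega>. \<omega> t - (LBINT s:{0..t}. drift_down a b G s \<omega>))"
    if Q: "prob_space Q" "sets Q = sets path_algebra" and
      eq: "\<forall>s\<ge>0. \<forall>\<Gamma>\<in>sets (path_filtration s). measure Q \<Gamma> = 1 / m0 * (\<integral>\<omega>. indicator \<Gamma> \<omega> * M_down a b G s \<omega> \<partial>P)"
    for Q
  proof -
    interpret Q: prob_space Q by fact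
    interpret penalised a b P G Q
      using Q eq by unfold_locales auto
    show ?thesis using driftless_brownian_motion unfolding driftless_def[abs_def] .
  qed
  show ?thesis
    using 1 2 penalisation_limit by (intro exI[of _ m0]) blast
qed

end
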